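(* Let $(M,g)$ be a transverse Riemann-Lorentz space with tangent radical and singular hypersurface $\Sigma$. (a) Let $\mathcal A,\mathcal B\in\mathfrak{X}(M)$ be such that $\mathrm{rank}(g_{\mathcal A\wedge\mathcal B})=2$, with restrictions $A,B$ to $\Sigma$. Then $K_{\mathcal A^o\wedge\mathcal B^o}\cong0$ if and only if $\Upsilon(A,B,A,B)=0$. (b) Consider the assertions: (1) for all such $A,B$: if $\det\begin{pmatrix}\nu(A)&\nu(B)\\ \rho(A)&\rho(B)\end{pmatrix}=0$ then $\Upsilon(A,B,A,B)=0$; (2) $\Sigma$ is $II$-flat; (3) for all such $A,B$: if $\Upsilon(A,B,A,B)=0$ then $\det\begin{pmatrix}\nu(A)&\nu(B)\\ \rho(A)&\rho(B)\end{pmatrix}=0$. Then (1) $\Leftrightarrow$ (2) $\Rightarrow$ (3).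
   Context: $M$ is a connected smooth manifold of dimension $m>2$ with a smooth symmetric $(0,2)$-tensor field $g=\langle\cdot,\cdot\rangle$ which fails to have maximal rank exactly on a nonempty set $\Sigma\subset M$. $(M,g)$ is a transverse singular space if in every local coordinate system $\det(g_{ab})$ has nonzero differential at the points of $\Sigma$; then $\Sigma$ is a smooth hypersurface (the singular hypersurface) and the radical $Rad_p=\{v\in T_pM: g(v,\cdot)=0\}$, $p\in\Sigma$, is one-dimensional. Tangent radical: $Rad_p\subset T_p\Sigma$ for all $p\in\Sigma$. Riemann-Lorentz: the signature of $g$ changes from Riemannian to Lorentzian across $\Sigma$. $\mathfrak{X}_\Sigma$: smooth vector fields along $\Sigma$; $\mathfrak{X}(\Sigma)$: those tangent to $\Sigma$. For $\mathcal A\in\mathfrak{X}(M)$, $\mathcal A^o=\mathcal A|_{M-\Sigma}$; $\mathcal A$ is an extension of $A=\mathcal A|_\Sigma$. Everything is local: $M$ may be replaced by a small neighbourhood of (a point of) $\Sigma$, and vector fields may be only locally defined. Dual connection: $2\square_{\mathcal A}\mathcal B(\mathcal C)=\mathcal A\langle\mathcal B,\mathcal C\rangle+\mathcal B\langle\mathcal C,\mathcal A\rangle-\mathcal C\langle\mathcal A,\mathcal B\rangle+\langle[\mathcal A,\mathcal B],\mathcal C\rangle-\langle[\mathcal B,\mathcal C],\mathcal A\rangle+\langle[\mathcal C,\mathcal A],\mathcal B\rangle$. For a radical vector field $R'$ along $\Sigma$, $II_{R'}(A,B):=\square_AB(R')$ is a well-defined symmetric $C^\infty(\Sigma)$-bilinear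 map on $\mathfrak{X}_\Sigma$. The main normal $N\in\mathfrak{X}_\Sigma$ satisfies $\langle N,T\Sigma\rangle=0$, $II_{R'}(N,N)=0$ for radical $R'$, $\langle N,N\rangle=1$ (unique up to sign). Second fundamental form: the symmetric tensor $\mathcal H(X,Y):=\square_XY(N)=-\square_XN(Y)$ on $\Sigma$. The main radical vector field $R\in\mathfrak{X}(\Sigma)$ is in the radical distribution with $\mathcal H(R,R)=-1$ (unique up to sign, the sign of $N$ being chosen to make this possible). $II:=II_R$. Canonical screen distribution: $S_p:=\{v\in T_p\Sigma:\mathcal H(v,R(p))=0\}$, a complement of $Rad_p$ in $T_p\Sigma$; $\Gamma(S)$ is its module of sections. $\Sigma$ is $II$-flat if $II(V,W)=0$ for all $V,W\in\Gamma(S)$ (equivalently $II(X,Y)=0$ for all $X,Y\in\mathfrak{X}(\Sigma)$). Each $A\in\mathfrak{X}_\Sigma$ decomposes as $A=\nu(A)N+A^S+\rho(A)R$ with $A^S\in\Gamma(S)$, $\nu(A)=\langle A,N\rangle$, $\rho(A)=-\mathcal H(A-\nu(A)N,R)$. Let $\nabla$ be the Levi-Civita connection on $M-\Sigma$, with curvature $R(\mathcal A,\mathcal B)\mathcal C=\nabla_{\mathcal A}\nabla_{\mathcal B}\mathcal C-\nabla_{\mathcal B}\nabla_{\mathcal A}\mathcal C-\nabla_{[\mathcal A,\mathcal B]}\mathcal C$. $N$ has a unique local extension $\mathcal N\in\mathfrak{X}(M)$ which is $\nabla$-geodesic on $M-\Sigma$; the canonical extension of $A\in\mathfrak{X}_\Sigma$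 is the unique extension $\mathcal A$ with $[\mathcal N,\mathcal A]=0$. Let $\mathcal R$ be the canonical extension of $R$ and $\tau:=\langle\mathcal R,\mathcal R\rangle$ (then $\tau=0$ on $\Sigma$ and $d\tau\neq0$ there). $\Upsilon$ is the smooth $(0,4)$-tensor field on $M$ given on $M-\Sigma$ by $\Upsilon(\mathcal A,\mathcal B,\mathcal C,\mathcal D)=\tau\langle R(\mathcal A,\mathcal B)\mathcal C,\mathcal D\rangle$; on $\Sigma$, $\Upsilon(A,B,C,D)=II(A,C)II(B,D)-II(A,D)II(B,C)$. For linearly independent $\mathcal A,\mathcal B$, $g_{\mathcal A\wedge\mathcal B}$ is the Gram matrix of $\mathcal A,\mathcal B$ (restriction of $g$ to the plane they span); $\mathrm{rank}(g_{\mathcal A\wedge\mathcal B})=2$ is required at all points, including those of $\Sigma$. Sectional curvature on $M-\Sigma$ (paper's sign convention): $K_{\mathcal A^o\wedge\mathcal B^o}:=\langle R(\mathcal A^o,\mathcal B^o)\mathcal A^o,\mathcal B^o\rangle/\det(g_{\mathcal A^o\wedge\mathcal B^o})$. For a smooth function $F$ on $M-\Sigma$, $F\cong0$ means that $F$ extends smoothly to $M$. *)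

theory Defs
  imports "HOL-Analysis.Analysis"
begin

section \<open>Smooth manifolds\<close>

primrec Ck_on :: "nat \<Rightarrow> 'v::real_normed_vector set \<Rightarrow> ('v \<Rightarrow> 'w::real_normed_vector) \<Rightarrow> bool" where
  "Ck_on 0 = (\<lambda>S f. continuous_on S f)"
| "Ck_on (Suc k) = (\<lambda>S f. (\<forall>x\<in>S. f differentiable (at x)) \<and>
      (\<forall>v. Ck_on k S (\<lambda>x. frechet_derivative f (at x) v)))"

definition smooth_on :: "'v::real_normed_vector set \<Rightarrow> ('v \<Rightarrow> 'w::real_normed_vector) \<Rightarrow> bool" where
  "smooth_on S f \<longleftrightarrow> (\<forall>k. Ck_on k S f)"

text \<open>\<^const>\<open>smooth_on\<close> is only meant for, and only used with, open subsets of a finite-dimensional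
  space. A chart is a pair of its domain and its coordinate map; the manifold is the whole
  topological type, and is given by its maximal atlas \<open>M\<close>. Its dimension is \<open>CARD('m)\<close>.\<close>

type_synonym ('a, 'm) chart = "'a set \<times> ('a \<Rightarrow> real ^ 'm)"

definition is_chart :: "('a::topological_space, 'm::finite) chart \<Rightarrow> bool" where
  "is_chart c \<longleftrightarrow> open (fst c) \<and> open (snd c ` fst c) \<and>
     homeomorphism (fst c) (snd c ` fst c) (snd c) (inv_into (fst c) (snd c))"

definition compatible :: "('a::topological_space, 'm::finite) chart \<Rightarrow> ('a, 'm) chart \<Rightarrow> bool" where
  "compatible c d \<longleftrightarrow>
     smooth_on (snd c ` (fst c \<inter> fst d)) (snd d \<circ> inv_into (fst c) (snd c)) \<and>
     smooth_on (snd d ` (fst c \<inter> fst d)) (snd c \<circ> inv_into (fst d) (snd d))"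

definition smooth_structure :: "('a::topological_space, 'm::finite) chart set \<Rightarrow> bool" where
  "smooth_structure M \<longleftrightarrow>
     (\<forall>c\<in>M. is_chart c) \<and> (\<Union>c\<in>M. fst c) = UNIV \<and> (\<forall>c\<in>M. \<forall>d\<in>M. compatible c d) \<and>
     (\<forall>c. is_chart c \<and> (\<forall>d\<in>M. compatible c d) \<longrightarrow> c \<in> M)"

definition smooth_fun ::
    "('a::topological_space, 'm::finite) chart set \<Rightarrow> 'a set \<Rightarrow> ('a \<Rightarrow> real) \<Rightarrow> bool" where
  "smooth_fun M W f \<longleftrightarrow>
     (\<forall>c\<in>M. smooth_on (snd c ` (fst c \<inter> W)) (f \<circ> inv_into (fst c) (snd c)))"

definition smooth_near ::
    "('a::topological_space, 'm::finite) chart set \<Rightarrow> 'a \<Rightarrow> ('a \<Rightarrow> real) \<Rightarrow> bool" where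
  "smooth_near M p f \<longleftrightarrow> (\<exists>W. open W \<and> p \<in> W \<and> smooth_fun M W f)"

section \<open>Tangent vectors, vector fields and tensor fields\<close>

text \<open>Tangent vectors at \<open>p\<close> are the derivations of the algebra of germs at \<open>p\<close> of smooth functions.
  As functions on all of \<open>'a \<Rightarrow> real\<close> they are made unique by the value \<open>0\<close> where the argument is
  not smooth near \<open>p\<close>. Sums, multiples and the zero vector are pointwise.\<close>

type_synonym 'a tvec = "('a \<Rightarrow> real) \<Rightarrow> real"
type_synonym 'a vfield = "'a \<Rightarrow> 'a tvec"

definition tangent_space ::
    "('a::topological_space, 'm::finite) chart set \<Rightarrow> 'a \<Rightarrow> 'a tvec set" where
  "tangent_space M p = {v.
     (\<forall>f. \<not> smooth_near M p f \<longrightarrow> v f = 0) \<and>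
     (\<forall>f h. smooth_near M p f \<and> smooth_near M p h \<and> (\<forall>\<^sub>F q in nhds p. f q = h q) \<longrightarrow> v f = v h) \<and>
     (\<forall>f h a b. smooth_near M p f \<and> smooth_near M p h \<longrightarrow>
        v (\<lambda>q. a * f q + b * h q) = a * v f + b * v h) \<and>
     (\<forall>f h. smooth_near M p f \<and> smooth_near M p h \<longrightarrow>
        v (\<lambda>q. f q * h q) = v f * h p + f p * v h)}"

text \<open>The coordinate vector of the \<open>i\<close>-th coordinate of the chart \<open>c\<close> at \<open>p\<close>.\<close>

definition coord_vec ::
    "('a::topological_space, 'm::finite) chart set \<Rightarrow> ('a, 'm) chart \<Rightarrow> 'm \<Rightarrow> 'a vfield" where
  "coord_vec M c i p = (\<lambda>f. if smooth_near M p f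
     then frechet_derivative (f \<circ> inv_into (fst c) (snd c)) (at (snd c p)) (axis i 1) else 0)"

definition vector_field ::
    "('a::topological_space, 'm::finite) chart set \<Rightarrow> 'a set \<Rightarrow> 'a vfield \<Rightarrow> bool" where
  "vector_field M W X \<longleftrightarrow> (\<forall>p\<in>W. X p \<in> tangent_space M p) \<and>
     (\<forall>V f. open V \<and> V \<subseteq> W \<and> smooth_fun M V f \<longrightarrow> smooth_fun M V (\<lambda>p. X p f))"

definition lie_bracket ::
    "('a::topological_space, 'm::finite) chart set \<Rightarrow> 'a vfield \<Rightarrow> 'a vfield \<Rightarrow> 'a vfield" where
  "lie_bracket M X Y p = (\<lambda>f. if smooth_near M p f
     then X p (\<lambda>q. Y q f) - Y p (\<lambda>q. X q f) else 0)"

definition linear_form ::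
    "('a::topological_space, 'm::finite) chart set \<Rightarrow> 'a \<Rightarrow> ('a tvec \<Rightarrow> real) \<Rightarrow> bool" where
  "linear_form M p L \<longleftrightarrow>
     (\<forall>u\<in>tangent_space M p. \<forall>v\<in>tangent_space M p. \<forall>a b.
        L (\<lambda>f. a * u f + b * v f) = a * L u + b * L v)"

definition smooth_tensor2 ::
    "('a::topological_space, 'm::finite) chart set \<Rightarrow> 'a set \<Rightarrow>
     ('a \<Rightarrow> 'a tvec \<Rightarrow> 'a tvec \<Rightarrow> real) \<Rightarrow> bool" where
  "smooth_tensor2 M U T \<longleftrightarrow>
     (\<forall>p\<in>U. \<forall>u\<in>tangent_space M p.
        linear_form M p (\<lambda>x. T p x u) \<and> linear_form M p (\<lambda>x. T p u x)) \<and>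
     (\<forall>W X Y. open W \<and> W \<subseteq> U \<and> vector_field M W X \<and> vector_field M W Y \<longrightarrow>
        smooth_fun M W (\<lambda>p. T p (X p) (Y p)))"

definition smooth_tensor4 ::
    "('a::topological_space, 'm::finite) chart set \<Rightarrow> 'a set \<Rightarrow>
     ('a \<Rightarrow> 'a tvec \<Rightarrow> 'a tvec \<Rightarrow> 'a tvec \<Rightarrow> 'a tvec \<Rightarrow> real) \<Rightarrow> bool" where
  "smooth_tensor4 M U T \<longleftrightarrow>
     (\<forall>p\<in>U. \<forall>u\<in>tangent_space M p. \<forall>v\<in>tangent_space M p. \<forall>w\<in>tangent_space M p.
        linear_form M p (\<lambda>x. T p x u v w) \<and> linear_form M p (\<lambda>x. T p u x v w) \<and>
        linear_form M p (\<lambda>x. T p u v x w) \<and> linear_form M p (\<lambda>x. T p u v w x)) \<and>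
     (\<forall>W X Y Z V. open W \<and> W \<subseteq> U \<and> vector_field M W X \<and> vector_field M W Y \<and>
        vector_field M W Z \<and> vector_field M W V \<longrightarrow>
        smooth_fun M W (\<lambda>p. T p (X p) (Y p) (Z p) (V p)))"

section \<open>Transverse Riemann-Lorentz metrics\<close>

type_synonym 'a metric_field = "'a \<Rightarrow> 'a tvec \<Rightarrow> 'a tvec \<Rightarrow> real"

definition smooth_symmetric ::
    "('a::topological_space, 'm::finite) chart set \<Rightarrow> 'a metric_field \<Rightarrow> bool" where
  "smooth_symmetric M g \<longleftrightarrow> smooth_tensor2 M UNIV g \<and>
     (\<forall>p. \<forall>u\<in>tangent_space M p. \<forall>v\<in>tangent_space M p. g p u v = g p v u)"

definition coord_metric ::
    "('a::topological_space, 'm::finite) chart set \<Rightarrow> 'a metric_field \<Rightarrow> ('a, 'm) chart \<Rightarrow> 'a \<Rightarrow>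
     real ^ 'm ^ 'm" where
  "coord_metric M g c p = (\<chi> i j. g p (coord_vec M c i p) (coord_vec M c j p))"

definition singular_set ::
    "('a::topological_space, 'm::finite) chart set \<Rightarrow> 'a metric_field \<Rightarrow> 'a set" where
  "singular_set M g = {p. \<exists>c\<in>M. p \<in> fst c \<and> rank (coord_metric M g c p) < CARD('m)}"

definition transverse_singular ::
    "('a::topological_space, 'm::finite) chart set \<Rightarrow> 'a metric_field \<Rightarrow> bool" where
  "transverse_singular M g \<longleftrightarrow> smooth_symmetric M g \<and> singular_set M g \<noteq> {} \<and>
     (\<forall>c\<in>M. \<forall>p\<in>singular_set M g \<inter> fst c.
        \<exists>v\<in>tangent_space M p. v (\<lambda>q. det (coord_metric M g c q)) \<noteq> 0)"

definition radical ::
    "('a::topological_space, 'm::finite) chart set \<Rightarrow> 'a metric_field \<Rightarrow> 'a \<Rightarrow> 'a tvec set" where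
  "radical M g p = {v \<in> tangent_space M p. \<forall>w\<in>tangent_space M p. g p v w = 0}"

text \<open>For a point \<open>p\<close> of an embedded submanifold \<open>S\<close>, this is the tangent space of \<open>S\<close> at \<open>p\<close>,
  as a subspace of the ambient tangent space.\<close>

definition tangent_sub ::
    "('a::topological_space, 'm::finite) chart set \<Rightarrow> 'a set \<Rightarrow> 'a \<Rightarrow> 'a tvec set" where
  "tangent_sub M S p = {v \<in> tangent_space M p.
     \<forall>f. smooth_near M p f \<and> (\<forall>\<^sub>F q in nhds p. q \<in> S \<longrightarrow> f q = 0) \<longrightarrow> v f = 0}"

definition tangent_radical ::
    "('a::topological_space, 'm::finite) chart set \<Rightarrow> 'a metric_field \<Rightarrow> bool" where
  "tangent_radical M g \<longleftrightarrow>
     (\<forall>p\<in>singular_set M g. radical M g p \<subseteq> tangent_sub M (singular_set M g) p)"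

text \<open>Nondegeneracy with exactly \<open>k\<close> minus signs: there is an orthonormal basis of that type.
  The \<open>CARD('m)\<close> vectors \<open>e i\<close> are automatically independent.\<close>

definition has_index ::
    "('a::topological_space, 'm::finite) chart set \<Rightarrow> 'a metric_field \<Rightarrow> 'a \<Rightarrow> nat \<Rightarrow> bool" where
  "has_index M g p k \<longleftrightarrow>
     (\<exists>(e :: 'm \<Rightarrow> 'a tvec) s. (\<forall>i. e i \<in> tangent_space M p \<and> s i \<in> {-1, 1}) \<and>
        (\<forall>i j. g p (e i) (e j) = (if i = j then s i else 0)) \<and> card {i. s i = -1} = k)"

definition riemann_lorentz ::
    "('a::topological_space, 'm::finite) chart set \<Rightarrow> 'a metric_field \<Rightarrow> bool" where
  "riemann_lorentz M g \<longleftrightarrow>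
     (\<forall>p. p \<notin> singular_set M g \<longrightarrow> has_index M g p 0 \<or> has_index M g p 1) \<and>
     (\<forall>p\<in>singular_set M g.
        p \<in> closure {q. has_index M g q 0} \<and> p \<in> closure {q. has_index M g q 1})"

section \<open>Dual connection, main normal and main radical\<close>

definition dual_conn ::
    "('a::topological_space, 'm::finite) chart set \<Rightarrow> 'a metric_field \<Rightarrow>
     'a vfield \<Rightarrow> 'a vfield \<Rightarrow> 'a vfield \<Rightarrow> 'a \<Rightarrow> real" where
  "dual_conn M g A B C p =
     (A p (\<lambda>q. g q (B q) (C q)) + B p (\<lambda>q. g q (C q) (A q)) - C p (\<lambda>q. g q (A q) (B q))
      + g p (lie_bracket M A B p) (C p) - g p (lie_bracket M B C p) (A p)
      + g p (lie_bracket M C A p) (B p)) / 2"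

definition smooth_along ::
    "('a::topological_space, 'm::finite) chart set \<Rightarrow> 'a set \<Rightarrow> 'a vfield \<Rightarrow> bool" where
  "smooth_along M S X \<longleftrightarrow>
     (\<forall>p\<in>S. \<exists>W Y. open W \<and> p \<in> W \<and> vector_field M W Y \<and> (\<forall>q\<in>W \<inter> S. Y q = X q))"

text \<open>Both of the following are the pointwise values of tensors, i.e. the common value for all local
  extensions of the arguments: \<open>II\<close> for \<open>r\<close> in the radical at a singular point \<open>p\<close>, and \<open>sff\<close> for
  \<open>x\<close>, \<open>y\<close> tangent to the singular hypersurface and \<open>N\<close> normal to it.\<close>

definition II ::
    "('a::topological_space, 'm::finite) chart set \<Rightarrow> 'a metric_field \<Rightarrow> 'a \<Rightarrow>
     'a tvec \<Rightarrow> 'a tvec \<Rightarrow> 'a tvec \<Rightarrow> real" where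
  "II M g p r a b = (THE y. \<forall>W A B C. open W \<and> p \<in> W \<and>
     vector_field M W A \<and> vector_field M W B \<and> vector_field M W C \<and>
     A p = a \<and> B p = b \<and> C p = r \<longrightarrow> dual_conn M g A B C p = y)"

definition sff ::
    "('a::topological_space, 'm::finite) chart set \<Rightarrow> 'a metric_field \<Rightarrow> 'a vfield \<Rightarrow> 'a \<Rightarrow>
     'a tvec \<Rightarrow> 'a tvec \<Rightarrow> real" where
  "sff M g N p x y = (THE h. \<forall>W X Y C. open W \<and> p \<in> W \<and>
     vector_field M W X \<and> vector_field M W Y \<and> vector_field M W C \<and>
     (\<forall>q\<in>W \<inter> singular_set M g. X q \<in> tangent_sub M (singular_set M g) q \<and>
        Y q \<in> tangent_sub M (singular_set M g) q \<and> C q = N q) \<and>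
     X p = x \<and> Y p = y \<longrightarrow> dual_conn M g X Y C p = h)"

text \<open>In the sequel \<open>U\<close> is an open set on which the local objects (the main normal \<open>N\<close> and the main
  radical vector field \<open>R\<close> along the singular points in \<open>U\<close>, their extensions \<open>NN\<close> and \<open>RR\<close>, and
  \<open>\<Upsilon>\<close>) exist.\<close>

definition main_normal ::
    "('a::topological_space, 'm::finite) chart set \<Rightarrow> 'a metric_field \<Rightarrow> 'a set \<Rightarrow>
     'a vfield \<Rightarrow> bool" where
  "main_normal M g U N \<longleftrightarrow> smooth_along M (singular_set M g \<inter> U) N \<and>
     (\<forall>p\<in>singular_set M g \<inter> U. N p \<in> tangent_space M p \<and>
        (\<forall>v\<in>tangent_sub M (singular_set M g) p. g p (N p) v = 0) \<and>
        (\<forall>r\<in>radical M g p. II M g p r (N p) (N p) = 0) \<and>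
        g p (N p) (N p) = 1)"

definition main_radical ::
    "('a::topological_space, 'm::finite) chart set \<Rightarrow> 'a metric_field \<Rightarrow> 'a set \<Rightarrow>
     'a vfield \<Rightarrow> 'a vfield \<Rightarrow> bool" where
  "main_radical M g U N R \<longleftrightarrow> smooth_along M (singular_set M g \<inter> U) R \<and>
     (\<forall>p\<in>singular_set M g \<inter> U. R p \<in> radical M g p \<and> sff M g N p (R p) (R p) = -1)"

definition screen ::
    "('a::topological_space, 'm::finite) chart set \<Rightarrow> 'a metric_field \<Rightarrow>
     'a vfield \<Rightarrow> 'a vfield \<Rightarrow> 'a \<Rightarrow> 'a tvec set" where
  "screen M g N R p = {v \<in> tangent_sub M (singular_set M g) p. sff M g N p v (R p) = 0}"

definition screen_section ::
    "('a::topological_space, 'm::finite) chart set \<Rightarrow> 'a metric_field \<Rightarrow>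
     'a vfield \<Rightarrow> 'a vfield \<Rightarrow> 'a set \<Rightarrow> 'a vfield \<Rightarrow> bool" where
  "screen_section M g N R W V \<longleftrightarrow> smooth_along M (singular_set M g \<inter> W) V \<and>
     (\<forall>p\<in>singular_set M g \<inter> W. V p \<in> screen M g N R p)"

definition II_flat ::
    "('a::topological_space, 'm::finite) chart set \<Rightarrow> 'a metric_field \<Rightarrow>
     'a vfield \<Rightarrow> 'a vfield \<Rightarrow> 'a set \<Rightarrow> bool" where
  "II_flat M g N R U \<longleftrightarrow> (\<forall>W V V'. open W \<and> W \<subseteq> U \<and>
     screen_section M g N R W V \<and> screen_section M g N R W V' \<longrightarrow>
     (\<forall>p\<in>singular_set M g \<inter> W. II M g p (R p) (V p) (V' p) = 0))"

definition nu :: "'a metric_field \<Rightarrow> 'a vfield \<Rightarrow> 'a \<Rightarrow> 'a tvec \<Rightarrow> real" where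
  "nu g N p a = g p a (N p)"

definition rho ::
    "('a::topological_space, 'm::finite) chart set \<Rightarrow> 'a metric_field \<Rightarrow>
     'a vfield \<Rightarrow> 'a vfield \<Rightarrow> 'a \<Rightarrow> 'a tvec \<Rightarrow> real" where
  "rho M g N R p a = - sff M g N p (\<lambda>f. a f - nu g N p a * N p f) (R p)"

section \<open>Curvature\<close>

text \<open>\<open>D\<close> is the unique torsion-free metric connection of the nondegenerate metric \<open>g\<close> on the open
  set \<open>S\<close>; only the values \<open>D X Y p\<close> for \<open>p\<close> in an open subset of \<open>S\<close> on which \<open>X\<close> and \<open>Y\<close> are
  vector fields are meaningful.\<close>

definition levi_civita ::
    "('a::topological_space, 'm::finite) chart set \<Rightarrow> 'a metric_field \<Rightarrow> 'a set \<Rightarrow>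
     ('a vfield \<Rightarrow> 'a vfield \<Rightarrow> 'a vfield) \<Rightarrow> bool" where
  "levi_civita M g S D \<longleftrightarrow> (\<forall>W. open W \<and> W \<subseteq> S \<longrightarrow>
     (\<forall>X Y. vector_field M W X \<and> vector_field M W Y \<longrightarrow>
        vector_field M W (D X Y) \<and>
        (\<forall>p\<in>W. \<forall>f. D X Y p f - D Y X p f = lie_bracket M X Y p f)) \<and>
     (\<forall>X Y Z. vector_field M W X \<and> vector_field M W Y \<and> vector_field M W Z \<longrightarrow>
        (\<forall>p\<in>W. \<forall>f. D (\<lambda>q h. X q h + Y q h) Z p f = D X Z p f + D Y Z p f \<and>
           D X (\<lambda>q h. Y q h + Z q h) p f = D X Y p f + D X Z p f) \<and>
        (\<forall>p\<in>W. X p (\<lambda>q. g q (Y q) (Z q)) = g p (D X Y p) (Z p) + g p (Y p) (D X Z p))) \<and>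
     (\<forall>u X Y. smooth_fun M W u \<and> vector_field M W X \<and> vector_field M W Y \<longrightarrow>
        (\<forall>p\<in>W. \<forall>f. D (\<lambda>q h. u q * X q h) Y p f = u p * D X Y p f \<and>
           D X (\<lambda>q h. u q * Y q h) p f = X p u * Y p f + u p * D X Y p f)))"

definition curvature ::
    "('a::topological_space, 'm::finite) chart set \<Rightarrow> ('a vfield \<Rightarrow> 'a vfield \<Rightarrow> 'a vfield) \<Rightarrow>
     'a vfield \<Rightarrow> 'a vfield \<Rightarrow> 'a vfield \<Rightarrow> 'a vfield" where
  "curvature M D A B C p =
     (\<lambda>f. D A (D B C) p f - D B (D A C) p f - D (lie_bracket M A B) C p f)"

definition geodesic_extension ::
    "('a::topological_space, 'm::finite) chart set \<Rightarrow> 'a metric_field \<Rightarrow>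
     ('a vfield \<Rightarrow> 'a vfield \<Rightarrow> 'a vfield) \<Rightarrow> 'a set \<Rightarrow> 'a vfield \<Rightarrow> 'a vfield \<Rightarrow> bool" where
  "geodesic_extension M g D U N NN \<longleftrightarrow> vector_field M U NN \<and>
     (\<forall>p\<in>singular_set M g \<inter> U. NN p = N p) \<and>
     (\<forall>p\<in>U - singular_set M g. D NN NN p = (\<lambda>f. 0))"

definition canonical_extension ::
    "('a::topological_space, 'm::finite) chart set \<Rightarrow> 'a metric_field \<Rightarrow> 'a set \<Rightarrow>
     'a vfield \<Rightarrow> 'a vfield \<Rightarrow> 'a vfield \<Rightarrow> bool" where
  "canonical_extension M g U NN A AA \<longleftrightarrow> vector_field M U AA \<and>
     (\<forall>p\<in>singular_set M g \<inter> U. AA p = A p) \<and>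
     (\<forall>p\<in>U. lie_bracket M NN AA p = (\<lambda>f. 0))"

text \<open>The smooth tensor field \<open>\<Upsilon>\<close> on \<open>U\<close>. It is determined by its values off the singular set, whose
  complement is dense; the factor \<open>g p (RR p) (RR p)\<close> is \<open>\<tau>\<close>.\<close>

definition is_Upsilon ::
    "('a::topological_space, 'm::finite) chart set \<Rightarrow> 'a metric_field \<Rightarrow>
     ('a vfield \<Rightarrow> 'a vfield \<Rightarrow> 'a vfield) \<Rightarrow> 'a set \<Rightarrow> 'a vfield \<Rightarrow>
     ('a \<Rightarrow> 'a tvec \<Rightarrow> 'a tvec \<Rightarrow> 'a tvec \<Rightarrow> 'a tvec \<Rightarrow> real) \<Rightarrow> bool" where
  "is_Upsilon M g D U RR Ups \<longleftrightarrow> smooth_tensor4 M U Ups \<and>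
     (\<forall>W A B C E. open W \<and> W \<subseteq> U - singular_set M g \<and> vector_field M W A \<and>
        vector_field M W B \<and> vector_field M W C \<and> vector_field M W E \<longrightarrow>
        (\<forall>p\<in>W. Ups p (A p) (B p) (C p) (E p) =
           g p (RR p) (RR p) * g p (curvature M D A B C p) (E p)))"

definition gram :: "'a metric_field \<Rightarrow> 'a vfield \<Rightarrow> 'a vfield \<Rightarrow> 'a \<Rightarrow> real ^ 2 ^ 2" where
  "gram g A B p = vector [vector [g p (A p) (A p), g p (A p) (B p)],
                          vector [g p (B p) (A p), g p (B p) (B p)]]"

text \<open>The numerator is \<open>\<langle>R(A,B)A,B\<rangle>\<close>; with \<^const>\<open>curvature\<close> as above this is the negative of the usual
  sectional curvature.\<close>

definition sectional ::
    "('a::topological_space, 'm::finite) chart set \<Rightarrow> 'a metric_field \<Rightarrow>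
     ('a vfield \<Rightarrow> 'a vfield \<Rightarrow> 'a vfield) \<Rightarrow> 'a vfield \<Rightarrow> 'a vfield \<Rightarrow> 'a \<Rightarrow> real" where
  "sectional M g D A B p = g p (curvature M D A B A p) (B p) / det (gram g A B p)"

definition smoothly_extendible ::
    "('a::topological_space, 'm::finite) chart set \<Rightarrow> 'a set \<Rightarrow> 'a set \<Rightarrow> ('a \<Rightarrow> real) \<Rightarrow> bool" where
  "smoothly_extendible M W S F \<longleftrightarrow> (\<exists>F'. smooth_fun M W F' \<and> (\<forall>p\<in>W - S. F' p = F p))"

text \<open>Vector fields on an open set \<open>W\<close> spanning planes on which \<open>g\<close> has rank 2, also at the singular
  points; those in \<open>W\<close> are required to lie in \<open>U\<close>, where \<open>\<Upsilon>\<close> is defined.\<close>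

definition nondegenerate_pair ::
    "('a::topological_space, 'm::finite) chart set \<Rightarrow> 'a metric_field \<Rightarrow> 'a set \<Rightarrow>
     'a set \<Rightarrow> 'a vfield \<Rightarrow> 'a vfield \<Rightarrow> bool" where
  "nondegenerate_pair M g U W A B \<longleftrightarrow> open W \<and> singular_set M g \<inter> W \<subseteq> U \<and>
     vector_field M W A \<and> vector_field M W B \<and> (\<forall>p\<in>W. rank (gram g A B p) = 2)"

definition Upsilon_vanishes ::
    "('a::topological_space, 'm::finite) chart set \<Rightarrow> 'a metric_field \<Rightarrow>
     ('a \<Rightarrow> 'a tvec \<Rightarrow> 'a tvec \<Rightarrow> 'a tvec \<Rightarrow> 'a tvec \<Rightarrow> real) \<Rightarrow> 'a set \<Rightarrow>
     'a vfield \<Rightarrow> 'a vfield \<Rightarrow> bool" where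
  "Upsilon_vanishes M g Ups W A B \<longleftrightarrow>
     (\<forall>p\<in>singular_set M g \<inter> W. Ups p (A p) (B p) (A p) (B p) = 0)"

definition nu_rho_det_vanishes ::
    "('a::topological_space, 'm::finite) chart set \<Rightarrow> 'a metric_field \<Rightarrow>
     'a vfield \<Rightarrow> 'a vfield \<Rightarrow> 'a set \<Rightarrow> 'a vfield \<Rightarrow> 'a vfield \<Rightarrow> bool" where
  "nu_rho_det_vanishes M g N R W A B \<longleftrightarrow>
     (\<forall>p\<in>singular_set M g \<inter> W.
        det (vector [vector [nu g N p (A p), nu g N p (B p)],
                     vector [rho M g N R p (A p), rho M g N R p (B p)]] :: real ^ 2 ^ 2) = 0)"

end

theory Submission
  imports Defs
begin

text \<open>The singular hypersurface is locally \<open>{\<delta> = 0}\<close> with \<open>\<delta>\<close> the determinant of the metric in a chart, and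
  by Hadamard's lemma every smooth function vanishing on it is a smooth multiple of \<open>\<delta>\<close>. In
  particular \<open>\<tau> = k \<delta>\<close>, and \<open>k \<noteq> 0\<close> since the Koszul formula gives \<open>d\<tau>(N) = - 2 H(R,R) = 2\<close>. So
  \<open>\<Upsilon>(A,B,A,B)/\<tau>\<close> extends smoothly iff its numerator vanishes on the hypersurface, which is (a).

  Write \<open>\<box>\<close> for the dual connection. On the hypersurface \<open>\<tau> \<nabla>\<^sub>A C\<close> has the limit \<open>II(A,C) R\<close>, so the
  quadratic terms of the curvature in \<open>\<nabla>\<close>, which are \<open>\<tau>\<langle>\<nabla>\<^sub>A A, \<nabla>\<^sub>B B\<rangle> - \<tau>\<langle>\<nabla>\<^sub>B A, \<nabla>\<^sub>A B\<rangle>\<close>, tend to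
  \<open>II(A,A) II(B,B) - II(A,B)\<^sup>2\<close>, while the other ones are \<open>\<tau>\<close> times derivatives of values of \<open>\<box>\<close>, and
  vanish. Since \<open>II(N,N) = II(R,R) = 0\<close>, \<open>II(N,R) = 1\<close> and the screen \<open>S\<close> is \<open>II\<close>-orthogonal to \<open>N\<close> and
  \<open>R\<close>, one has \<open>II(A,B) = \<nu>(A) \<rho>(B) + \<rho>(A) \<nu>(B) + II(A\<^sup>S,B\<^sup>S)\<close>. If the last term vanishes, \<open>\<Upsilon>(A,B,A,B)\<close> is
  minus the square of the determinant in (b). Conversely, applying (1) to a screen field \<open>V\<close> and
  \<open>N + R\<close> gives \<open>2 II(V,V) = 0\<close>.\<close>

text \<open>The Levi-Civita connection \<open>D\<close> is known only off the hypersurface, so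
  nothing can be evaluated there directly. The dual connection is smooth across it. A value on the
  hypersurface is therefore found by proving an identity off it whose two sides are smooth
  everywhere, and by density of the nonsingular points, which holds because \<delta> has nonzero
  differential. In a product such as \<open>tau\<close> times the pairing of two covariant
  derivatives, the single factor \<open>tau\<close> is absorbed by one of them; pairing the
  resulting smooth field with the other is again a value of the dual connection.

  N + R is a test vector because its \<nu> and \<rho> are both 1, so that II(N + R, N + R) = 2,
  whereas N and R are II-null. The plane of V and N + R is nondegenerate only if V is not null. Here
  the signature change helps: on the hypersurface the metric is a limit of positive definite ones,
  hence semidefinite, so a null V is a multiple of R and II(V, V) = 0 anyway. Polarization passes
  from II(V, V) to II(V, V').\<close>

section \<open>Calculus of iterated derivatives on open sets\<close>

lemma Ck_on_cong:
  assumes "open S" "\<And>x. x \<in> S \<Longrightarrow> f x = h x"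
  shows "Ck_on k S f \<longleftrightarrow> Ck_on k S h"
proof -
  have "Ck_on k S h" if "Ck_on k S f" "\<And>x. x \<in> S \<Longrightarrow> f x = h x" for f h
    using that
  proof (induction k arbitrary: f h)
    case 0
    then show ?case using continuous_on_cong by force
  next
    case (Suc k)
    \<comment> \<open>\<open>Ck_on\<close> takes derivatives at \<open>x\<close> in the whole space,
      so the two functions must agree on a neighbourhood of \<open>x\<close>; openness of
      \<open>S\<close> provides it.\<close>
    have d: "(h has_derivative frechet_derivative f (at x)) (at x)" if "x \<in> S" for x
    proof -
      have "(f has_derivative frechet_derivative f (at x)) (at x)"
        using Suc.prems(1) that frechet_derivative_works by auto
      then show ?thesis
        using has_derivative_transform_within_open[OF _ assms(1) that] Suc.prems(2) by blast
    qed
    then have e: "frechet_derivative f (at x) = frechet_derivative h (at x)" if "x \<in> S" for x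
      using frechet_derivative_at that by blast
    have "Ck_on k S (\<lambda>x. frechet_derivative h (at x) v)" for v
      by (rule Suc.IH[of "\<lambda>x. frechet_derivative f (at x) v"]) (use Suc.prems e in auto)
    then show ?case using d by (auto simp: differentiable_def)
  qed
  then show ?thesis using assms(2) by (metis (no_types, lifting))
qed

lemma smooth_on_cong:
  assumes "open S" "\<And>x. x \<in> S \<Longrightarrow> f x = h x"
  shows "smooth_on S f \<longleftrightarrow> smooth_on S h"
  unfolding smooth_on_def using Ck_on_cong[OF assms] by simp

lemma Ck_on_subset: "Ck_on k S f \<Longrightarrow> T \<subseteq> S \<Longrightarrow> Ck_on k T f"
  by (induction k arbitrary: f) (auto intro: continuous_on_subset)

lemma smooth_on_subset: "smooth_on S f \<Longrightarrow> T \<subseteq> S \<Longrightarrow> smooth_on T f"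
  unfolding smooth_on_def using Ck_on_subset by blast

lemma Ck_on_mono: "Ck_on (Suc k) S f \<Longrightarrow> Ck_on k S f"
proof (induction k arbitrary: f)
  case 0
  then show ?case
    by (simp add: continuous_at_imp_continuous_on differentiable_imp_continuous_within)
next
  case (Suc k)
  then show ?case by (metis Ck_on.simps(2))
qed

lemma Ck_on_continuous: "Ck_on k S f \<Longrightarrow> continuous_on S f"
proof (induction k)
  case (Suc k)
  show ?case by (rule Suc.IH[OF Ck_on_mono[OF Suc.prems]])
qed simp

lemma Ck_on_local:
  assumes "\<And>x. x \<in> S \<Longrightarrow> \<exists>T. open T \<and> x \<in> T \<and> Ck_on k T f"
  shows "Ck_on k S f"
  using assms
proof (induction k arbitrary: f)
  case 0
  then show ?case
    by simp (metis continuous_at_imp_continuous_on continuous_on_eq_continuous_at)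
next
  case (Suc k)
  have "f differentiable at x" if "x \<in> S" for x
    using Suc.prems[OF that] by auto
  moreover have "Ck_on k S (\<lambda>x. frechet_derivative f (at x) v)" for v
    by (rule Suc.IH) (use Suc.prems in fastforce)
  ultimately show ?case by simp
qed

lemma smooth_on_local:
  assumes "\<And>x. x \<in> S \<Longrightarrow> \<exists>T. open T \<and> x \<in> T \<and> smooth_on T f"
  shows "smooth_on S f"
  unfolding smooth_on_def using assms Ck_on_local by (metis smooth_on_def)

lemma smooth_on_differentiable: "smooth_on S f \<Longrightarrow> x \<in> S \<Longrightarrow> f differentiable (at x)"
  unfolding smooth_on_def by (metis Ck_on.simps(2))

lemma smooth_on_continuous: "smooth_on S f \<Longrightarrow> continuous_on S f"
  unfolding smooth_on_def by (metis Ck_on.simps(1))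

lemma smooth_on_derivative: "smooth_on S f \<Longrightarrow> smooth_on S (\<lambda>x. frechet_derivative f (at x) v)"
  unfolding smooth_on_def by (metis Ck_on.simps(2))

lemma Ck_on_const: "Ck_on k S (\<lambda>x. c)"
  by (induction k arbitrary: c) (auto simp: frechet_derivative_const)

lemma frechet_derivative_eqI:
  "(f has_derivative f') (at x) \<Longrightarrow> frechet_derivative f (at x) v = f' v"
  using frechet_derivative_at by metis

lemma has_derivative_frechet:
  "f differentiable (at x) \<Longrightarrow> (f has_derivative (\<lambda>v. frechet_derivative f (at x) v)) (at x)"
  using frechet_derivative_works by metis

text \<open>Lets an induction on the order run with an explicit formula \<open>f'\<close>, read as a
  function of the point for each fixed direction. Each closure property below then needs only its
  own differentiation rule.\<close>

lemma Ck_on_SucI: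
  assumes "open S"
    and "\<And>x. x \<in> S \<Longrightarrow> (f has_derivative (\<lambda>v. f' v x)) (at x)"
    and "\<And>v. Ck_on k S (f' v)"
  shows "Ck_on (Suc k) S f"
proof -
  have "Ck_on k S (\<lambda>x. frechet_derivative f (at x) v)" for v
    by (subst Ck_on_cong[OF assms(1), where h = "f' v"])
      (use assms(3) frechet_derivative_eqI[OF assms(2)] in auto)
  then show ?thesis using assms(2) by (auto simp: differentiable_def)
qed

lemma Ck_on_SucD:
  assumes "Ck_on (Suc k) S f"
  shows "x \<in> S \<Longrightarrow> (f has_derivative (\<lambda>v. frechet_derivative f (at x) v)) (at x)"
    and "Ck_on k S (\<lambda>x. frechet_derivative f (at x) v)"
  using assms has_derivative_frechet by auto

lemma Ck_on_bounded_linear: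
  assumes "bounded_linear L" "open S" "Ck_on k S f"
  shows "Ck_on k S (\<lambda>x. L (f x))"
  using assms(3)
proof (induction k arbitrary: f)
  case 0
  then show ?case
    using assms(1) by (auto intro: bounded_linear.continuous_on)
next
  case (Suc k)
  show ?case
  proof (rule Ck_on_SucI[OF assms(2)])
    show "((\<lambda>x. L (f x)) has_derivative (\<lambda>v. L (frechet_derivative f (at x) v))) (at x)"
      if "x \<in> S" for x
      using bounded_linear.has_derivative[OF assms(1)] Ck_on_SucD(1)[OF Suc.prems that] by blast
    show "Ck_on k S (\<lambda>x. L (frechet_derivative f (at x) v))" for v
      by (rule Suc.IH[OF Ck_on_SucD(2)[OF Suc.prems]])
  qed
qed

lemma Ck_on_add:
  assumes "open S" "Ck_on k S f" "Ck_on k S h"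
  shows "Ck_on k S (\<lambda>x. f x + h x)"
  using assms(2,3)
proof (induction k arbitrary: f h)
  case 0
  then show ?case by (auto intro: continuous_on_add)
next
  case (Suc k)
  show ?case
  proof (rule Ck_on_SucI[OF assms(1)])
    show "((\<lambda>x. f x + h x) has_derivative
        (\<lambda>v. frechet_derivative f (at x) v + frechet_derivative h (at x) v)) (at x)"
      if "x \<in> S" for x
      by (intro has_derivative_add Ck_on_SucD(1)[OF Suc.prems(1) that] Ck_on_SucD(1)[OF Suc.prems(2) that])
    show "Ck_on k S (\<lambda>x. frechet_derivative f (at x) v + frechet_derivative h (at x) v)" for v
      by (rule Suc.IH) (use Suc.prems in auto)
  qed
qed

lemma Ck_on_sum:
  assumes "open S" "\<And>i. i \<in> I \<Longrightarrow> Ck_on k S (f i)"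
  shows "Ck_on k S (\<lambda>x. \<Sum>i\<in>I. f i x)"
proof (cases "finite I")
  case True
  then show ?thesis using assms(2)
    by (induction I rule: finite_induct) (auto intro!: Ck_on_const Ck_on_add[OF assms(1)])
qed (simp add: Ck_on_const)

lemma Ck_on_mult:
  fixes f h :: "'v::real_normed_vector \<Rightarrow> real"
  assumes "open S" "Ck_on k S f" "Ck_on k S h"
  shows "Ck_on k S (\<lambda>x. f x * h x)"
  using assms(2,3)
proof (induction k arbitrary: f h)
  case 0
  then show ?case by (auto intro: continuous_on_mult)
next
  case (Suc k)
  show ?case
  proof (rule Ck_on_SucI[OF assms(1)])
    show "((\<lambda>x. f x * h x) has_derivative
        (\<lambda>v. f x * frechet_derivative h (at x) v + frechet_derivative f (at x) v * h x)) (at x)"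
      if "x \<in> S" for x
      by (intro has_derivative_mult Ck_on_SucD(1)[OF Suc.prems(1) that] Ck_on_SucD(1)[OF Suc.prems(2) that])
    show "Ck_on k S (\<lambda>x. f x * frechet_derivative h (at x) v + frechet_derivative f (at x) v * h x)"
      for v
      by (intro Ck_on_add[OF assms(1)] Suc.IH Ck_on_SucD(2) Suc.prems Suc.prems[THEN Ck_on_mono])
  qed
qed

lemma Ck_on_inverse:
  fixes f :: "'v::real_normed_vector \<Rightarrow> real"
  assumes "open S" "Ck_on k S f" "\<And>x. x \<in> S \<Longrightarrow> f x \<noteq> 0"
  shows "Ck_on k S (\<lambda>x. inverse (f x))"
  using assms(2,3)
proof (induction k arbitrary: f)
  case 0
  then show ?case by (auto intro: continuous_on_inverse)
next
  case (Suc k)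
  show ?case
  proof (rule Ck_on_SucI[OF assms(1)])
    fix x assume x: "x \<in> S"
    have "((\<lambda>x. inverse (f x)) has_derivative
        (\<lambda>v. - (inverse (f x) * frechet_derivative f (at x) v * inverse (f x)))) (at x)"
      by (rule Deriv.has_derivative_inverse[OF Suc.prems(2)[OF x] Ck_on_SucD(1)[OF Suc.prems(1) x]])
    \<comment> \<open>Written as a product of scalar functions, so that \<open>Ck_on_mult\<close>
      and the induction hypothesis for the inverse apply.\<close>
    then show "((\<lambda>x. inverse (f x)) has_derivative
        (\<lambda>v. (- 1) * (inverse (f x) * (frechet_derivative f (at x) v * inverse (f x))))) (at x)"
      by (simp add: mult.assoc)
  next
    show "Ck_on k S (\<lambda>x. (- 1) * (inverse (f x) * (frechet_derivative f (at x) v * inverse (f x))))"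
      for v
      by (intro Ck_on_mult[OF assms(1)] Suc.IH[OF Ck_on_mono] Ck_on_SucD(2)[OF Suc.prems(1)]
          Ck_on_const Suc.prems)
  qed
qed

text \<open>In the chain rule the direction in which \<open>f\<close> is differentiated depends on
  \<open>x\<close>, while the induction hypothesis covers fixed directions only. Expanding that
  direction in the basis moves the dependence on \<open>x\<close> into scalar coefficients.\<close>

lemma Ck_on_compose:
  fixes f :: "'b::euclidean_space \<Rightarrow> real" and \<phi> :: "'v::real_normed_vector \<Rightarrow> 'b"
  assumes "open S" "open T" "\<phi> ` S \<subseteq> T" "Ck_on k T f" "Ck_on k S \<phi>"
  shows "Ck_on k S (\<lambda>x. f (\<phi> x))"
  using assms(4,5)
proof (induction k arbitrary: f)
  case 0
  then show ?case using assms(3) by (auto intro: continuous_on_compose2)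
next
  case (Suc k)
  let ?D = "\<lambda>v x. \<Sum>b\<in>Basis. (frechet_derivative \<phi> (at x) v \<bullet> b) * frechet_derivative f (at (\<phi> x)) b"
  show ?case
  proof (rule Ck_on_SucI[OF assms(1), where f' = ?D])
    fix x assume x: "x \<in> S"
    have df: "(f has_derivative frechet_derivative f (at (\<phi> x))) (at (\<phi> x))"
      using Ck_on_SucD(1)[OF Suc.prems(1)] x assms(3) by blast
    have dphi: "(\<phi> has_derivative frechet_derivative \<phi> (at x)) (at x)"
      using Ck_on_SucD(1)[OF Suc.prems(2) x] by blast
    have "?D v x = frechet_derivative f (at (\<phi> x)) (frechet_derivative \<phi> (at x) v)" for v
    proof -
      interpret linear "frechet_derivative f (at (\<phi> x))"
        using df has_derivative_linear by blast
      show ?thesis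
        by (subst (3) euclidean_representation[symmetric]) (simp add: sum scale)
    qed
    then show "((\<lambda>x. f (\<phi> x)) has_derivative (\<lambda>v. ?D v x)) (at x)"
      using diff_chain_at[OF dphi df] by (simp add: o_def)
  next
    fix v
    have "Ck_on k S (\<lambda>x. frechet_derivative \<phi> (at x) v \<bullet> b)" for b
      by (rule Ck_on_bounded_linear[OF bounded_linear_inner_left assms(1)])
        (rule Ck_on_SucD(2)[OF Suc.prems(2)])
    moreover have "Ck_on k S (\<lambda>x. frechet_derivative f (at (\<phi> x)) b)" for b
      by (rule Suc.IH[of "\<lambda>y. frechet_derivative f (at y) b"])
        (use Ck_on_mono[OF Suc.prems(2)] Ck_on_SucD(2)[OF Suc.prems(1)] in auto)
    ultimately show "Ck_on k S (?D v)"
      by (intro Ck_on_sum Ck_on_mult assms(1))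
  qed
qed

lemma Ck_on_componentwise:
  fixes \<phi> :: "'v::real_normed_vector \<Rightarrow> 'b::euclidean_space"
  assumes "open S" "\<And>b. b \<in> Basis \<Longrightarrow> Ck_on k S (\<lambda>x. \<phi> x \<bullet> b)"
  shows "Ck_on k S \<phi>"
proof -
  have "Ck_on k S (\<lambda>x. \<Sum>b\<in>Basis. (\<phi> x \<bullet> b) *\<^sub>R b)"
    by (intro Ck_on_sum assms(1) Ck_on_bounded_linear[OF bounded_linear_scaleR_left] assms(2))
  then show ?thesis by (simp add: euclidean_representation)
qed

lemma smooth_on_bounded_linear_comp:
  "bounded_linear L \<Longrightarrow> open S \<Longrightarrow> smooth_on S f \<Longrightarrow> smooth_on S (\<lambda>x. L (f x))"
  unfolding smooth_on_def using Ck_on_bounded_linear by blast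

lemma smooth_on_const: "smooth_on S (\<lambda>x. c)"
  unfolding smooth_on_def using Ck_on_const by blast

lemma smooth_on_add: "open S \<Longrightarrow> smooth_on S f \<Longrightarrow> smooth_on S h \<Longrightarrow> smooth_on S (\<lambda>x. f x + h x)"
  unfolding smooth_on_def using Ck_on_add by blast

lemma smooth_on_mult:
  fixes f h :: "'v::real_normed_vector \<Rightarrow> real"
  shows "open S \<Longrightarrow> smooth_on S f \<Longrightarrow> smooth_on S h \<Longrightarrow> smooth_on S (\<lambda>x. f x * h x)"
  unfolding smooth_on_def using Ck_on_mult by blast

lemma smooth_on_inverse:
  fixes f :: "'v::real_normed_vector \<Rightarrow> real"
  shows "open S \<Longrightarrow> smooth_on S f \<Longrightarrow> (\<And>x. x \<in> S \<Longrightarrow> f x \<noteq> 0) \<Longrightarrow> smooth_on S (\<lambda>x. inverse (f x))"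
  unfolding smooth_on_def using Ck_on_inverse by blast

lemma smooth_on_compose:
  fixes f :: "'b::euclidean_space \<Rightarrow> real" and \<phi> :: "'v::real_normed_vector \<Rightarrow> 'b"
  shows "open S \<Longrightarrow> open T \<Longrightarrow> \<phi> ` S \<subseteq> T \<Longrightarrow> smooth_on T f \<Longrightarrow> smooth_on S \<phi>
    \<Longrightarrow> smooth_on S (\<lambda>x. f (\<phi> x))"
  unfolding smooth_on_def using Ck_on_compose by blast

lemma Ck_on_id: "Ck_on k S (\<lambda>x. x)"
proof (cases k)
  case (Suc n)
  then show ?thesis by (auto simp: frechet_derivative_eqI[OF has_derivative_ident] Ck_on_const)
qed auto

lemma smooth_on_bounded_linear: "bounded_linear L \<Longrightarrow> open S \<Longrightarrow> smooth_on S L"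
  unfolding smooth_on_def using Ck_on_bounded_linear[OF _ _ Ck_on_id] by blast

section \<open>Parameter integrals, the implicit function theorem and Hadamard division\<close>

text \<open>Differentiating under the integral in direction \<open>v\<close> replaces
  \<open>G\<close> by its derivative in direction \<open>(0, v)\<close>, an integrand of the same
  kind, so the Leibniz rule iterates. \<open>G\<close> lives on an open neighbourhood of the closed
  strip because \<open>Ck_on\<close> differentiates in the integration variable as well.\<close>

lemma Ck_on_integral:
  fixes G :: "real \<times> 'a::euclidean_space \<Rightarrow> real"
  assumes "open S" "open \<Omega>" "{0..1} \<times> \<Omega> \<subseteq> S" "Ck_on k S G"
  shows "Ck_on k \<Omega> (\<lambda>x. integral {0..1} (\<lambda>t. G (t, x)))"
  using assms(4)
proof (induction k arbitrary: G)
  case 0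
  have "continuous_on (\<Omega> \<times> cbox 0 1) (\<lambda>(x, t). G (t, x))"
    unfolding case_prod_beta
    by (rule continuous_on_compose2[of S G]) (use 0 assms(3) in \<open>auto intro!: continuous_intros\<close>)
  from integral_continuous_on_param[OF this] show ?case by simp
next
  case (Suc k)
  let ?G' = "\<lambda>v x. integral {0..1} (\<lambda>t. frechet_derivative G (at (t, x)) (0, v))"
  show ?case
  proof (rule Ck_on_SucI[OF assms(2), where f' = ?G'])
    show "Ck_on k \<Omega> (?G' v)" for v
      by (rule Suc.IH) (rule Ck_on_SucD(2)[OF Suc.prems])
    fix x0 assume x0: "x0 \<in> \<Omega>"
    obtain r where r: "r > 0" "ball x0 r \<subseteq> \<Omega>" using assms(2) x0 open_contains_ball by blast
    let ?B = "ball x0 r"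
    have sub: "(t, x) \<in> S" if "x \<in> ?B" "t \<in> {0..1}" for t x
    proof -
      have "x \<in> \<Omega>" using that(1) r(2) by (rule subsetD[rotated])
      then show ?thesis using that(2) assms(3) by blast
    qed
    have bl: "bounded_linear (\<lambda>v. frechet_derivative G (at (t, x)) (0, v))"
      if "x \<in> ?B" "t \<in> {0..1}" for t x
      using has_derivative_bounded_linear[OF Ck_on_SucD(1)[OF Suc.prems sub[OF that]]]
      by (rule bounded_linear_compose) (simp add: bounded_linear_Pair bounded_linear_zero bounded_linear_ident)
    \<comment> \<open>The Leibniz rule takes the derivative as a bounded linear function; its
      continuity is checked vector by vector.\<close>
    define F where "F x t = Blinfun (\<lambda>v. frechet_derivative G (at (t, x)) (0, v))" for x t
    have F: "blinfun_apply (F x t) v = frechet_derivative G (at (t, x)) (0, v)"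
      if "x \<in> ?B" "t \<in> {0..1}" for t x v
      using bl[OF that] by (simp add: F_def bounded_linear_Blinfun_apply)
    have cF: "continuous_on (?B \<times> cbox 0 1) (\<lambda>(x, t). F x t)"
    proof (rule continuous_on_blinfun_componentwise)
      fix i :: 'a
      have "continuous_on S (\<lambda>z. frechet_derivative G (at z) (0, i))"
        using Ck_on_SucD(2)[OF Suc.prems] Ck_on_continuous by blast
      then have "continuous_on (?B \<times> cbox 0 1)
        (\<lambda>p. frechet_derivative G (at (snd p, fst p)) (0, i))"
        by (rule continuous_on_compose2) (use sub in \<open>auto intro!: continuous_intros\<close>)
      then show "continuous_on (?B \<times> cbox 0 1) (\<lambda>z. blinfun_apply (case z of (x, t) \<Rightarrow> F x t) i)"
        by (rule continuous_on_eq) (use F in auto)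
    qed
    have cG: "continuous_on {0..1} (\<lambda>t. G (t, x))" if "x \<in> ?B" for x
    proof (rule continuous_on_compose2[of S G])
      show "continuous_on S G"
        using Suc.prems Ck_on_continuous by blast
    qed (use sub that in \<open>auto intro!: continuous_intros\<close>)
    have der: "((\<lambda>x. G (t, x)) has_derivative blinfun_apply (F x t)) (at x within ?B)"
      if "x \<in> ?B" "t \<in> cbox 0 1" for x t
    proof -
      have t: "t \<in> {0..1}" using that by simp
      have d1: "((\<lambda>x. (t, x)) has_derivative (\<lambda>v. (0, v))) (at x)"
        by (auto intro!: derivative_eq_intros)
      have "((\<lambda>x. G (t, x)) has_derivative (\<lambda>v. frechet_derivative G (at (t, x)) (0, v))) (at x)"
        using diff_chain_at[OF d1 Ck_on_SucD(1)[OF Suc.prems sub[OF that(1) t]]]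
        by (simp add: o_def)
      then show ?thesis using F[OF that(1) t]
        by (metis (no_types, lifting) ext has_derivative_at_withinI)
    qed
    have "((\<lambda>x. integral (cbox 0 1) (\<lambda>t. G (t, x))) has_derivative
       blinfun_apply (integral (cbox 0 1) (F x0))) (at x0 within ?B)"
      by (rule leibniz_rule[OF der _ cF])
        (use r cG in \<open>auto intro: integrable_continuous_interval\<close>)
    moreover have "blinfun_apply (integral (cbox 0 1) (F x0)) v = ?G' v x0" for v
    proof -
      have "continuous_on (cbox 0 1) (F x0)"
        using continuous_on_compose2[OF cF, of "cbox 0 1" "\<lambda>t. (x0, t)"] r
          continuous_on_Pair[OF continuous_on_const[of _ x0] continuous_on_id[of "cbox (0::real) 1"]]
        by (simp add: image_subset_iff)
      then have "F x0 integrable_on cbox 0 1" by (rule integrable_continuous)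
      then have "blinfun_apply (integral (cbox 0 1) (F x0)) v =
          integral (cbox 0 1) (\<lambda>t. blinfun_apply (F x0 t) v)"
        by (simp add: blinfun_apply_integral)
      also have "\<dots> = ?G' v x0"
        using F r by (auto intro!: integral_cong)
      finally show ?thesis .
    qed
    ultimately show "((\<lambda>x. integral {0..1} (\<lambda>t. G (t, x))) has_derivative (\<lambda>v. ?G' v x0)) (at x0)"
      using at_within_open[of x0 ?B] r
      by (simp add: ext[of "blinfun_apply (integral {0..1} (F x0))" "\<lambda>v. ?G' v x0"])
  qed
qed

lemma smooth_on_integral:
  fixes G :: "real \<times> 'a::euclidean_space \<Rightarrow> real"
  assumes "open S" "open \<Omega>" "{0..1} \<times> \<Omega> \<subseteq> S" "smooth_on S G"
  shows "smooth_on \<Omega> (\<lambda>x. integral {0..1} (\<lambda>t. G (t, x)))"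
  using Ck_on_integral[OF assms(1-3)] assms(4) unfolding smooth_on_def by blast

text \<open>With the \<open>s\<close> of \<open>implicit_shift\<close>, these are the points of the
  segment from \<open>snd z\<close> to the zero set of \<delta>, over which Hadamard division
  integrates.\<close>

lemma smooth_shift_map:
  fixes s :: "'a::euclidean_space \<Rightarrow> real"
  assumes "open S" "smooth_on S s"
  shows "smooth_on (UNIV \<times> S) (\<lambda>z. snd z + (fst z * s (snd z)) *\<^sub>R e)"
proof -
  have o: "open (UNIV \<times> S)" by (intro open_Times open_UNIV assms)
  show ?thesis
    by (intro smooth_on_add[OF o] smooth_on_bounded_linear bounded_linear_snd o
        smooth_on_bounded_linear_comp[OF bounded_linear_scaleR_left o] smooth_on_mult[OF o]
        bounded_linear_fst smooth_on_compose[OF o assms(1) _ assms(2)]) auto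
qed

lemma integral_derivative_segment:
  fixes f :: "'a::euclidean_space \<Rightarrow> real"
  assumes "smooth_on S f" "\<And>t. t \<in> {0..1} \<Longrightarrow> x + t *\<^sub>R w \<in> S"
  shows "((\<lambda>t. frechet_derivative f (at (x + t *\<^sub>R w)) w) has_integral (f (x + w) - f x)) {0..1}"
proof -
  have "((\<lambda>t. frechet_derivative f (at (x + t *\<^sub>R w)) w) has_integral
     (f (x + 1 *\<^sub>R w) - f (x + 0 *\<^sub>R w))) {0..1}"
  proof (rule fundamental_theorem_of_calculus)
    fix t :: real assume t: "t \<in> {0..1}"
    have df: "(f has_derivative frechet_derivative f (at (x + t *\<^sub>R w))) (at (x + t *\<^sub>R w))"
      using smooth_on_differentiable[OF assms(1) assms(2)[OF t]] frechet_derivative_works by blast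
    have "((\<lambda>t. x + t *\<^sub>R w) has_derivative (\<lambda>h. h *\<^sub>R w)) (at t)"
      by (auto intro!: derivative_eq_intros)
    from diff_chain_at[OF this df]
    have "((\<lambda>t. f (x + t *\<^sub>R w)) has_derivative
        (\<lambda>h. frechet_derivative f (at (x + t *\<^sub>R w)) (h *\<^sub>R w))) (at t)"
      by (simp add: o_def)
    then have "((\<lambda>t. f (x + t *\<^sub>R w)) has_vector_derivative
        frechet_derivative f (at (x + t *\<^sub>R w)) w) (at t)"
      unfolding has_vector_derivative_def
      using linear_scale[OF has_derivative_linear[OF df]] by simp
    then show "((\<lambda>t. f (x + t *\<^sub>R w)) has_vector_derivative
        frechet_derivative f (at (x + t *\<^sub>R w)) w) (at t within {0..1})"
      by (rule has_vector_derivative_at_within)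
  qed simp
  then show ?thesis by simp
qed

text \<open>\<open>h b\<close> is the mean of the partial derivative in direction \<open>b\<close>
  over the segment from \<open>p\<close> to \<open>x\<close>. This is the expansion that reduces
  derivations to coordinate vectors.\<close>

lemma smooth_on_taylor:
  fixes f :: "'a::euclidean_space \<Rightarrow> real"
  assumes "smooth_on (ball p r) f" "r > 0"
  obtains h where "\<And>b. b \<in> Basis \<Longrightarrow> smooth_on (ball p r) (h b)"
    "\<And>x. x \<in> ball p r \<Longrightarrow> f x = f p + (\<Sum>b\<in>Basis. ((x - p) \<bullet> b) * h b x)"
    "\<And>b. b \<in> Basis \<Longrightarrow> h b p = frechet_derivative f (at p) b"
proof
  let ?m = "\<lambda>z::real \<times> 'a. p + fst z *\<^sub>R (snd z - p)"
  let ?h = "\<lambda>b x. integral {0..1} (\<lambda>t. frechet_derivative f (at (?m (t, x))) b)"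
  let ?S = "?m -` ball p r"
  have oS: "open ?S"
    by (intro open_vimage continuous_intros) auto
  have inb: "p + t *\<^sub>R (x - p) \<in> ball p r" if "x \<in> ball p r" "t \<in> {0..1}" for t x
  proof -
    have "\<bar>t\<bar> * norm (x - p) \<le> 1 * norm (x - p)"
      using that by (intro mult_right_mono) auto
    then show ?thesis using that by (auto simp: dist_norm norm_minus_commute)
  qed
  have sm: "smooth_on ?S ?m"
    unfolding smooth_on_def
  proof
    fix k
    show "Ck_on k ?S ?m"
    proof (rule Ck_on_componentwise[OF oS])
      fix b :: 'a
      have "smooth_on ?S (\<lambda>z. p \<bullet> b + fst z * ((snd z) \<bullet> b + - (p \<bullet> b)))"
        by (intro smooth_on_add[OF oS] smooth_on_mult[OF oS] smooth_on_const oS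
            smooth_on_bounded_linear bounded_linear_fst
            bounded_linear_compose[OF bounded_linear_inner_left bounded_linear_snd])
      then show "Ck_on k ?S (\<lambda>z. ?m z \<bullet> b)"
        by (simp add: smooth_on_def inner_add_left inner_diff_left)
    qed
  qed
  show "smooth_on (ball p r) (?h b)" for b
  proof (rule smooth_on_integral[OF oS])
    show "smooth_on ?S (\<lambda>z. frechet_derivative f (at (?m z)) b)"
      by (rule smooth_on_compose[OF oS open_ball _ smooth_on_derivative[OF assms(1)] sm]) auto
  qed (use inb in auto)
  show "f x = f p + (\<Sum>b\<in>Basis. ((x - p) \<bullet> b) * ?h b x)" if x: "x \<in> ball p r" for x
  proof -
    have cont: "continuous_on {0..1} (\<lambda>t. frechet_derivative f (at (?m (t, x))) b)" for b
      by (rule continuous_on_compose2[OF smooth_on_continuous[OF smooth_on_derivative[OF assms(1)]]])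
        (use inb[OF x] in \<open>auto intro!: continuous_intros\<close>)
    have "((\<lambda>t. frechet_derivative f (at (p + t *\<^sub>R (x - p))) (x - p)) has_integral
        (f (p + (x - p)) - f p)) {0..1}"
      by (rule integral_derivative_segment[OF assms(1)]) (rule inb[OF x])
    then have "f x - f p = integral {0..1} (\<lambda>t. frechet_derivative f (at (?m (t, x))) (x - p))"
      by (simp add: integral_unique)
    also have "\<dots> = integral {0..1} (\<lambda>t. \<Sum>b\<in>Basis. ((x - p) \<bullet> b) * frechet_derivative f (at (?m (t, x))) b)"
    proof (rule integral_cong)
      fix t :: real assume t: "t \<in> {0..1}"
      interpret linear "frechet_derivative f (at (p + t *\<^sub>R (x - p)))"
        using smooth_on_differentiable[OF assms(1) inb[OF x t]] by (rule linear_frechet_derivative)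
      have "frechet_derivative f (at (?m (t, x))) (x - p) =
        frechet_derivative f (at (?m (t, x))) (\<Sum>b\<in>Basis. ((x - p) \<bullet> b) *\<^sub>R b)"
        by (simp only: euclidean_representation)
      then show "frechet_derivative f (at (?m (t, x))) (x - p) =
        (\<Sum>b\<in>Basis. ((x - p) \<bullet> b) * frechet_derivative f (at (?m (t, x))) b)"
        by (simp add: sum scale)
    qed
    also have "\<dots> = (\<Sum>b\<in>Basis. integral {0..1} (\<lambda>t. ((x - p) \<bullet> b) * frechet_derivative f (at (?m (t, x))) b))"
      by (rule integral_sum) (use cont in \<open>auto intro!: integrable_continuous_interval continuous_intros\<close>)
    finally show ?thesis by simp
  qed
  show "?h b p = frechet_derivative f (at p) b" for b by simp
qed

text \<open>The implicit function theorem, with the solution written as a shift along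
  \<open>e\<close>. The inverse function theorem supplies a differentiable \<open>s\<close>; the
  higher orders are bootstrapped from the formula for its derivative.\<close>

lemma implicit_shift:
  fixes \<delta> :: "'a::euclidean_space \<Rightarrow> real"
  assumes "open S" "smooth_on S \<delta>" "p \<in> S" "e \<in> Basis" "\<delta> p = 0"
    and ne: "frechet_derivative \<delta> (at p) e \<noteq> 0"
  obtains \<Omega> s where "open \<Omega>" "p \<in> \<Omega>" "smooth_on \<Omega> s" "s p = 0"
    "\<And>x. x \<in> \<Omega> \<Longrightarrow> x + s x *\<^sub>R e \<in> S" "\<And>x. x \<in> \<Omega> \<Longrightarrow> \<delta> (x + s x *\<^sub>R e) = 0"
proof -
  define S' where "S' = {x \<in> S. frechet_derivative \<delta> (at x) e \<noteq> 0}"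
  have cd: "continuous_on S (\<lambda>x. frechet_derivative \<delta> (at x) v)" for v
    by (rule smooth_on_continuous[OF smooth_on_derivative[OF assms(2)]])
  have oS': "open S'"
  proof -
    have "S' = S \<inter> (\<lambda>x. frechet_derivative \<delta> (at x) e) -` (- {0})" by (auto simp: S'_def)
    then show ?thesis
      using continuous_open_preimage[OF cd assms(1), of "- {0}" e] by (simp add: open_Compl)
  qed
  have pS': "p \<in> S'" using assms by (simp add: S'_def)
  have d\<delta>: "(\<delta> has_derivative frechet_derivative \<delta> (at x)) (at x)" if "x \<in> S" for x
    using smooth_on_differentiable[OF assms(2) that] frechet_derivative_works by blast
  define \<Phi> where "\<Phi> x = x + (\<delta> x - x \<bullet> e) *\<^sub>R e" for x
  define \<Phi>' where "\<Phi>' x = Blinfun (\<lambda>v. v + (frechet_derivative \<delta> (at x) v - v \<bullet> e) *\<^sub>R e)" for x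
  have ee: "e \<bullet> e = 1" using assms(4) by simp
  have bl: "bounded_linear (\<lambda>v. v + (frechet_derivative \<delta> (at x) v - v \<bullet> e) *\<^sub>R e)" if "x \<in> S" for x
    using has_derivative_bounded_linear[OF d\<delta>[OF that]]
    by (intro bounded_linear_add bounded_linear_ident bounded_linear_scaleR_const
        bounded_linear_sub bounded_linear_inner_left)
  have \<Phi>': "blinfun_apply (\<Phi>' x) v = v + (frechet_derivative \<delta> (at x) v - v \<bullet> e) *\<^sub>R e"
    if "x \<in> S" for x v
    using bl[OF that] by (simp add: \<Phi>'_def bounded_linear_Blinfun_apply)
  have der\<Phi>: "(\<Phi> has_derivative blinfun_apply (\<Phi>' x)) (at x)" if "x \<in> S" for x
  proof -
    have "(\<Phi> has_derivative (\<lambda>v. v + (frechet_derivative \<delta> (at x) v - v \<bullet> e) *\<^sub>R e)) (at x)"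
      unfolding \<Phi>_def by (auto intro!: derivative_eq_intros d\<delta>[OF that])
    then show ?thesis using \<Phi>'[OF that] by presburger
  qed
  have cont\<Phi>': "continuous_on S \<Phi>'"
  proof (rule continuous_on_blinfun_componentwise)
    fix i :: 'a
    have "continuous_on S (\<lambda>x. i + (frechet_derivative \<delta> (at x) i - i \<bullet> e) *\<^sub>R e)"
      by (intro continuous_intros cd)
    then show "continuous_on S (\<lambda>x. blinfun_apply (\<Phi>' x) i)"
      by (rule continuous_on_eq) (simp add: \<Phi>')
  qed
  let ?c = "frechet_derivative \<delta> (at p)"
  \<comment> \<open>The left inverse of \<open>\<Phi>' p\<close>: for the image w of v one has w
    \<bullet> e = \<open>?c\<close> v, and (\<open>?c\<close> w - \<open>?c\<close> v) /
    \<open>?c\<close> e is the multiple of \<open>e\<close> that has to be removed from w.\<close>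
  define I where "I = Blinfun (\<lambda>v. v + ((v \<bullet> e - ?c v) / ?c e) *\<^sub>R e)"
  interpret c: linear ?c using d\<delta>[OF assms(3)] has_derivative_linear by blast
  have blI: "bounded_linear (\<lambda>v. v + ((v \<bullet> e - ?c v) / ?c e) *\<^sub>R e)"
    using has_derivative_bounded_linear[OF d\<delta>[OF assms(3)]]
    by (intro bounded_linear_add bounded_linear_ident bounded_linear_scaleR_const
        bounded_linear_sub bounded_linear_inner_left bounded_linear_divide
        bounded_linear_compose[OF bounded_linear_divide])
  have I: "I o\<^sub>L \<Phi>' p = id_blinfun"
  proof (rule blinfun_eqI)
    fix v
    show "blinfun_apply (I o\<^sub>L \<Phi>' p) v = blinfun_apply id_blinfun v"
      using ne blI assms(3)
      by (simp add: I_def bounded_linear_Blinfun_apply \<Phi>' inner_add_left ee c.add c.scale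
          flip: scaleR_add_left)
  qed
  obtain U V \<Psi> \<Psi>' where U: "open U" "U \<subseteq> S" "p \<in> U" and V: "open V" "\<Phi> p \<in> V"
    and hom: "homeomorphism U V \<Phi> \<Psi>"
    and der\<Psi>: "\<And>y. y \<in> V \<Longrightarrow> (\<Psi> has_derivative (\<Psi>' y)) (at y)"
      "\<And>y. y \<in> V \<Longrightarrow> \<Psi>' y = inv (blinfun_apply (\<Phi>' (\<Psi> y)))"
      "\<And>y. y \<in> V \<Longrightarrow> bij (blinfun_apply (\<Phi>' (\<Psi> y)))"
    by (rule inverse_function_theorem[OF assms(1) der\<Phi> cont\<Phi>' assms(3) I], assumption) (rule that)
  \<comment> \<open>A point z has \<open>\<Phi> z = q x\<close> exactly if it differs from
    \<open>x\<close> by a multiple of \<open>e\<close> and satisfies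
    \<open>\<delta> z = 0\<close>.\<close>
  define q where "q x = x - (x \<bullet> e) *\<^sub>R e" for x
  define s where "s x = \<Psi> (q x) \<bullet> e - x \<bullet> e" for x
  have zS: "x + s x *\<^sub>R e = \<Psi> (q x)" "\<delta> (\<Psi> (q x)) = 0" "\<Psi> (q x) \<in> S"
    if "q x \<in> V" for x
  proof -
    let ?z = "\<Psi> (q x)"
    have z: "\<Phi> ?z = q x" and "?z \<in> U"
      using hom that by (auto simp: homeomorphism_def)
    then show "?z \<in> S" using U by blast
    have "\<Phi> ?z \<bullet> e = 0" using z by (simp add: q_def inner_diff_left ee)
    then show d0: "\<delta> ?z = 0" by (simp add: \<Phi>_def inner_add_left ee)
    have "?z - (?z \<bullet> e) *\<^sub>R e = x - (x \<bullet> e) *\<^sub>R e"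
      using z d0 by (simp add: \<Phi>_def q_def)
    then show "x + s x *\<^sub>R e = ?z"
      by (simp add: s_def scaleR_diff_left algebra_simps)
  qed
  have cq: "continuous_on UNIV q" unfolding q_def by (intro continuous_intros)
  define \<Omega>1 where "\<Omega>1 = q -` V"
  have o1: "open \<Omega>1" unfolding \<Omega>1_def by (rule open_vimage[OF V(1) cq])
  have s1: "\<Phi> p = q p" using assms(5) by (simp add: \<Phi>_def q_def)
  then have p1: "p \<in> \<Omega>1" using V by (simp add: \<Omega>1_def)
  have sp: "s p = 0"
  proof -
    have "\<Psi> (\<Phi> p) = p" using hom U by (auto simp: homeomorphism_def)
    then show ?thesis by (simp add: s_def s1[symmetric])
  qed
  have ds: "s differentiable (at x)" if "x \<in> \<Omega>1" for x
  proof -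
    have "(\<Psi> has_derivative \<Psi>' (q x)) (at (q x))" using der\<Psi> that by (simp add: \<Omega>1_def)
    moreover have "(q has_derivative (\<lambda>v. v - (v \<bullet> e) *\<^sub>R e)) (at x)"
      unfolding q_def by (auto intro!: derivative_eq_intros)
    ultimately have "((\<lambda>x. \<Psi> (q x)) has_derivative (\<lambda>v. \<Psi>' (q x) (v - (v \<bullet> e) *\<^sub>R e))) (at x)"
      using diff_chain_at[of q _ x \<Psi>] by (simp add: o_def)
    then show ?thesis unfolding s_def
      by (auto intro!: derivative_eq_intros differentiableI)
  qed
  have cs: "continuous_on \<Omega>1 s"
    using ds by (meson continuous_at_imp_continuous_on differentiable_imp_continuous_within)
  \<comment> \<open>The shrinking keeps the denominator in the derivative of \<open>s\<close>
    nonzero.\<close>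
  define \<Omega> where "\<Omega> = {x \<in> \<Omega>1. x + s x *\<^sub>R e \<in> S'}"
  have o\<Omega>: "open \<Omega>"
  proof -
    have "continuous_on \<Omega>1 (\<lambda>x. x + s x *\<^sub>R e)" by (intro continuous_intros cs)
    from continuous_open_preimage[OF this o1 oS'] show ?thesis
      unfolding \<Omega>_def by (rule back_subst[of "open"]) auto
  qed
  have p\<Omega>: "p \<in> \<Omega>" using p1 pS' sp by (simp add: \<Omega>_def)
  let ?z = "\<lambda>x. x + s x *\<^sub>R e"
  \<comment> \<open>Implicit differentiation of \<open>\<delta> (x + s x *\<^sub>R e) = 0\<close>.
    Only \<open>s\<close> itself occurs on the right, so order k for \<open>s\<close> yields order k
    + 1.\<close>
  let ?D = "\<lambda>v x. (- 1) * frechet_derivative \<delta> (at (?z x)) v * inverse (frechet_derivative \<delta> (at (?z x)) e)"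
  have ders: "(s has_derivative (\<lambda>v. ?D v x)) (at x)" if "x \<in> \<Omega>" for x
  proof -
    let ?s' = "frechet_derivative s (at x)"
    let ?d = "frechet_derivative \<delta> (at (?z x))"
    have x1: "x \<in> \<Omega>1" and zx: "?z x \<in> S'" using that by (auto simp: \<Omega>_def)
    have s': "(s has_derivative ?s') (at x)" using ds[OF x1] frechet_derivative_works by blast
    then have "(?z has_derivative (\<lambda>v. v + ?s' v *\<^sub>R e)) (at x)"
      by (auto intro!: derivative_eq_intros)
    moreover have dd: "(\<delta> has_derivative ?d) (at (?z x))" using d\<delta> zx by (simp add: S'_def)
    ultimately have "((\<lambda>x. \<delta> (?z x)) has_derivative (\<lambda>v. ?d (v + ?s' v *\<^sub>R e))) (at x)"
      using diff_chain_at[of ?z _ x \<delta>] by (simp add: o_def)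
    moreover have "((\<lambda>x. \<delta> (?z x)) has_derivative (\<lambda>v. 0)) (at x)"
      by (rule has_derivative_transform_within_open[OF has_derivative_const[of 0] o1 x1])
        (use zS in \<open>simp add: \<Omega>1_def\<close>)
    ultimately have "(\<lambda>v. ?d (v + ?s' v *\<^sub>R e)) = (\<lambda>v. 0)"
      by (rule has_derivative_unique)
    then have eq: "?d (v + ?s' v *\<^sub>R e) = 0" for v by (rule fun_cong)
    interpret d: linear ?d using dd has_derivative_linear by blast
    have "?s' v = ?D v x" for v
      using eq[of v] zx by (simp add: d.add d.scale S'_def field_simps)
    then have "?s' = (\<lambda>v. ?D v x)" by blast
    then show ?thesis using s' by simp
  qed
  have "smooth_on \<Omega> s"
    unfolding smooth_on_def
  proof
    fix k
    show "Ck_on k \<Omega> s"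
    proof (induction k)
      case 0
      then show ?case using continuous_on_subset[OF cs] by (auto simp: \<Omega>_def)
    next
      case (Suc k)
      have z: "Ck_on k \<Omega> ?z"
        by (intro Ck_on_add[OF o\<Omega>] Ck_on_id Ck_on_bounded_linear[OF bounded_linear_scaleR_left o\<Omega>] Suc)
      have D: "Ck_on k \<Omega> (\<lambda>x. frechet_derivative \<delta> (at (?z x)) v)" for v
        by (rule Ck_on_compose[OF o\<Omega> assms(1) _ _ z])
          (use smooth_on_derivative[OF assms(2)] in \<open>auto simp: smooth_on_def \<Omega>_def S'_def\<close>)
      have "Ck_on k \<Omega> (?D v)" for v
      proof (intro Ck_on_mult[OF o\<Omega>] Ck_on_const D Ck_on_inverse[OF o\<Omega>])
        show "frechet_derivative \<delta> (at (?z x)) e \<noteq> 0" if "x \<in> \<Omega>" for x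
          using that by (auto simp: \<Omega>_def S'_def)
      qed
      with Ck_on_SucI[OF o\<Omega> ders] show ?case by blast
    qed
  qed
  moreover have "?z x \<in> S" "\<delta> (?z x) = 0" if "x \<in> \<Omega>" for x
    using that zS by (auto simp: \<Omega>_def S'_def \<Omega>1_def)
  ultimately show ?thesis using that o\<Omega> p\<Omega> sp by blast
qed

text \<open>Along the segment from \<open>x\<close> to the point \<open>x + s x e\<close> of \<open>{\<delta> = 0}\<close> both \<open>f\<close> and \<open>\<delta>\<close> are \<open>- s x\<close>
  times the mean of their derivative in direction \<open>e\<close>; the quotient of the two means is smooth.\<close>

lemma hadamard_division:
  fixes \<delta> f :: "'a::euclidean_space \<Rightarrow> real"
  assumes "open S" "smooth_on S \<delta>" "smooth_on S f" "p \<in> S" "\<delta> p = 0"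
    and ne: "frechet_derivative \<delta> (at p) v \<noteq> 0"
    and f0: "\<And>x. x \<in> S \<Longrightarrow> \<delta> x = 0 \<Longrightarrow> f x = 0"
  obtains \<Omega> h where "open \<Omega>" "p \<in> \<Omega>" "\<Omega> \<subseteq> S" "smooth_on \<Omega> h" "\<And>x. x \<in> \<Omega> \<Longrightarrow> f x = h x * \<delta> x"
proof -
  obtain e where e: "e \<in> Basis" "frechet_derivative \<delta> (at p) e \<noteq> 0"
  proof (rule ccontr)
    assume neg: "\<not> thesis"
    note witness = that
    have "frechet_derivative \<delta> (at p) b = 0" if b: "b \<in> Basis" for b
      using neg witness[OF b] by blast
    moreover have "linear (frechet_derivative \<delta> (at p))"
      using smooth_on_differentiable[OF assms(2,4)] by (rule linear_frechet_derivative)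
    ultimately have "frechet_derivative \<delta> (at p) = (\<lambda>_. 0)"
      by (intro linear_eq_stdbasis linear_zero)
    with ne show False by simp
  qed
  obtain r where r: "r > 0" "ball p r \<subseteq> S" using assms(1,4) open_contains_ball by blast
  have sb: "smooth_on (ball p r) \<delta>" "smooth_on (ball p r) f"
    by (rule smooth_on_subset[OF assms(2) r(2)], rule smooth_on_subset[OF assms(3) r(2)])
  obtain \<Omega>0 s where \<Omega>0: "open \<Omega>0" "p \<in> \<Omega>0" "smooth_on \<Omega>0 s" "s p = 0"
    "\<And>x. x \<in> \<Omega>0 \<Longrightarrow> x + s x *\<^sub>R e \<in> ball p r" "\<And>x. x \<in> \<Omega>0 \<Longrightarrow> \<delta> (x + s x *\<^sub>R e) = 0"
    by (rule implicit_shift[OF open_ball sb(1) _ e(1) assms(5) e(2)], simp add: r) (rule that)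
  define \<Omega>1 where "\<Omega>1 = \<Omega>0 \<inter> ball p r"
  have \<Omega>1: "open \<Omega>1" "p \<in> \<Omega>1" "smooth_on \<Omega>1 s"
    using \<Omega>0(1,2) r smooth_on_subset[OF \<Omega>0(3)] by (auto simp: \<Omega>1_def)
  let ?m = "\<lambda>z::real \<times> 'a. snd z + (fst z * s (snd z)) *\<^sub>R e"
  have sm: "smooth_on (UNIV \<times> \<Omega>1) ?m" by (rule smooth_shift_map[OF \<Omega>1(1,3)])
  define Z where "Z = (UNIV \<times> \<Omega>1) \<inter> ?m -` ball p r"
  have oZ: "open Z" unfolding Z_def
    by (rule continuous_open_preimage[OF smooth_on_continuous[OF sm]])
      (auto intro!: open_Times \<Omega>1)
  have inb: "x + (t * s x) *\<^sub>R e \<in> ball p r" if "x \<in> \<Omega>1" "t \<in> {0..1}" for t x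
  proof -
    have "(1 - t) *\<^sub>R x + t *\<^sub>R (x + s x *\<^sub>R e) \<in> ball p r"
      using that \<Omega>0(5)[of x] by (intro convexD[OF convex_ball]) (auto simp: \<Omega>1_def)
    then show ?thesis by (simp add: algebra_simps)
  qed
  define J where "J k x = integral {0..1} (\<lambda>t. frechet_derivative k (at (?m (t, x))) e)"
    for k :: "'a \<Rightarrow> real" and x
  have smJ: "smooth_on \<Omega>1 (J k)" if "smooth_on (ball p r) k" for k
    unfolding J_def
  proof (rule smooth_on_integral[OF oZ \<Omega>1(1)])
    show "smooth_on Z (\<lambda>z. frechet_derivative k (at (?m z)) e)"
      by (rule smooth_on_compose[OF oZ open_ball _ smooth_on_derivative[OF that]
            smooth_on_subset[OF sm]]) (auto simp: Z_def)
  qed (use inb in \<open>auto simp: Z_def\<close>)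
  have J: "k x = - s x * J k x"
    if k: "smooth_on (ball p r) k" and k0: "k (x + s x *\<^sub>R e) = 0" and x: "x \<in> \<Omega>1" for k x
  proof -
    have "((\<lambda>t. frechet_derivative k (at (x + t *\<^sub>R (s x *\<^sub>R e))) (s x *\<^sub>R e)) has_integral
        (k (x + s x *\<^sub>R e) - k x)) {0..1}"
      by (rule integral_derivative_segment[OF k]) (use inb[OF x] in simp)
    then have "- k x = integral {0..1} (\<lambda>t. frechet_derivative k (at (?m (t, x))) (s x *\<^sub>R e))"
      using k0 by (simp add: integral_unique)
    also have "\<dots> = integral {0..1} (\<lambda>t. s x * frechet_derivative k (at (?m (t, x))) e)"
    proof (rule integral_cong)
      fix t :: real assume t: "t \<in> {0..1}"
      have "linear (frechet_derivative k (at (?m (t, x))))"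
        using smooth_on_differentiable[OF k] inb[OF x t] by (simp add: linear_frechet_derivative)
      from linear_scale[OF this] show "frechet_derivative k (at (?m (t, x))) (s x *\<^sub>R e) =
          s x * frechet_derivative k (at (?m (t, x))) e" by simp
    qed
    also have "\<dots> = s x * J k x" by (simp add: J_def)
    finally show ?thesis by simp
  qed
  \<comment> \<open>At \<open>p\<close> the segment shrinks to a point, so
    \<open>J \<delta> p\<close> is the derivative of \<delta> in direction \<open>e\<close>. The
    quotient of the two means stays defined where \<open>s\<close> vanishes, which a quotient of
    \<open>f\<close> by \<delta> does not.\<close>
  define \<Omega> where "\<Omega> = \<Omega>1 \<inter> J \<delta> -` (- {0})"
  have o\<Omega>: "open \<Omega>" unfolding \<Omega>_def
    by (rule continuous_open_preimage[OF smooth_on_continuous[OF smJ[OF sb(1)]] \<Omega>1(1)]) auto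
  have "J \<delta> p = frechet_derivative \<delta> (at p) e" by (simp add: J_def \<Omega>0)
  then have p\<Omega>: "p \<in> \<Omega>" using e \<Omega>1 by (simp add: \<Omega>_def)
  have sub: "\<Omega> \<subseteq> \<Omega>1" by (auto simp: \<Omega>_def)
  have "smooth_on \<Omega> (\<lambda>x. J f x * inverse (J \<delta> x))"
    by (intro smooth_on_mult[OF o\<Omega>] smooth_on_inverse[OF o\<Omega>] smooth_on_subset[OF smJ sub] sb)
      (simp add: \<Omega>_def)
  moreover have "f x = J f x * inverse (J \<delta> x) * \<delta> x" if "x \<in> \<Omega>" for x
  proof -
    have x: "x \<in> \<Omega>1" "J \<delta> x \<noteq> 0" using that by (auto simp: \<Omega>_def)
    have z: "x + s x *\<^sub>R e \<in> ball p r" "\<delta> (x + s x *\<^sub>R e) = 0" using x \<Omega>0 by (auto simp: \<Omega>1_def)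
    have "f (x + s x *\<^sub>R e) = 0" using z f0 r by blast
    then show ?thesis using J[OF sb(2) _ x(1)] J[OF sb(1) z(2) x(1)] x(2) by simp
  qed
  ultimately show ?thesis using that[OF o\<Omega> p\<Omega>] sub r by (auto simp: \<Omega>1_def)
qed

section \<open>Manifolds, tangent vectors as derivations, vector fields\<close>

abbreviation cinv :: "('a, 'm::finite) chart \<Rightarrow> real ^ 'm \<Rightarrow> 'a" where
  "cinv c \<equiv> inv_into (fst c) (snd c)"

abbreviation coord :: "('a, 'm::finite) chart \<Rightarrow> 'm \<Rightarrow> 'a \<Rightarrow> real" where
  "coord c i \<equiv> \<lambda>q. snd c q $ i"

lemma sum_Basis_vec:
  fixes F :: "real ^ 'm::finite \<Rightarrow> 'b::comm_monoid_add"
  shows "(\<Sum>b\<in>Basis. F b) = (\<Sum>i\<in>UNIV. F (axis i 1))"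
proof -
  have 1: "(Basis :: (real ^ 'm) set) = range (\<lambda>i. axis i 1)"
    by (auto simp: Basis_vec_def)
  have 2: "inj (\<lambda>i::'m. axis i (1::real))"
    by (auto simp: inj_on_def axis_eq_axis)
  show ?thesis unfolding 1 sum.reindex[OF 2] o_def ..
qed

locale smooth_manifold =
  fixes M :: "('a::t2_space, 'm::finite) chart set"
  assumes smooth_structure: "smooth_structure M"
begin

abbreviation TM :: "'a \<Rightarrow> 'a tvec set" where "TM \<equiv> tangent_space M"

abbreviation VF :: "'a set \<Rightarrow> 'a vfield \<Rightarrow> bool" where "VF \<equiv> vector_field M"

subsection \<open>Charts and smooth functions\<close>

lemma is_chart: "c \<in> M \<Longrightarrow> is_chart c"
  and compatible: "c \<in> M \<Longrightarrow> d \<in> M \<Longrightarrow> compatible c d"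
  and charts_cover: "(\<Union>c\<in>M. fst c) = UNIV"
  using smooth_structure unfolding smooth_structure_def by blast+

lemma chart_props:
  assumes "c \<in> M"
  shows chart_open: "open (fst c)"
    and chart_continuous: "continuous_on (fst c) (snd c)"
    and cinv_continuous: "continuous_on (snd c ` fst c) (cinv c)"
    and cinv_chart: "p \<in> fst c \<Longrightarrow> cinv c (snd c p) = p"
proof -
  have "open (fst c)" and h: "homeomorphism (fst c) (snd c ` fst c) (snd c) (cinv c)"
    using is_chart[OF assms] unfolding is_chart_def by blast+
  then show "open (fst c)" by blast
  show "continuous_on (fst c) (snd c)" by (rule homeomorphism_cont1[OF h])
  show "continuous_on (snd c ` fst c) (cinv c)" by (rule homeomorphism_cont2[OF h])
  show "cinv c (snd c p) = p" if "p \<in> fst c" by (rule homeomorphism_apply1[OF h that])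
qed

lemma chart_cover: obtains c where "c \<in> M" "p \<in> fst c"
  using charts_cover by blast

lemma chart_image_open:
  assumes "c \<in> M" "open W" shows "open (snd c ` (fst c \<inter> W))"
proof -
  have o: "open (snd c ` fst c)"
    using is_chart[OF assms(1)] unfolding is_chart_def by blast
  have "snd c ` (fst c \<inter> W) = snd c ` fst c \<inter> cinv c -` W"
    using cinv_chart[OF assms(1)] by auto
  then show ?thesis
    using continuous_open_preimage[OF cinv_continuous[OF assms(1)] o assms(2)] by simp
qed

lemma transition_smooth:
  assumes "c \<in> M" "d \<in> M"
  shows "smooth_on (snd c ` (fst c \<inter> fst d)) (\<lambda>x. snd d (cinv c x))"
  using compatible[OF assms] unfolding compatible_def o_def by blast

lemma smooth_fun_subset: "smooth_fun M W f \<Longrightarrow> V \<subseteq> W \<Longrightarrow> smooth_fun M V f"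
  unfolding smooth_fun_def
  by (meson Int_mono image_mono order_refl smooth_on_subset)

lemma smooth_fun_near: "smooth_fun M W f \<Longrightarrow> open W \<Longrightarrow> p \<in> W \<Longrightarrow> smooth_near M p f"
  by (auto simp: smooth_near_def)

lemma smooth_fun_chartD:
  assumes "smooth_fun M W f" "c \<in> M"
  shows "smooth_on (snd c ` (fst c \<inter> W)) (\<lambda>x. f (cinv c x))"
  using assms by (auto simp: smooth_fun_def o_def)

lemma smooth_funI:
  assumes "\<And>c. c \<in> M \<Longrightarrow> smooth_on (snd c ` (fst c \<inter> W)) (\<lambda>x. f (cinv c x))"
  shows "smooth_fun M W f"
  using assms by (auto simp: smooth_fun_def o_def)

lemma smooth_fun_local:
  assumes "\<And>p. p \<in> W \<Longrightarrow> smooth_near M p f"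
  shows "smooth_fun M W f"
proof (rule smooth_funI)
  fix c assume c: "c \<in> M"
  show "smooth_on (snd c ` (fst c \<inter> W)) (\<lambda>x. f (cinv c x))"
  proof (rule smooth_on_local)
    fix x assume "x \<in> snd c ` (fst c \<inter> W)"
    then obtain p where p: "p \<in> fst c" "p \<in> W" "x = snd c p" by auto
    obtain V where V: "open V" "p \<in> V" "smooth_fun M V f"
      using assms[OF p(2)] by (auto simp: smooth_near_def)
    show "\<exists>T. open T \<and> x \<in> T \<and> smooth_on T (\<lambda>x. f (cinv c x))"
      using chart_image_open[OF c V(1)] smooth_fun_chartD[OF V(3) c] p V by blast
  qed
qed

lemma smooth_fun_cong:
  assumes "open W" "\<And>p. p \<in> W \<Longrightarrow> f p = h p"
  shows "smooth_fun M W f \<longleftrightarrow> smooth_fun M W h"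
proof -
  have "smooth_on (snd c ` (fst c \<inter> W)) (\<lambda>x. f (cinv c x)) \<longleftrightarrow>
      smooth_on (snd c ` (fst c \<inter> W)) (\<lambda>x. h (cinv c x))" if "c \<in> M" for c
    by (rule smooth_on_cong[OF chart_image_open[OF that assms(1)]])
      (use assms(2) cinv_chart[OF that] in auto)
  then show ?thesis using smooth_funI smooth_fun_chartD by meson
qed

lemma smooth_near_cong:
  assumes "smooth_near M p f" "\<forall>\<^sub>F q in nhds p. f q = h q"
  shows "smooth_near M p h"
proof -
  obtain V where V: "open V" "p \<in> V" "smooth_fun M V f"
    using assms by (auto simp: smooth_near_def)
  obtain W where W: "open W" "p \<in> W" "\<And>q. q \<in> W \<Longrightarrow> f q = h q"
    using assms(2) by (auto simp: eventually_nhds)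
  have "smooth_fun M (V \<inter> W) f" using smooth_fun_subset[OF V(3)] by auto
  then have "smooth_fun M (V \<inter> W) h"
    using smooth_fun_cong[of "V \<inter> W" f h] V W by auto
  then show ?thesis by (rule smooth_fun_near) (use V W in auto)
qed

text \<open>One chart containing \<open>W\<close> suffices, since the expression in any other chart
  differs by a smooth transition map.\<close>

lemma smooth_fun_chartI:
  assumes c: "c \<in> M" and W: "open W" "W \<subseteq> fst c"
    and f: "smooth_on (snd c ` W) (\<lambda>x. f (cinv c x))"
  shows "smooth_fun M W f"
proof (rule smooth_funI)
  fix d assume d: "d \<in> M"
  have o: "open (snd d ` (fst d \<inter> W))" by (rule chart_image_open[OF d W(1)])
  have oc: "open (snd c ` W)" using chart_image_open[OF c W(1)] W(2) by (simp add: Int_absorb1)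
  have t: "smooth_on (snd d ` (fst d \<inter> W)) (\<lambda>x. snd c (cinv d x))"
    by (rule smooth_on_subset[OF transition_smooth[OF d c]]) (use W in auto)
  have "smooth_on (snd d ` (fst d \<inter> W)) (\<lambda>x. f (cinv c (snd c (cinv d x))))"
    by (rule smooth_on_compose[OF o oc _ f t]) (use cinv_chart[OF d] in auto)
  then show "smooth_on (snd d ` (fst d \<inter> W)) (\<lambda>x. f (cinv d x))"
    by (rule smooth_on_cong[OF o, THEN iffD1, rotated])
      (use cinv_chart[OF d] cinv_chart[OF c] W in auto)
qed

lemma smooth_fun_compose_chart:
  assumes c: "c \<in> M" and W: "open W" "W \<subseteq> fst c" and f: "smooth_on (snd c ` W) F"
  shows "smooth_fun M W (\<lambda>q. F (snd c q))"
proof (rule smooth_fun_chartI[OF c W])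
  have oc: "open (snd c ` W)" using chart_image_open[OF c W(1)] W(2) by (simp add: Int_absorb1)
  show "smooth_on (snd c ` W) (\<lambda>x. F (snd c (cinv c x)))"
    by (rule smooth_on_cong[OF oc, THEN iffD1, OF _ f]) (use W cinv_chart[OF c] in auto)
qed

lemma smooth_fun_continuous:
  assumes "smooth_fun M W f" "open W" shows "continuous_on W f"
proof -
  have "isCont f p" if p: "p \<in> W" for p
  proof -
    obtain c where c: "c \<in> M" "p \<in> fst c" by (rule chart_cover)
    have "continuous_on (snd c ` (fst c \<inter> W)) (\<lambda>x. f (cinv c x))"
      using smooth_fun_chartD[OF assms(1) c(1)] by (rule smooth_on_continuous)
    then have "continuous_on (fst c \<inter> W) (\<lambda>q. f (cinv c (snd c q)))"
      by (rule continuous_on_compose2)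
        (auto intro: continuous_on_subset[OF chart_continuous[OF c(1)]])
    then have "continuous_on (fst c \<inter> W) f"
      by (rule continuous_on_cong[THEN iffD1, rotated -1]) (auto simp: cinv_chart[OF c(1)])
    then show ?thesis
      using c p chart_open[OF c(1)] assms(2)
      by (simp add: continuous_on_eq_continuous_at open_Int)
  qed
  then show ?thesis by (simp add: continuous_at_imp_continuous_on)
qed

lemma smooth_fun_const: "smooth_fun M W (\<lambda>p. a)"
  by (rule smooth_funI) (rule smooth_on_const)

lemma smooth_fun_add:
  "open W \<Longrightarrow> smooth_fun M W f \<Longrightarrow> smooth_fun M W h \<Longrightarrow> smooth_fun M W (\<lambda>p. f p + h p)"
  by (rule smooth_funI, rule smooth_on_add[OF chart_image_open smooth_fun_chartD smooth_fun_chartD])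

lemma smooth_fun_mult:
  "open W \<Longrightarrow> smooth_fun M W f \<Longrightarrow> smooth_fun M W h \<Longrightarrow> smooth_fun M W (\<lambda>p. f p * h p)"
  by (rule smooth_funI, rule smooth_on_mult[OF chart_image_open smooth_fun_chartD smooth_fun_chartD])

lemma smooth_fun_uminus: "open W \<Longrightarrow> smooth_fun M W f \<Longrightarrow> smooth_fun M W (\<lambda>p. - f p)"
  using smooth_fun_mult[OF _ smooth_fun_const[of W "-1"]] by simp

lemma smooth_fun_diff:
  "open W \<Longrightarrow> smooth_fun M W f \<Longrightarrow> smooth_fun M W h \<Longrightarrow> smooth_fun M W (\<lambda>p. f p - h p)"
  using smooth_fun_add[OF _ _ smooth_fun_uminus] by simp

lemma smooth_fun_inverse:
  assumes "open W" "smooth_fun M W f" "\<And>p. p \<in> W \<Longrightarrow> f p \<noteq> 0"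
  shows "smooth_fun M W (\<lambda>p. inverse (f p))"
proof (rule smooth_funI)
  fix c assume c: "c \<in> M"
  show "smooth_on (snd c ` (fst c \<inter> W)) (\<lambda>x. inverse (f (cinv c x)))"
    by (rule smooth_on_inverse[OF chart_image_open[OF c assms(1)] smooth_fun_chartD[OF assms(2) c]])
      (use assms(3) cinv_chart[OF c] in auto)
qed

lemma smooth_fun_divide:
  assumes "open W" "smooth_fun M W f" "smooth_fun M W h" "\<And>p. p \<in> W \<Longrightarrow> h p \<noteq> 0"
  shows "smooth_fun M W (\<lambda>p. f p / h p)"
  unfolding divide_inverse using assms by (intro smooth_fun_mult smooth_fun_inverse) auto

lemma smooth_fun_sum:
  assumes "open W" "\<And>i. i \<in> I \<Longrightarrow> smooth_fun M W (f i)"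
  shows "smooth_fun M W (\<lambda>p. \<Sum>i\<in>I. f i p)"
proof (cases "finite I")
  case True
  then show ?thesis using assms(2)
    by (induction I rule: finite_induct) (auto intro!: smooth_fun_const smooth_fun_add assms(1))
qed (simp add: smooth_fun_const)

lemma smooth_fun_prod:
  assumes "open W" "\<And>i. i \<in> I \<Longrightarrow> smooth_fun M W (f i)"
  shows "smooth_fun M W (\<lambda>p. \<Prod>i\<in>I. f i p)"
proof (cases "finite I")
  case True
  then show ?thesis using assms(2)
    by (induction I rule: finite_induct) (auto intro!: smooth_fun_const smooth_fun_mult assms(1))
qed (simp add: smooth_fun_const)

lemma smooth_fun_det:
  fixes A :: "'a \<Rightarrow> real ^ 'n ^ 'n"
  assumes "open W" "\<And>i j. smooth_fun M W (\<lambda>p. A p $ i $ j)"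
  shows "smooth_fun M W (\<lambda>p. det (A p))"
  unfolding det_def
  by (intro smooth_fun_sum smooth_fun_mult smooth_fun_prod smooth_fun_const assms)

lemma smooth_nearE:
  assumes "smooth_near M p f"
  obtains W where "open W" "p \<in> W" "smooth_fun M W f"
  using assms by (auto simp: smooth_near_def)

lemma smooth_near_const: "smooth_near M p (\<lambda>q. a)"
  by (rule smooth_fun_near[OF smooth_fun_const[of UNIV]]) auto

lemma smooth_near_binary:
  assumes "smooth_near M p f" "smooth_near M p h"
    and "\<And>W. open W \<Longrightarrow> smooth_fun M W f \<Longrightarrow> smooth_fun M W h \<Longrightarrow> smooth_fun M W k"
  shows "smooth_near M p k"
proof -
  obtain V W where "open V" "p \<in> V" "smooth_fun M V f" "open W" "p \<in> W" "smooth_fun M W h"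
    using assms(1,2) by (auto simp: smooth_near_def)
  then have "smooth_fun M (V \<inter> W) k"
    by (intro assms(3)) (auto intro: smooth_fun_subset)
  then show ?thesis by (rule smooth_fun_near) (use \<open>open V\<close> \<open>open W\<close> \<open>p \<in> V\<close> \<open>p \<in> W\<close> in auto)
qed

lemma smooth_near_add:
  "smooth_near M p f \<Longrightarrow> smooth_near M p h \<Longrightarrow> smooth_near M p (\<lambda>q. f q + h q)"
  by (erule (1) smooth_near_binary) (rule smooth_fun_add)

lemma smooth_near_mult:
  "smooth_near M p f \<Longrightarrow> smooth_near M p h \<Longrightarrow> smooth_near M p (\<lambda>q. f q * h q)"
  by (erule (1) smooth_near_binary) (rule smooth_fun_mult)

lemma smooth_near_sum:
  assumes "\<And>i. i \<in> I \<Longrightarrow> smooth_near M p (f i)"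
  shows "smooth_near M p (\<lambda>q. \<Sum>i\<in>I. f i q)"
proof (cases "finite I")
  case True
  then show ?thesis using assms
    by (induction I rule: finite_induct) (auto intro!: smooth_near_const smooth_near_add)
qed (simp add: smooth_near_const)

lemma smooth_near_prod:
  assumes "\<And>i. i \<in> I \<Longrightarrow> smooth_near M p (f i)"
  shows "smooth_near M p (\<lambda>q. \<Prod>i\<in>I. f i q)"
proof (cases "finite I")
  case True
  then show ?thesis using assms
    by (induction I rule: finite_induct) (auto intro!: smooth_near_const smooth_near_mult)
qed (simp add: smooth_near_const)

lemma coord_smooth: assumes "c \<in> M" shows "smooth_fun M (fst c) (coord c i)"
  by (rule smooth_fun_compose_chart[OF assms chart_open[OF assms] order_refl])
    (rule smooth_on_bounded_linear[OF bounded_linear_vec_nth],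
      use chart_image_open[OF assms open_UNIV] in simp)

subsection \<open>Tangent vectors\<close>

lemma tv_cong:
  assumes "v \<in> TM p" "smooth_near M p f" "\<forall>\<^sub>F q in nhds p. f q = h q"
  shows "v f = v h"
  using assms smooth_near_cong[OF assms(2,3)] unfolding tangent_space_def by blast

lemma tv_cong_open:
  assumes "v \<in> TM p" "smooth_near M p f" "open W" "p \<in> W"
    "\<And>q. q \<in> W \<Longrightarrow> f q = h q"
  shows "v f = v h"
  using tv_cong[OF assms(1,2)] assms(3-5) unfolding eventually_nhds by blast

lemma tv_nonsmooth: "v \<in> TM p \<Longrightarrow> \<not> smooth_near M p f \<Longrightarrow> v f = 0"
  unfolding tangent_space_def by blast

lemma tv_lin:
  assumes "v \<in> TM p" "smooth_near M p f" "smooth_near M p h"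
  shows "v (\<lambda>q. a * f q + b * h q) = a * v f + b * v h"
  using assms unfolding tangent_space_def by blast

lemma tv_add:
  assumes "v \<in> TM p" "smooth_near M p f" "smooth_near M p h"
  shows "v (\<lambda>q. f q + h q) = v f + v h"
  using tv_lin[OF assms, of 1 1] by simp

lemma tv_mult:
  assumes "v \<in> TM p" "smooth_near M p f" "smooth_near M p h"
  shows "v (\<lambda>q. f q * h q) = v f * h p + f p * v h"
  using assms unfolding tangent_space_def by blast

text \<open>The product rule for 1 = 1 * 1 forces the value at 1 to equal twice itself.\<close>

lemma tv_const:
  assumes v: "v \<in> TM p"
  shows "v (\<lambda>q. a) = 0"
proof -
  have "v (\<lambda>q. 1) = 0" using tv_mult[OF v smooth_near_const smooth_near_const, of 1 1] by simp
  then show ?thesis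
    using tv_lin[OF v smooth_near_const smooth_near_const, of a 1 0 1] by simp
qed

lemma tv_cmult:
  assumes "v \<in> TM p" "smooth_near M p f"
  shows "v (\<lambda>q. a * f q) = a * v f"
  using tv_lin[OF assms assms(2), of a 0] by simp

lemma tv_sum:
  assumes "v \<in> TM p" "finite I" "\<And>i. i \<in> I \<Longrightarrow> smooth_near M p (f i)"
  shows "v (\<lambda>q. \<Sum>i\<in>I. f i q) = (\<Sum>i\<in>I. v (f i))"
  using assms(2,3)
  by (induction I rule: finite_induct)
    (auto simp: tv_const[OF assms(1)] tv_add[OF assms(1)] smooth_near_sum)

lemma tv_prod:
  assumes "v \<in> TM p" "finite I" "\<And>i. i \<in> I \<Longrightarrow> smooth_near M p (f i)"
  shows "v (\<lambda>q. \<Prod>i\<in>I. f i q) = (\<Sum>i\<in>I. v (f i) * (\<Prod>j\<in>I - {i}. f j p))"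
  using assms(2,3)
proof (induction I rule: finite_induct)
  case empty
  then show ?case by (simp add: tv_const[OF assms(1)])
next
  case (insert x I)
  have "(\<Prod>j\<in>insert x I - {i}. f j p) = f x p * (\<Prod>j\<in>I - {i}. f j p)" if "i \<in> I" for i
  proof -
    have "insert x I - {i} = insert x (I - {i})" using that insert.hyps by auto
    then show ?thesis using insert.hyps by simp
  qed
  then have "(\<Sum>i\<in>I. v (f i) * (\<Prod>j\<in>insert x I - {i}. f j p)) =
      f x p * (\<Sum>i\<in>I. v (f i) * (\<Prod>j\<in>I - {i}. f j p))"
    by (simp add: sum_distrib_left algebra_simps)
  then show ?case using insert
    by (simp add: tv_mult[OF assms(1)] smooth_near_prod)
qed

lemma tv_combination:
  assumes "u \<in> TM p" "v \<in> TM p"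
  shows "(\<lambda>f. a * u f + b * v f) \<in> TM p"
proof -
  have "(\<lambda>f. a * u f + b * v f) f = (\<lambda>f. a * u f + b * v f) h"
    if "smooth_near M p f" "\<forall>\<^sub>F q in nhds p. f q = h q" for f h
    using tv_cong[OF assms(1) that] tv_cong[OF assms(2) that] by simp
  then show ?thesis
    unfolding tangent_space_def
    by (auto simp: tv_nonsmooth[OF assms(1)] tv_nonsmooth[OF assms(2)] tv_lin[OF assms(1)]
        tv_lin[OF assms(2)] tv_mult[OF assms(1)] tv_mult[OF assms(2)] algebra_simps)
qed

lemma tv_zero: "(\<lambda>f. 0) \<in> TM p"
  by (simp add: tangent_space_def)

lemma tv_combination_sum:
  assumes "\<And>i. i \<in> I \<Longrightarrow> E i \<in> TM p"
  shows "(\<lambda>f. \<Sum>i\<in>I. a i * E i f) \<in> TM p"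
proof (cases "finite I")
  case True
  then show ?thesis using assms
  proof (induction I rule: finite_induct)
    case (insert x I)
    then show ?case using tv_combination[of "E x" p "\<lambda>f. \<Sum>i\<in>I. a i * E i f" "a x" 1] by simp
  qed (simp add: tv_zero)
qed (simp add: tv_zero)

lemma coord_vec_eq:
  "smooth_near M p f \<Longrightarrow> coord_vec M c i p f =
    frechet_derivative (\<lambda>x. f (cinv c x)) (at (snd c p)) (axis i 1)"
  by (simp add: coord_vec_def o_def)

lemma has_derivative_chart:
  assumes "c \<in> M" "p \<in> fst c" "smooth_near M p f"
  shows "((\<lambda>x. f (cinv c x)) has_derivative
    frechet_derivative (\<lambda>x. f (cinv c x)) (at (snd c p))) (at (snd c p))"
proof -
  obtain W where W: "open W" "p \<in> W" "smooth_fun M W f"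
    using assms(3) by (rule smooth_nearE)
  have "(\<lambda>x. f (cinv c x)) differentiable (at (snd c p))"
    by (rule smooth_on_differentiable[OF smooth_fun_chartD[OF W(3) assms(1)]])
      (use assms W in auto)
  then show ?thesis using frechet_derivative_works by blast
qed

lemma coord_vec_tangent:
  assumes c: "c \<in> M" "p \<in> fst c"
  shows "coord_vec M c i p \<in> TM p"
proof -
  let ?x = "snd c p"
  have zero: "coord_vec M c i p f = 0" if "\<not> smooth_near M p f" for f
    using that by (simp add: coord_vec_def)
  have cong: "coord_vec M c i p f = coord_vec M c i p h"
    if that: "smooth_near M p f" "smooth_near M p h" and ev: "\<forall>\<^sub>F q in nhds p. f q = h q" for f h
  proof -
    obtain W where W: "open W" "p \<in> W" "\<And>q. q \<in> W \<Longrightarrow> f q = h q"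
      using ev by (auto simp: eventually_nhds)
    have "((\<lambda>x. h (cinv c x)) has_derivative frechet_derivative (\<lambda>x. f (cinv c x)) (at ?x)) (at ?x)"
      by (rule has_derivative_transform_within_open[OF has_derivative_chart[OF c that(1)]
            chart_image_open[OF c(1) W(1)]])
        (use c W cinv_chart[OF c(1)] in auto)
    then show ?thesis using that by (simp add: coord_vec_eq frechet_derivative_eqI)
  qed
  have lin: "coord_vec M c i p (\<lambda>q. a * f q + b * h q) = a * coord_vec M c i p f + b * coord_vec M c i p h"
    if "smooth_near M p f" "smooth_near M p h" for f h a b
  proof -
    have "((\<lambda>x. a * f (cinv c x) + b * h (cinv c x)) has_derivative
      (\<lambda>v. a * frechet_derivative (\<lambda>x. f (cinv c x)) (at ?x) v +
           b * frechet_derivative (\<lambda>x. h (cinv c x)) (at ?x) v)) (at ?x)"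
      using has_derivative_chart[OF c that(1)] has_derivative_chart[OF c that(2)]
      by (auto intro!: derivative_eq_intros)
    then show ?thesis using that
      by (simp add: coord_vec_eq frechet_derivative_eqI smooth_near_add smooth_near_mult smooth_near_const)
  qed
  have prod: "coord_vec M c i p (\<lambda>q. f q * h q) = coord_vec M c i p f * h p + f p * coord_vec M c i p h"
    if "smooth_near M p f" "smooth_near M p h" for f h
  proof -
    have "((\<lambda>x. f (cinv c x) * h (cinv c x)) has_derivative
      (\<lambda>v. f (cinv c ?x) * frechet_derivative (\<lambda>x. h (cinv c x)) (at ?x) v +
           frechet_derivative (\<lambda>x. f (cinv c x)) (at ?x) v * h (cinv c ?x))) (at ?x)"
      by (rule has_derivative_mult[OF has_derivative_chart[OF c that(1)] has_derivative_chart[OF c that(2)]])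
    then show ?thesis using that
      by (simp add: coord_vec_eq frechet_derivative_eqI smooth_near_mult cinv_chart[OF c(1,2)])
  qed
  show ?thesis
    unfolding tangent_space_def mem_Collect_eq
    by (intro conjI allI impI; (elim conjE)?; (rule zero lin prod cong; assumption))
qed

lemma coord_vec_coord:
  assumes c: "c \<in> M" "p \<in> fst c"
  shows "coord_vec M c i p (coord c j) = (if i = j then 1 else 0)"
proof -
  have o: "open (snd c ` fst c)" using chart_image_open[OF c(1) open_UNIV] by simp
  have "((\<lambda>x. x $ j) has_derivative (\<lambda>v. v $ j)) (at (snd c p))"
    by (rule bounded_linear.has_derivative[OF bounded_linear_vec_nth has_derivative_ident])
  then have "((\<lambda>x. snd c (cinv c x) $ j) has_derivative (\<lambda>v. v $ j)) (at (snd c p))"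
    by (rule has_derivative_transform_within_open[OF _ o]) (use c cinv_chart[OF c(1)] in auto)
  moreover have "smooth_near M p (coord c j)"
    by (rule smooth_fun_near[OF coord_smooth[OF c(1)] chart_open[OF c(1)] c(2)])
  ultimately show ?thesis
    by (simp add: coord_vec_eq frechet_derivative_eqI) (simp add: axis_def)
qed

text \<open>By \<open>smooth_on_taylor\<close>, \<open>f\<close> is near \<open>p\<close> a constant
  plus a sum of products of \<open>snd c q $ i - snd c p $ i\<close> with smooth functions. The
  first factors vanish at \<open>p\<close>, so the product rule leaves only
  \<open>v (coord c i)\<close> times the partial derivative. For a function that is not smooth near
  \<open>p\<close> both sides are 0 by convention.\<close>

lemma tv_expansion:
  assumes c: "c \<in> M" "p \<in> fst c" and v: "v \<in> TM p"
  shows "v f = (\<Sum>i\<in>UNIV. v (coord c i) * coord_vec M c i p f)"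
proof (cases "smooth_near M p f")
  case False
  then show ?thesis using tv_nonsmooth[OF v] by (simp add: coord_vec_def)
next
  case True
  then obtain W where W: "open W" "p \<in> W" "smooth_fun M W f" by (rule smooth_nearE)
  let ?x = "snd c p" and ?F = "\<lambda>x. f (cinv c x)"
  have "?x \<in> snd c ` (fst c \<inter> W)" using c W by auto
  then obtain r where r: "r > 0" "ball ?x r \<subseteq> snd c ` (fst c \<inter> W)"
    using chart_image_open[OF c(1) W(1)] open_contains_ball by blast
  obtain h where h: "\<And>b. b \<in> Basis \<Longrightarrow> smooth_on (ball ?x r) (h b)"
    "\<And>x. x \<in> ball ?x r \<Longrightarrow> ?F x = ?F ?x + (\<Sum>b\<in>Basis. ((x - ?x) \<bullet> b) * h b x)"
    "\<And>b. b \<in> Basis \<Longrightarrow> h b ?x = frechet_derivative ?F (at ?x) b"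
    by (rule smooth_on_taylor[OF smooth_on_subset[OF smooth_fun_chartD[OF W(3) c(1)] r(2)] r(1)]) blast
  define V where "V = fst c \<inter> snd c -` ball ?x r"
  have oV: "open V" unfolding V_def
    by (rule continuous_open_preimage[OF chart_continuous[OF c(1)] chart_open[OF c(1)] open_ball])
  have pV: "p \<in> V" "V \<subseteq> fst c" using c r by (auto simp: V_def)
  let ?h = "\<lambda>i q. h (axis i 1) (snd c q)"
  have sh: "smooth_near M p (?h i)" for i
  proof (rule smooth_fun_near[OF _ oV pV(1)])
    show "smooth_fun M V (?h i)"
      by (rule smooth_fun_compose_chart[OF c(1) oV pV(2) smooth_on_subset[OF h(1)]])
        (auto simp: V_def axis_in_Basis_iff)
  qed
  have sx: "smooth_near M p (coord c i)" for i
    by (rule smooth_fun_near[OF coord_smooth[OF c(1)] chart_open[OF c(1)] c(2)])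
  have sxa: "smooth_near M p (\<lambda>q. snd c q $ i + - (?x $ i))" for i
    by (intro smooth_near_add sx smooth_near_const)
  have eq: "f q = f p + (\<Sum>i\<in>UNIV. (snd c q $ i + - (?x $ i)) * ?h i q)" if q: "q \<in> V" for q
  proof -
    have q': "q \<in> fst c" "snd c q \<in> ball ?x r" using q by (auto simp: V_def)
    show ?thesis
      using h(2)[OF q'(2)] cinv_chart[OF c(1)] q'(1) c(2)
      by (simp add: sum_Basis_vec inner_axis)
  qed
  have s2: "smooth_near M p (\<lambda>q. \<Sum>i\<in>UNIV. (snd c q $ i + - (?x $ i)) * ?h i q)"
    by (intro smooth_near_sum smooth_near_mult sxa sh)
  have "v f = v (\<lambda>q. f p + (\<Sum>i\<in>UNIV. (snd c q $ i + - (?x $ i)) * ?h i q))"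
    by (rule tv_cong_open[OF v True oV pV(1) eq])
  also have "\<dots> = (\<Sum>i\<in>UNIV. v (\<lambda>q. (snd c q $ i + - (?x $ i)) * ?h i q))"
    by (simp only: tv_add[OF v smooth_near_const s2] tv_const[OF v]
        tv_sum[OF v finite smooth_near_mult[OF sxa sh]] add_0)
  also have "\<dots> = (\<Sum>i\<in>UNIV. v (coord c i) * coord_vec M c i p f)"
  proof (rule sum.cong[OF refl])
    fix i
    have "v (\<lambda>q. snd c q $ i + - (?x $ i)) = v (coord c i)"
      by (simp only: tv_add[OF v sx smooth_near_const] tv_const[OF v] add_0_right)
    then show "v (\<lambda>q. (snd c q $ i + - (?x $ i)) * ?h i q) = v (coord c i) * coord_vec M c i p f"
      using h(3)[of "axis i 1"] True
      by (simp only: tv_mult[OF v sxa sh]) (simp add: coord_vec_eq axis_in_Basis_iff)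
  qed
  finally show ?thesis .
qed

subsection \<open>Vector fields\<close>

lemma vf_subset: "VF W X \<Longrightarrow> V \<subseteq> W \<Longrightarrow> VF V X"
  unfolding vector_field_def by (meson subsetD subset_trans)

lemma vf_tangent: "VF W X \<Longrightarrow> p \<in> W \<Longrightarrow> X p \<in> TM p"
  unfolding vector_field_def by blast

lemma vf_smooth:
  assumes "VF W X" "open V" "V \<subseteq> W" "smooth_fun M V f"
  shows "smooth_fun M V (\<lambda>p. X p f)"
  using assms unfolding vector_field_def by blast

lemma vf_smooth_near:
  assumes "VF W X" "open W" "p \<in> W" "smooth_near M p f"
  shows "smooth_near M p (\<lambda>p. X p f)"
proof -
  obtain V where V: "open V" "p \<in> V" "smooth_fun M V f" using assms(4) by (rule smooth_nearE)
  have "smooth_fun M (V \<inter> W) (\<lambda>p. X p f)"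
    by (rule vf_smooth[OF assms(1) _ _ smooth_fun_subset[OF V(3)]]) (use V(1) assms(2) in auto)
  then show ?thesis by (rule smooth_fun_near) (use V assms in auto)
qed

lemma vf_combination:
  assumes W: "open W" and "smooth_fun M W a" "smooth_fun M W b" "VF W X" "VF W Y"
  shows "VF W (\<lambda>p f. a p * X p f + b p * Y p f)"
  unfolding vector_field_def
proof (intro conjI ballI allI impI)
  show "(\<lambda>f. a p * X p f + b p * Y p f) \<in> TM p" if "p \<in> W" for p
    by (intro tv_combination vf_tangent[OF assms(4) that] vf_tangent[OF assms(5) that])
  fix V f assume V: "open V \<and> V \<subseteq> W \<and> smooth_fun M V f"
  show "smooth_fun M V (\<lambda>p. a p * X p f + b p * Y p f)"
    using V by (intro smooth_fun_add smooth_fun_mult smooth_fun_subset[OF assms(2)]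
        smooth_fun_subset[OF assms(3)] vf_smooth[OF assms(4)] vf_smooth[OF assms(5)]) auto
qed

lemma vf_sum:
  assumes W: "open W" and "\<And>i. i \<in> I \<Longrightarrow> smooth_fun M W (a i)" "\<And>i. i \<in> I \<Longrightarrow> VF W (E i)"
  shows "VF W (\<lambda>p f. \<Sum>i\<in>I. a i p * E i p f)"
  unfolding vector_field_def
proof (intro conjI ballI allI impI)
  show "(\<lambda>f. \<Sum>i\<in>I. a i p * E i p f) \<in> TM p" if "p \<in> W" for p
    by (intro tv_combination_sum vf_tangent[OF assms(3) that])
  fix V f assume V: "open V \<and> V \<subseteq> W \<and> smooth_fun M V f"
  show "smooth_fun M V (\<lambda>p. \<Sum>i\<in>I. a i p * E i p f)"
    using V by (intro smooth_fun_sum smooth_fun_mult smooth_fun_subset[OF assms(2)]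
        vf_smooth[OF assms(3)]) auto
qed

lemma coord_vec_vf:
  assumes c: "c \<in> M"
  shows "VF (fst c) (coord_vec M c i)"
  unfolding vector_field_def
proof (intro conjI ballI allI impI)
  show "coord_vec M c i p \<in> TM p" if "p \<in> fst c" for p
    by (rule coord_vec_tangent[OF c that])
  fix V f assume V: "open V \<and> V \<subseteq> fst c \<and> smooth_fun M V f"
  then have oV: "open V" and sub: "V \<subseteq> fst c" and f: "smooth_fun M V f" by auto
  have V': "snd c ` (fst c \<inter> V) = snd c ` V" using sub by (simp add: Int_absorb1)
  have near: "smooth_near M q f" if "q \<in> V" for q using smooth_fun_near[OF f oV that] .
  have "smooth_on (snd c ` V) (\<lambda>x. frechet_derivative (\<lambda>x. f (cinv c x)) (at x) (axis i 1))"
    using smooth_on_derivative[OF smooth_fun_chartD[OF f c]] V' by simp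
  then have "smooth_fun M V (\<lambda>q. frechet_derivative (\<lambda>x. f (cinv c x)) (at (snd c q)) (axis i 1))"
    by (rule smooth_fun_compose_chart[OF c oV sub])
  then show "smooth_fun M V (\<lambda>p. coord_vec M c i p f)"
    by (rule smooth_fun_cong[THEN iffD1, OF oV, rotated]) (simp add: coord_vec_eq near)
qed

lemma lie_bracket_eq:
  "smooth_near M p f \<Longrightarrow> lie_bracket M X Y p f = X p (\<lambda>q. Y q f) - Y p (\<lambda>q. X q f)"
  by (simp add: lie_bracket_def)

text \<open>The bracket is a commutator of derivations. Its axioms at \<open>p\<close> use those of
  \<open>X q\<close> and \<open>Y q\<close> at nearby points \<open>q\<close>, hence smoothness of
  the arguments near those points too (\<open>near\<close>).\<close>

lemma lie_bracket_tangent: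
  assumes W: "open W" "p \<in> W" and X: "VF W X" and Y: "VF W Y"
  shows "lie_bracket M X Y p \<in> TM p"
proof -
  let ?L = "lie_bracket M X Y p"
  note Xp = vf_tangent[OF X W(2)] and Yp = vf_tangent[OF Y W(2)]
  note sX = vf_smooth_near[OF X W] and sY = vf_smooth_near[OF Y W]
  have near: "\<forall>\<^sub>F q in nhds p. q \<in> W \<and> smooth_near M q f" if s: "smooth_near M p f" for f
  proof -
    obtain V where V: "open V" "p \<in> V" "smooth_fun M V f" using s by (rule smooth_nearE)
    have "\<forall>q\<in>V \<inter> W. q \<in> W \<and> smooth_near M q f" using smooth_fun_near[OF V(3,1)] by blast
    then show ?thesis unfolding eventually_nhds
      using W V(1,2) open_Int[OF V(1) W(1)] by (intro exI[of _ "V \<inter> W"]) blast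
  qed
  have zero: "?L f = 0" if "\<not> smooth_near M p f" for f
    using that by (simp add: lie_bracket_def)
  have cong: "?L f = ?L h"
    if s: "smooth_near M p f" "smooth_near M p h" and e: "\<forall>\<^sub>F q in nhds p. f q = h q" for f h
  proof -
    have *: "v (\<lambda>q. Z q f) = v (\<lambda>q. Z q h)"
      if v: "v \<in> TM p" and Z: "VF W Z" for v Z
    proof (rule tv_cong[OF v vf_smooth_near[OF Z W s(1)]])
      \<comment> \<open>Two functions with the same germ at \<open>p\<close> have the same germ at
        every nearby \<open>q\<close>.\<close>
      have "\<forall>\<^sub>F q in nhds p. \<forall>\<^sub>F r in nhds q. f r = h r" using e by (simp add: eventually_eventually)
      then show "\<forall>\<^sub>F q in nhds p. Z q f = Z q h"
        using near[OF s(1)]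
        by eventually_elim (rule tv_cong[OF vf_tangent[OF Z]], auto)
    qed
    show ?thesis using s *[OF Xp Y] *[OF Yp X] by (simp add: lie_bracket_eq)
  qed
  have lin: "?L (\<lambda>q. a * f q + b * h q) = a * ?L f + b * ?L h"
    if s: "smooth_near M p f" "smooth_near M p h" for f h a b
  proof -
    have *: "v (\<lambda>q. Z q (\<lambda>q. a * f q + b * h q)) = a * v (\<lambda>q. Z q f) + b * v (\<lambda>q. Z q h)"
      if v: "v \<in> TM p" and Z: "VF W Z" for v Z
    proof -
      have "v (\<lambda>q. a * Z q f + b * Z q h) = v (\<lambda>q. Z q (\<lambda>q. a * f q + b * h q))"
      proof (rule tv_cong[OF v])
        show "smooth_near M p (\<lambda>q. a * Z q f + b * Z q h)"
          by (intro smooth_near_add smooth_near_mult smooth_near_const vf_smooth_near[OF Z W] s)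
        show "\<forall>\<^sub>F q in nhds p. a * Z q f + b * Z q h = Z q (\<lambda>q. a * f q + b * h q)"
          using near[OF s(1)] near[OF s(2)]
          by eventually_elim (simp add: tv_lin[OF vf_tangent[OF Z]])
      qed
      then show ?thesis
        using tv_lin[OF v vf_smooth_near[OF Z W s(1)] vf_smooth_near[OF Z W s(2)]] by simp
    qed
    have "smooth_near M p (\<lambda>q. a * f q + b * h q)"
      by (intro smooth_near_add smooth_near_mult smooth_near_const s)
    then show ?thesis using s *[OF Xp Y] *[OF Yp X] by (simp add: lie_bracket_eq algebra_simps)
  qed
  have prod: "?L (\<lambda>q. f q * h q) = ?L f * h p + f p * ?L h"
    if s: "smooth_near M p f" "smooth_near M p h" for f h
  proof -
    \<comment> \<open>The two mixed terms are symmetric in \<open>v\<close> and \<open>Z p\<close>,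
      so they cancel in the commutator.\<close>
    have *: "v (\<lambda>q. Z q (\<lambda>q. f q * h q)) =
        v (\<lambda>q. Z q f) * h p + Z p f * v h + (v f * Z p h + f p * v (\<lambda>q. Z q h))"
      if v: "v \<in> TM p" and Z: "VF W Z" for v Z
    proof -
      have "v (\<lambda>q. Z q f * h q + f q * Z q h) = v (\<lambda>q. Z q (\<lambda>q. f q * h q))"
      proof (rule tv_cong[OF v])
        show "smooth_near M p (\<lambda>q. Z q f * h q + f q * Z q h)"
          by (intro smooth_near_add smooth_near_mult vf_smooth_near[OF Z W] s)
        show "\<forall>\<^sub>F q in nhds p. Z q f * h q + f q * Z q h = Z q (\<lambda>q. f q * h q)"
          using near[OF s(1)] near[OF s(2)]
          by eventually_elim (simp add: tv_mult[OF vf_tangent[OF Z]])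
      qed
      then show ?thesis
        using vf_smooth_near[OF Z W s(1)] vf_smooth_near[OF Z W s(2)] s
        by (simp add: tv_add[OF v] tv_mult[OF v] smooth_near_mult)
    qed
    show ?thesis using s smooth_near_mult[OF s] *[OF Xp Y] *[OF Yp X]
      by (simp add: lie_bracket_eq algebra_simps)
  qed
  show ?thesis
    unfolding tangent_space_def mem_Collect_eq
    by (intro conjI allI impI; (elim conjE)?; (rule zero lin prod cong; assumption))
qed

lemma lie_bracket_vf:
  assumes W: "open W" and X: "VF W X" and Y: "VF W Y"
  shows "VF W (lie_bracket M X Y)"
  unfolding vector_field_def
proof (intro conjI ballI allI impI)
  show "lie_bracket M X Y p \<in> TM p" if "p \<in> W" for p
    by (rule lie_bracket_tangent[OF W that X Y])
  fix V f assume V: "open V \<and> V \<subseteq> W \<and> smooth_fun M V f"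
  have "smooth_fun M V (\<lambda>p. X p (\<lambda>q. Y q f) - Y p (\<lambda>q. X q f))"
    using V by (intro smooth_fun_diff vf_smooth[OF X] vf_smooth[OF Y]) auto
  then show "smooth_fun M V (\<lambda>p. lie_bracket M X Y p f)"
    by (rule smooth_fun_cong[THEN iffD1, rotated -1])
      (use V in \<open>simp_all add: lie_bracket_eq smooth_fun_near[of V]\<close>)
qed

lemma vf_extension:
  assumes c: "c \<in> M" "p \<in> fst c" and v: "v \<in> TM p"
  obtains X where "VF (fst c) X" "X p = v"
proof -
  have 1: "VF (fst c) (\<lambda>q f. \<Sum>i\<in>UNIV. v (coord c i) * coord_vec M c i q f)"
    by (rule vf_sum[OF chart_open[OF c(1)] smooth_fun_const coord_vec_vf[OF c(1)]])
  have 2: "(\<lambda>f. \<Sum>i\<in>UNIV. v (coord c i) * coord_vec M c i p f) = v"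
    by (rule ext) (rule tv_expansion[OF c v, symmetric])
  show thesis by (rule that[OF 1]) (rule 2)
qed

end

locale metric_manifold = smooth_manifold M
  for M :: "('a::t2_space, 'm::finite) chart set" +
  fixes g :: "'a metric_field"
  assumes smooth_symmetric: "smooth_symmetric M g"
begin

abbreviation dual :: "'a vfield \<Rightarrow> 'a vfield \<Rightarrow> 'a vfield \<Rightarrow> 'a \<Rightarrow> real" where
  "dual \<equiv> dual_conn M g"

subsection \<open>Multilinearity of the metric\<close>

lemma g_sym: "u \<in> TM p \<Longrightarrow> v \<in> TM p \<Longrightarrow> g p u v = g p v u"
  using smooth_symmetric unfolding smooth_symmetric_def by blast

lemma g_lin_left:
  assumes "u \<in> TM p" "v \<in> TM p" "w \<in> TM p"
  shows "g p (\<lambda>f. a * u f + b * v f) w = a * g p u w + b * g p v w"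
proof -
  have "linear_form M p (\<lambda>x. g p x w)"
    using smooth_symmetric assms(3) unfolding smooth_symmetric_def smooth_tensor2_def by blast
  then show ?thesis using assms(1,2) unfolding linear_form_def by simp
qed

lemma g_lin_right:
  assumes "u \<in> TM p" "v \<in> TM p" "w \<in> TM p"
  shows "g p w (\<lambda>f. a * u f + b * v f) = a * g p w u + b * g p w v"
  using g_lin_left[OF assms] g_sym assms tv_combination[OF assms(1,2)] by simp

lemma g_zero_left: "w \<in> TM p \<Longrightarrow> g p (\<lambda>f. 0) w = 0"
  using g_lin_left[OF tv_zero tv_zero, of w p 0 0] by simp

lemma g_zero_right: "w \<in> TM p \<Longrightarrow> g p w (\<lambda>f. 0) = 0"
  using g_lin_right[OF tv_zero tv_zero, of w p 0 0] by simp

lemma g_sum_left: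
  fixes a :: "'i \<Rightarrow> real"
  assumes "finite I" "\<And>i. i \<in> I \<Longrightarrow> E i \<in> TM p" "w \<in> TM p"
  shows "g p (\<lambda>f. \<Sum>i\<in>I. a i * E i f) w = (\<Sum>i\<in>I. a i * g p (E i) w)"
  using assms(1,2)
proof (induction I rule: finite_induct)
  case empty
  then show ?case by (simp add: g_zero_left[OF assms(3)])
next
  case (insert x I)
  have "(\<lambda>f. \<Sum>i\<in>I. a i * E i f) \<in> TM p"
    by (rule tv_combination_sum) (use insert in auto)
  then have "g p (\<lambda>f. a x * E x f + 1 * (\<Sum>i\<in>I. a i * E i f)) w =
      a x * g p (E x) w + 1 * g p (\<lambda>f. \<Sum>i\<in>I. a i * E i f) w"
    by (rule g_lin_left[OF insert.prems[OF insertI1] _ assms(3)])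
  then show ?case using insert by simp
qed

lemma g_sum_right:
  fixes a :: "'i \<Rightarrow> real"
  assumes "finite I" "\<And>i. i \<in> I \<Longrightarrow> E i \<in> TM p" "w \<in> TM p"
  shows "g p w (\<lambda>f. \<Sum>i\<in>I. a i * E i f) = (\<Sum>i\<in>I. a i * g p w (E i))"
proof -
  have t: "(\<lambda>f. \<Sum>i\<in>I. a i * E i f) \<in> TM p"
    by (rule tv_combination_sum) (rule assms(2))
  have "g p w (\<lambda>f. \<Sum>i\<in>I. a i * E i f) = g p (\<lambda>f. \<Sum>i\<in>I. a i * E i f) w"
    by (rule g_sym[OF assms(3) t])
  also have "\<dots> = (\<Sum>i\<in>I. a i * g p (E i) w)"
    by (rule g_sum_left[OF assms(1) _ assms(3)]) (rule assms(2))
  also have "\<dots> = (\<Sum>i\<in>I. a i * g p w (E i))"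
    by (rule sum.cong[OF refl]) (simp add: g_sym[OF assms(2) assms(3)])
  finally show ?thesis .
qed

lemma g_smooth:
  assumes "open W" "VF W X" "VF W Y"
  shows "smooth_fun M W (\<lambda>p. g p (X p) (Y p))"
  using smooth_symmetric assms unfolding smooth_symmetric_def smooth_tensor2_def by blast

lemma g_smooth_near:
  assumes "open W" "p \<in> W" "VF W X" "VF W Y"
  shows "smooth_near M p (\<lambda>p. g p (X p) (Y p))"
  by (rule smooth_fun_near[OF g_smooth[OF assms(1,3,4)] assms(1,2)])

lemma tv_g_sym:
  assumes "v \<in> TM p" "open W" "p \<in> W" "VF W X" "VF W Y"
  shows "v (\<lambda>q. g q (X q) (Y q)) = v (\<lambda>q. g q (Y q) (X q))"
  by (rule tv_cong_open[OF assms(1) g_smooth_near[OF assms(2-5)] assms(2,3)])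
    (rule g_sym[OF vf_tangent[OF assms(4)] vf_tangent[OF assms(5)]])

lemma vf_const_combination:
  assumes "open W" "VF W X" "VF W Y"
  shows "VF W (\<lambda>p f. a * X p f + b * Y p f)"
  by (rule vf_combination[OF assms(1) smooth_fun_const smooth_fun_const assms(2,3)])

lemma vf_diff:
  assumes "open W" "VF W X" "VF W Y"
  shows "VF W (\<lambda>p f. X p f - Y p f)"
  using vf_const_combination[OF assms, of 1 "-1"] by simp

lemma lie_bracket_antisym: "lie_bracket M Y X p f = - lie_bracket M X Y p f"
  by (simp add: lie_bracket_def)

lemma lie_bracket_lin_right:
  assumes W: "open W" "p \<in> W" and X: "VF W X" and Y: "VF W Y"
    and Z: "VF W Z"
  shows "lie_bracket M X (\<lambda>q f. a * Y q f + b * Z q f) p =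
    (\<lambda>f. a * lie_bracket M X Y p f + b * lie_bracket M X Z p f)"
proof
  fix f
  show "lie_bracket M X (\<lambda>q f. a * Y q f + b * Z q f) p f =
    a * lie_bracket M X Y p f + b * lie_bracket M X Z p f"
  proof (cases "smooth_near M p f")
    case True
    have "X p (\<lambda>q. a * Y q f + b * Z q f) = a * X p (\<lambda>q. Y q f) + b * X p (\<lambda>q. Z q f)"
      by (rule tv_lin[OF vf_tangent[OF X W(2)] vf_smooth_near[OF Y W True] vf_smooth_near[OF Z W True]])
    then show ?thesis using True by (simp add: lie_bracket_eq algebra_simps)
  qed (simp add: lie_bracket_def)
qed

lemma lie_bracket_lin_left:
  assumes W: "open W" "p \<in> W" and X: "VF W X" and Y: "VF W Y"
    and Z: "VF W Z"
  shows "lie_bracket M (\<lambda>q f. a * Y q f + b * Z q f) X p =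
    (\<lambda>f. a * lie_bracket M Y X p f + b * lie_bracket M Z X p f)"
proof
  fix f
  have "lie_bracket M (\<lambda>q f. a * Y q f + b * Z q f) X p f =
    - lie_bracket M X (\<lambda>q f. a * Y q f + b * Z q f) p f"
    by (rule lie_bracket_antisym)
  also have "\<dots> = - (a * lie_bracket M X Y p f + b * lie_bracket M X Z p f)"
    by (simp only: lie_bracket_lin_right[OF assms])
  also have "\<dots> = a * lie_bracket M Y X p f + b * lie_bracket M Z X p f"
    by (simp add: lie_bracket_antisym[of X])
  finally show "lie_bracket M (\<lambda>q f. a * Y q f + b * Z q f) X p f =
    a * lie_bracket M Y X p f + b * lie_bracket M Z X p f" .
qed

lemma g_lie_bracket_antisym:
  assumes W: "open W" "p \<in> W" and X: "VF W X" and Y: "VF W Y"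
    and w: "w \<in> TM p"
  shows "g p (lie_bracket M Y X p) w = - g p (lie_bracket M X Y p) w"
proof -
  note t = lie_bracket_tangent[OF W X Y]
  have "lie_bracket M Y X p = (\<lambda>f. (- 1) * lie_bracket M X Y p f + 0 * lie_bracket M X Y p f)"
    by (rule ext) (simp add: lie_bracket_antisym[of Y X p])
  then show ?thesis by (simp only: g_lin_left[OF t t w])
qed

text \<open>Expand \<open>Z\<close> in coordinate vectors. Since its components vanish at
  \<open>p\<close>, only their \<open>X\<close>-derivatives survive, and these are the components of
  the bracket at \<open>p\<close>. The lemma controls how far the dual connection is from being a
  tensor.\<close>

lemma tv_g_zero:
  assumes W: "open W" "p \<in> W" and X: "VF W X" and Z: "VF W Z"
    and C: "VF W C" and Z0: "Z p = (\<lambda>f. 0)"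
  shows "X p (\<lambda>q. g q (Z q) (C q)) = g p (lie_bracket M X Z p) (C p)"
proof -
  obtain c where c: "c \<in> M" "p \<in> fst c" by (rule chart_cover)
  define V where "V = W \<inter> fst c"
  have V: "open V" "p \<in> V" using W c chart_open[OF c(1)] by (auto simp: V_def)
  have E: "VF V (coord_vec M c i)" for i
    by (rule vf_subset[OF coord_vec_vf[OF c(1)]]) (simp add: V_def)
  have CV: "VF V C" by (rule vf_subset[OF C]) (simp add: V_def)
  have sx: "smooth_near M p (coord c i)" for i
    by (rule smooth_fun_near[OF coord_smooth[OF c(1)] chart_open[OF c(1)] c(2)])
  note Xp = vf_tangent[OF X W(2)] and sZ = vf_smooth_near[OF Z W sx]
    and sg = g_smooth_near[OF V E CV]
  have "X p (\<lambda>q. g q (Z q) (C q)) =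
      X p (\<lambda>q. \<Sum>i\<in>UNIV. Z q (coord c i) * g q (coord_vec M c i q) (C q))"
  proof (rule tv_cong_open[OF Xp g_smooth_near[OF W Z C] V])
    fix q assume "q \<in> V"
    then have q: "q \<in> fst c" "q \<in> W" by (auto simp: V_def)
    have "Z q = (\<lambda>f. \<Sum>i\<in>UNIV. Z q (coord c i) * coord_vec M c i q f)"
      by (rule ext) (rule tv_expansion[OF c(1) q(1) vf_tangent[OF Z q(2)]])
    then have "g q (Z q) (C q) = g q (\<lambda>f. \<Sum>i\<in>UNIV. Z q (coord c i) * coord_vec M c i q f) (C q)"
      by (rule arg_cong)
    also have "\<dots> = (\<Sum>i\<in>UNIV. Z q (coord c i) * g q (coord_vec M c i q) (C q))"
      by (rule g_sum_left[OF finite coord_vec_tangent[OF c(1) q(1)] vf_tangent[OF C q(2)]])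
    finally show "g q (Z q) (C q) = (\<Sum>i\<in>UNIV. Z q (coord c i) * g q (coord_vec M c i q) (C q))" .
  qed
  also have "\<dots> = (\<Sum>i\<in>UNIV. X p (\<lambda>q. Z q (coord c i)) * g p (coord_vec M c i p) (C p))"
    by (simp add: tv_sum[OF Xp finite smooth_near_mult[OF sZ sg]] tv_mult[OF Xp sZ sg] Z0)
  also have "\<dots> = (\<Sum>i\<in>UNIV. lie_bracket M X Z p (coord c i) * g p (coord_vec M c i p) (C p))"
    by (simp add: lie_bracket_eq[OF sx] Z0)
  also have "\<dots> = g p (\<lambda>f. \<Sum>i\<in>UNIV. lie_bracket M X Z p (coord c i) * coord_vec M c i p f) (C p)"
    by (rule g_sum_left[OF finite coord_vec_tangent[OF c] vf_tangent[OF C W(2)], symmetric])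
  also have "(\<lambda>f. \<Sum>i\<in>UNIV. lie_bracket M X Z p (coord c i) * coord_vec M c i p f) = lie_bracket M X Z p"
    by (rule ext) (rule tv_expansion[OF c lie_bracket_tangent[OF W X Z], symmetric])
  finally show ?thesis .
qed

subsection \<open>The dual connection\<close>

lemma dual_smooth:
  assumes W: "open W" and vf: "VF W A" "VF W B" "VF W C"
  shows "smooth_fun M W (dual A B C)"
proof -
  have "smooth_fun M W (\<lambda>p. X p (\<lambda>q. g q (Y q) (Z q)))"
    if "VF W X" "VF W Y" "VF W Z" for X Y Z
    by (rule vf_smooth[OF that(1) W order_refl g_smooth[OF W that(2,3)]])
  note s = this
  have b: "smooth_fun M W (\<lambda>p. g p (lie_bracket M X Y p) (Z p))"
    if "VF W X" "VF W Y" "VF W Z" for X Y Z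
    by (rule g_smooth[OF W lie_bracket_vf[OF W that(1,2)] that(3)])
  have "smooth_fun M W (\<lambda>p. dual A B C p)"
    unfolding dual_conn_def
    by (rule smooth_fun_divide[OF W smooth_fun_add[OF W smooth_fun_diff[OF W smooth_fun_add[OF W
        smooth_fun_diff[OF W smooth_fun_add[OF W]]]]] smooth_fun_const])
      (auto intro: s b vf)
  then show ?thesis .
qed

text \<open>Metric compatibility and vanishing torsion in the form that makes sense at singular
  points too. Linearity and tensoriality of the second and third argument are derived from those of
  the first by these two identities.\<close>

lemma
  assumes W: "open W" "p \<in> W" and vf: "VF W A" "VF W B" "VF W C"
  shows dual_metric: "dual A B C p + dual A C B p = A p (\<lambda>q. g q (B q) (C q))"
    and dual_torsion: "dual A B C p - dual B A C p = g p (lie_bracket M A B p) (C p)"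
proof -
  note T = vf[THEN vf_tangent, OF W(2)]
  note sym = tv_g_sym[OF T(1) W vf(2,3)] tv_g_sym[OF T(2) W vf(1,3)] tv_g_sym[OF T(3) W vf(1,2)]
    g_lie_bracket_antisym[OF W vf(1,2) T(3)] g_lie_bracket_antisym[OF W vf(2,3) T(1)]
    g_lie_bracket_antisym[OF W vf(3,1) T(2)]
  show "dual A B C p + dual A C B p = A p (\<lambda>q. g q (B q) (C q))"
    "dual A B C p - dual B A C p = g p (lie_bracket M A B p) (C p)"
    unfolding dual_conn_def using sym by (simp_all add: field_simps)
qed

lemma dual_diag:
  assumes W: "open W" "p \<in> W" and vf: "VF W A" "VF W B"
  shows "2 * dual A B B p = A p (\<lambda>q. g q (B q) (B q))"
  using dual_metric[OF W vf vf(2)] by simp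

lemma dual_lin_1:
  assumes W: "open W" "p \<in> W" and A: "VF W A" "VF W A'"
    and B: "VF W B" and C: "VF W C"
  shows "dual (\<lambda>q f. a * A q f + b * A' q f) B C p =
    a * dual A B C p + b * dual A' B C p"
proof -
  let ?X = "\<lambda>q f. a * A q f + b * A' q f"
  note T = A[THEN vf_tangent, OF W(2)] B[THEN vf_tangent, OF W(2)] C[THEN vf_tangent, OF W(2)]
  have 1: "B p (\<lambda>q. g q (C q) (?X q)) = a * B p (\<lambda>q. g q (C q) (A q)) + b * B p (\<lambda>q. g q (C q) (A' q))"
  proof -
    have "B p (\<lambda>q. g q (C q) (?X q)) = B p (\<lambda>q. a * g q (C q) (A q) + b * g q (C q) (A' q))"
      by (rule tv_cong_open[OF T(3) g_smooth_near[OF W C vf_const_combination[OF W(1) A]] W])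
        (rule g_lin_right[OF A[THEN vf_tangent] C[THEN vf_tangent]])
    then show ?thesis by (simp only: tv_lin[OF T(3) g_smooth_near[OF W C A(1)] g_smooth_near[OF W C A(2)]])
  qed
  have 2: "C p (\<lambda>q. g q (?X q) (B q)) = a * C p (\<lambda>q. g q (A q) (B q)) + b * C p (\<lambda>q. g q (A' q) (B q))"
  proof -
    have "C p (\<lambda>q. g q (?X q) (B q)) = C p (\<lambda>q. a * g q (A q) (B q) + b * g q (A' q) (B q))"
      by (rule tv_cong_open[OF T(4) g_smooth_near[OF W vf_const_combination[OF W(1) A] B] W])
        (rule g_lin_left[OF A[THEN vf_tangent] B[THEN vf_tangent]])
    then show ?thesis by (simp only: tv_lin[OF T(4) g_smooth_near[OF W A(1) B] g_smooth_near[OF W A(2) B]])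
  qed
  have 3: "g p (lie_bracket M ?X B p) (C p) =
      a * g p (lie_bracket M A B p) (C p) + b * g p (lie_bracket M A' B p) (C p)"
    by (simp only: lie_bracket_lin_left[OF W B A]
        g_lin_left[OF lie_bracket_tangent[OF W A(1) B] lie_bracket_tangent[OF W A(2) B] T(4)])
  have 4: "g p (lie_bracket M C ?X p) (B p) =
      a * g p (lie_bracket M C A p) (B p) + b * g p (lie_bracket M C A' p) (B p)"
    by (simp only: lie_bracket_lin_right[OF W C A]
        g_lin_left[OF lie_bracket_tangent[OF W C A(1)] lie_bracket_tangent[OF W C A(2)] T(3)])
  have 5: "g p (lie_bracket M B C p) (?X p) =
      a * g p (lie_bracket M B C p) (A p) + b * g p (lie_bracket M B C p) (A' p)"
    by (rule g_lin_right[OF T(1,2) lie_bracket_tangent[OF W B C]])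
  show ?thesis
    unfolding dual_conn_def 1 2 3 4 5 by (simp add: field_simps)
qed

text \<open>\<open>dual_torsion\<close> moves the second argument into the first slot.\<close>

lemma dual_lin_2:
  assumes W: "open W" "p \<in> W" and A: "VF W A"
    and B: "VF W B" "VF W B'" and C: "VF W C"
  shows "dual A (\<lambda>q f. a * B q f + b * B' q f) C p =
    a * dual A B C p + b * dual A B' C p"
proof -
  let ?X = "\<lambda>q f. a * B q f + b * B' q f"
  have X: "VF W ?X" by (rule vf_const_combination[OF W(1) B])
  have "g p (lie_bracket M A ?X p) (C p) =
      a * g p (lie_bracket M A B p) (C p) + b * g p (lie_bracket M A B' p) (C p)"
    by (simp only: lie_bracket_lin_right[OF W A B]
        g_lin_left[OF lie_bracket_tangent[OF W A B(1)] lie_bracket_tangent[OF W A B(2)]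
          vf_tangent[OF C W(2)]])
  moreover have "dual A Z C p = dual Z A C p + g p (lie_bracket M A Z p) (C p)"
    if "VF W Z" for Z
    using dual_torsion[OF W A that C] by simp
  note e = this[OF X] this[OF B(1)] this[OF B(2)]
  ultimately show ?thesis
    by (simp only: e dual_lin_1[OF W B A C]) (simp add: algebra_simps)
qed

text \<open>\<open>dual_metric\<close> moves the third argument into the second slot.\<close>

lemma dual_lin_3:
  assumes W: "open W" "p \<in> W" and A: "VF W A"
    and B: "VF W B" and C: "VF W C" "VF W C'"
  shows "dual A B (\<lambda>q f. a * C q f + b * C' q f) p =
    a * dual A B C p + b * dual A B C' p"
proof -
  let ?X = "\<lambda>q f. a * C q f + b * C' q f"
  note Ap = vf_tangent[OF A W(2)]
  have X: "VF W ?X" by (rule vf_const_combination[OF W(1) C])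
  have "A p (\<lambda>q. g q (B q) (?X q)) = A p (\<lambda>q. a * g q (B q) (C q) + b * g q (B q) (C' q))"
    by (rule tv_cong_open[OF Ap g_smooth_near[OF W B X] W])
      (rule g_lin_right[OF C[THEN vf_tangent] B[THEN vf_tangent]])
  then have "A p (\<lambda>q. g q (B q) (?X q)) = a * A p (\<lambda>q. g q (B q) (C q)) + b * A p (\<lambda>q. g q (B q) (C' q))"
    by (simp only: tv_lin[OF Ap g_smooth_near[OF W B C(1)] g_smooth_near[OF W B C(2)]])
  moreover have "dual A B Z p = A p (\<lambda>q. g q (B q) (Z q)) - dual A Z B p"
    if "VF W Z" for Z
    using dual_metric[OF W A B that] by simp
  note e = this[OF X] this[OF C(1)] this[OF C(2)]
  ultimately show ?thesis
    by (simp only: e dual_lin_2[OF W A C B]) (simp add: algebra_simps)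
qed

text \<open>Together with linearity this is tensoriality in the first slot. The derivatives of
  \<open>g\<close> in the Koszul formula become brackets by \<open>tv_g_zero\<close> and cancel the
  bracket terms.\<close>

lemma dual_zero_1:
  assumes W: "open W" "p \<in> W" and Z: "VF W Z"
    and B: "VF W B" and C: "VF W C" and Z0: "Z p = (\<lambda>f. 0)"
  shows "dual Z B C p = 0"
  unfolding dual_conn_def
  using tv_g_zero[OF W B Z C Z0] tv_g_zero[OF W C Z B Z0]
    tv_g_sym[OF vf_tangent[OF B W(2)] W C Z] g_lie_bracket_antisym[OF W B Z vf_tangent[OF C W(2)]]
    g_zero_right[OF lie_bracket_tangent[OF W B C]]
  by (simp add: Z0)

text \<open>The second slot is the one that is not tensorial. The derivative left over here is what
  has to vanish for \<open>II\<close> and for \<open>sff\<close> to be well defined.\<close>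

lemma dual_zero_2:
  assumes W: "open W" "p \<in> W" and A: "VF W A"
    and Z: "VF W Z" and C: "VF W C" and Z0: "Z p = (\<lambda>f. 0)"
  shows "dual A Z C p = A p (\<lambda>q. g q (Z q) (C q))"
  using dual_torsion[OF W A Z C] dual_zero_1[OF W Z A C Z0] tv_g_zero[OF W A Z C Z0] by simp

lemma dual_zero_3:
  assumes W: "open W" "p \<in> W" and A: "VF W A"
    and B: "VF W B" and Z: "VF W Z" and Z0: "Z p = (\<lambda>f. 0)"
  shows "dual A B Z p = 0"
  using dual_metric[OF W A B Z] dual_zero_2[OF W A Z B Z0] tv_g_sym[OF vf_tangent[OF A W(2)] W B Z]
  by simp

lemma dual_cong_1:
  assumes W: "open W" "p \<in> W" and A: "VF W A" "VF W A'"
    and B: "VF W B" and C: "VF W C" and eq: "A p = A' p"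
  shows "dual A B C p = dual A' B C p"
  using dual_lin_1[OF W A B C, of 1 "-1"]
    dual_zero_1[OF W vf_const_combination[OF W(1) A, of 1 "-1"] B C] eq by simp

lemma dual_cong_2:
  assumes W: "open W" "p \<in> W" and A: "VF W A"
    and B: "VF W B" "VF W B'" and C: "VF W C"
    and eq: "B p = B' p"
  shows "dual A B C p - dual A B' C p =
    A p (\<lambda>q. g q (\<lambda>f. B q f - B' q f) (C q))"
  using dual_lin_2[OF W A B C, of 1 "-1"]
    dual_zero_2[OF W A vf_const_combination[OF W(1) B, of 1 "-1"] C] eq by simp

lemma dual_cong_3:
  assumes W: "open W" "p \<in> W" and A: "VF W A"
    and B: "VF W B" and C: "VF W C" "VF W C'"
    and eq: "C p = C' p"
  shows "dual A B C p = dual A B C' p"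
  using dual_lin_3[OF W A B C, of 1 "-1"]
    dual_zero_3[OF W A B vf_const_combination[OF W(1) C, of 1 "-1"]] eq by simp

lemma radicalD: "r \<in> radical M g p \<Longrightarrow> w \<in> TM p \<Longrightarrow> g p r w = 0"
  and radical_tangent: "r \<in> radical M g p \<Longrightarrow> r \<in> TM p"
  by (auto simp: radical_def)

lemma radicalD_right: "r \<in> radical M g p \<Longrightarrow> w \<in> TM p \<Longrightarrow> g p w r = 0"
  using radicalD[of r p w] g_sym[of r p w] radical_tangent[of r p] by simp

text \<open>The leftover derivative is a product of a bracket with \<open>C p\<close>, by
  \<open>tv_g_zero\<close>, and \<open>C p\<close> is radical. Hence \<open>II\<close> does not
  depend on the extensions.\<close>

lemma dual_cong_radical:
  assumes W: "open W" "p \<in> W" and A: "VF W A" "VF W A'"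
    and B: "VF W B" "VF W B'" and C: "VF W C" "VF W C'"
    and eq: "A p = A' p" "B p = B' p" "C p = C' p" and rad: "C p \<in> radical M g p"
  shows "dual A B C p = dual A' B' C' p"
proof -
  let ?Z = "\<lambda>q f. B q f - B' q f"
  have Z: "VF W ?Z" by (rule vf_diff[OF W(1) B])
  have "A p (\<lambda>q. g q (?Z q) (C q)) = g p (lie_bracket M A ?Z p) (C p)"
    by (rule tv_g_zero[OF W A(1) Z C(1)]) (simp add: eq)
  also have "\<dots> = 0" by (rule radicalD_right[OF rad lie_bracket_tangent[OF W A(1) Z]])
  finally have "dual A B C p = dual A B' C p"
    using dual_cong_2[OF W A(1) B C(1) eq(2)] by simp
  then show ?thesis
    using dual_cong_3[OF W A(1) B(2) C eq(3)] dual_cong_1[OF W A B(2) C(2) eq(1)] by simp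
qed

text \<open>Makes the definite description in \<open>II\<close> usable: any two triples of local
  extensions are compared on the intersection of their domains.\<close>

lemma II_eq:
  assumes W: "open W" "p \<in> W" and vf: "VF W A" "VF W B" "VF W C"
    and rad: "C p \<in> radical M g p"
  shows "II M g p (C p) (A p) (B p) = dual A B C p"
  unfolding II_def
proof (rule the_equality)
  show "\<forall>V A' B' C'. open V \<and> p \<in> V \<and> VF V A' \<and> VF V B' \<and>
     VF V C' \<and> A' p = A p \<and> B' p = B p \<and> C' p = C p \<longrightarrow>
     dual A' B' C' p = dual A B C p"
  proof (intro allI impI, elim conjE)
    fix V A' B' C'
    assume V: "open V" "p \<in> V" and vf': "VF V A'" "VF V B'" "VF V C'"
      and eq: "A' p = A p" "B' p = B p" "C' p = C p"
    have o: "open (W \<inter> V)" "p \<in> W \<inter> V" using W V by auto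
    note s = vf_subset[OF _ Int_lower1[of W V]] vf_subset[OF _ Int_lower2[of W V]]
    show "dual A' B' C' p = dual A B C p"
      by (rule dual_cong_radical[OF o s(2)[OF vf'(1)] s(1)[OF vf(1)] s(2)[OF vf'(2)]
            s(1)[OF vf(2)] s(2)[OF vf'(3)] s(1)[OF vf(3)] eq]) (simp add: eq rad)
  qed
next
  fix y assume "\<forall>V A' B' C'. open V \<and> p \<in> V \<and> VF V A' \<and> VF V B' \<and>
     VF V C' \<and> A' p = A p \<and> B' p = B p \<and> C' p = C p \<longrightarrow> dual A' B' C' p = y"
  then show "y = dual A B C p" using W vf by blast
qed

lemma tangent_subD:
  assumes "v \<in> tangent_sub M S p" "smooth_near M p f" "open W" "p \<in> W"
    "\<And>q. q \<in> W \<Longrightarrow> q \<in> S \<Longrightarrow> f q = 0"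
  shows "v f = 0"
proof -
  have "\<forall>\<^sub>F q in nhds p. q \<in> S \<longrightarrow> f q = 0"
    unfolding eventually_nhds using assms(3-5) by blast
  then show ?thesis using assms(1,2) unfolding tangent_sub_def by blast
qed

lemma tangent_sub_tangent: "v \<in> tangent_sub M S p \<Longrightarrow> v \<in> TM p"
  by (simp add: tangent_sub_def)

lemma tangent_sub_combination:
  assumes "u \<in> tangent_sub M S p" "v \<in> tangent_sub M S p"
  shows "(\<lambda>f. a * u f + b * v f) \<in> tangent_sub M S p"
  using assms tv_combination[of u p v a b] unfolding tangent_sub_def by simp

text \<open>The leftover derivative is taken along \<open>S\<close>, of the product of
  \<open>Y - Y'\<close> with \<open>C\<close>; that function vanishes on \<open>S\<close> since the
  first field is tangent and the second normal. This makes \<open>sff\<close> well defined.\<close>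

lemma dual_cong_tangent:
  assumes W: "open W" "p \<in> W" and X: "VF W X" "VF W X'"
    and Y: "VF W Y" "VF W Y'" and C: "VF W C" "VF W C'"
    and eq: "X p = X' p" "Y p = Y' p" "C p = C' p"
    and tan: "X p \<in> tangent_sub M S p"
      "\<And>q. q \<in> W \<inter> S \<Longrightarrow> Y q \<in> tangent_sub M S q \<and> Y' q \<in> tangent_sub M S q"
    and orth: "\<And>q v. q \<in> W \<inter> S \<Longrightarrow> v \<in> tangent_sub M S q \<Longrightarrow> g q (C q) v = 0"
  shows "dual X Y C p = dual X' Y' C' p"
proof -
  have Z: "VF W (\<lambda>q f. Y q f - Y' q f)" by (rule vf_diff[OF W(1) Y])
  have "X p (\<lambda>q. g q (\<lambda>f. Y q f - Y' q f) (C q)) = 0"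
  proof (rule tangent_subD[OF tan(1) g_smooth_near[OF W Z C(1)] W])
    fix q assume q: "q \<in> W" "q \<in> S"
    then have t: "Y q \<in> tangent_sub M S q" "Y' q \<in> tangent_sub M S q" using tan(2) by auto
    have t': "(\<lambda>f. Y q f - Y' q f) \<in> tangent_sub M S q"
      using tangent_sub_combination[OF t, of 1 "-1"] by simp
    have "g q (\<lambda>f. Y q f - Y' q f) (C q) = g q (C q) (\<lambda>f. Y q f - Y' q f)"
      by (rule g_sym[OF tangent_sub_tangent[OF t'] vf_tangent[OF C(1) q(1)]])
    also have "\<dots> = 0" using orth t' q by blast
    finally show "g q (\<lambda>f. Y q f - Y' q f) (C q) = 0" .
  qed
  then have "dual X Y C p = dual X Y' C p"
    using dual_cong_2[OF W X(1) Y C(1) eq(2)] by simp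
  then show ?thesis
    using dual_cong_3[OF W X(1) Y(2) C eq(3)] dual_cong_1[OF W X Y(2) C(2) eq(1)] by simp
qed

lemma sff_eq:
  assumes W: "open W" "p \<in> W" "p \<in> singular_set M g"
    and vf: "VF W X" "VF W Y" "VF W C"
    and tan: "\<And>q. q \<in> W \<inter> singular_set M g \<Longrightarrow> X q \<in> tangent_sub M (singular_set M g) q"
      "\<And>q. q \<in> W \<inter> singular_set M g \<Longrightarrow> Y q \<in> tangent_sub M (singular_set M g) q"
    and C: "\<And>q. q \<in> W \<inter> singular_set M g \<Longrightarrow> C q = N q"
    and orth: "\<And>q v. q \<in> W \<inter> singular_set M g \<Longrightarrow> v \<in> tangent_sub M (singular_set M g) q \<Longrightarrow>
      g q (N q) v = 0"
  shows "sff M g N p (X p) (Y p) = dual X Y C p"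
  unfolding sff_def
proof (rule the_equality)
  let ?S = "singular_set M g"
  show "\<forall>V X' Y' C'. open V \<and> p \<in> V \<and> VF V X' \<and> VF V Y' \<and>
     VF V C' \<and> (\<forall>q\<in>V \<inter> ?S. X' q \<in> tangent_sub M ?S q \<and> Y' q \<in> tangent_sub M ?S q \<and> C' q = N q) \<and>
     X' p = X p \<and> Y' p = Y p \<longrightarrow> dual X' Y' C' p = dual X Y C p"
  proof (intro allI impI, elim conjE)
    fix V X' Y' C'
    assume V: "open V" "p \<in> V" and vf': "VF V X'" "VF V Y'" "VF V C'"
      and t': "\<forall>q\<in>V \<inter> ?S. X' q \<in> tangent_sub M ?S q \<and> Y' q \<in> tangent_sub M ?S q \<and> C' q = N q"
      and eq: "X' p = X p" "Y' p = Y p"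
    have o: "open (W \<inter> V)" "p \<in> W \<inter> V" using W V by auto
    note s = vf_subset[OF _ Int_lower1[of W V]] vf_subset[OF _ Int_lower2[of W V]]
    show "dual X' Y' C' p = dual X Y C p"
    proof (rule dual_cong_tangent[OF o s(2)[OF vf'(1)] s(1)[OF vf(1)] s(2)[OF vf'(2)]
            s(1)[OF vf(2)] s(2)[OF vf'(3)] s(1)[OF vf(3)] eq, where S = ?S])
      show "C' p = C p" using t' C W V by auto
      show "X' p \<in> tangent_sub M ?S p" using t' V W by blast
      show "Y' q \<in> tangent_sub M ?S q \<and> Y q \<in> tangent_sub M ?S q" if "q \<in> W \<inter> V \<inter> ?S" for q
        using that t' tan(2) by blast
      show "g q (C' q) v = 0" if "q \<in> W \<inter> V \<inter> ?S" "v \<in> tangent_sub M ?S q" for q v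
        using that t' orth by auto
    qed
  qed
next
  let ?S = "singular_set M g"
  fix h assume "\<forall>V X' Y' C'. open V \<and> p \<in> V \<and> VF V X' \<and> VF V Y' \<and>
     VF V C' \<and> (\<forall>q\<in>V \<inter> ?S. X' q \<in> tangent_sub M ?S q \<and> Y' q \<in> tangent_sub M ?S q \<and> C' q = N q) \<and>
     X' p = X p \<and> Y' p = Y p \<longrightarrow> dual X' Y' C' p = h"
  then show "h = dual X Y C p" using W vf tan C by blast
qed

subsection \<open>The Levi-Civita connection\<close>

context
  fixes S :: "'a set" and D :: "'a vfield \<Rightarrow> 'a vfield \<Rightarrow> 'a vfield"
  assumes lc: "levi_civita M g S D"
begin

lemma lc_vf:
  assumes "open W" "W \<subseteq> S" "VF W X" "VF W Y"
  shows "VF W (D X Y)"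
  by (rule lc[unfolded levi_civita_def, THEN spec, THEN mp, OF conjI[OF assms(1,2)], THEN conjunct1,
        THEN spec, THEN spec, THEN mp, OF conjI[OF assms(3,4)], THEN conjunct1])

lemma lc_torsion:
  assumes "open W" "W \<subseteq> S" "VF W X" "VF W Y" "p \<in> W"
  shows "lie_bracket M X Y p = (\<lambda>f. D X Y p f - D Y X p f)"
  by (rule ext, rule lc[unfolded levi_civita_def, THEN spec, THEN mp, OF conjI[OF assms(1,2)],
        THEN conjunct1, THEN spec, THEN spec, THEN mp, OF conjI[OF assms(3,4)], THEN conjunct2,
        THEN bspec, OF assms(5), THEN spec, symmetric])

lemma lc_metric:
  assumes "open W" "W \<subseteq> S" "VF W X" "VF W Y" "VF W Z" "p \<in> W"
  shows "X p (\<lambda>q. g q (Y q) (Z q)) = g p (D X Y p) (Z p) + g p (Y p) (D X Z p)"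
  by (rule lc[unfolded levi_civita_def, THEN spec, THEN mp, OF conjI[OF assms(1,2)], THEN conjunct2,
        THEN conjunct1, THEN spec, THEN spec, THEN spec, THEN mp,
        OF conjI[OF assms(3) conjI[OF assms(4,5)]], THEN conjunct2, THEN bspec, OF assms(6)])

text \<open>The bridge from \<open>D\<close>, which exists off the singular set, to the dual
  connection, which is smooth across it.\<close>

lemma lc_koszul:
  assumes W: "open W" "W \<subseteq> S" "p \<in> W"
    and vf: "VF W X" "VF W Y" "VF W Z"
  shows "g p (D X Y p) (Z p) = dual X Y Z p"
proof -
  note T = vf[THEN vf_tangent, OF W(3)]
  have t: "D A B p \<in> TM p" if "VF W A" "VF W B" for A B
    by (rule vf_tangent[OF lc_vf[OF W(1,2) that] W(3)])
  have b: "g p (lie_bracket M A B p) w = g p (D A B p) w - g p (D B A p) w"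
    if "VF W A" "VF W B" "w \<in> TM p" for A B w
  proof -
    have "g p (\<lambda>f. 1 * D A B p f + (- 1) * D B A p f) w = 1 * g p (D A B p) w + (- 1) * g p (D B A p) w"
      by (rule g_lin_left[OF t[OF that(1,2)] t[OF that(2,1)] that(3)])
    then show ?thesis by (simp add: lc_torsion[OF W(1,2) that(1,2) W(3)])
  qed
  note m = lc_metric[OF W(1,2) _ _ _ W(3)]
  show ?thesis
    unfolding dual_conn_def m[OF vf] m[OF vf(2,3,1)] m[OF vf(3,1,2)]
      b[OF vf(1,2) T(3)] b[OF vf(2,3) T(1)] b[OF vf(3,1) T(2)]
    using g_sym[OF T(1) t[OF vf(2,3)]] g_sym[OF T(1) t[OF vf(3,2)]] g_sym[OF T(2) t[OF vf(1,3)]]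
      g_sym[OF T(2) t[OF vf(3,1)]] g_sym[OF T(3) t[OF vf(1,2)]] g_sym[OF T(3) t[OF vf(2,1)]]
    by (simp add: field_simps)
qed

lemma curvature_vf:
  assumes W: "open W" "W \<subseteq> S" and vf: "VF W A" "VF W B" "VF W C"
  shows "VF W (curvature M D A B C)"
proof -
  note l = lc_vf[OF W]
  have "VF W (\<lambda>p f. D A (D B C) p f - D B (D A C) p f - D (lie_bracket M A B) C p f)"
    by (intro vf_diff[OF W(1)] l vf lie_bracket_vf[OF W(1)])
  then show ?thesis unfolding curvature_def .
qed

text \<open>Metric compatibility moves the outer derivative of each second derivative onto
  \<open>B\<close>. All terms but the last two are then smooth across the singular set, and these
  two contain only first covariant derivatives.\<close>

lemma curvature_eq:
  assumes W: "open W" "W \<subseteq> S" "p \<in> W" and vf: "VF W A" "VF W B"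
  shows "g p (curvature M D A B A p) (B p) =
    A p (dual B A B) - B p (dual A A B) - dual (lie_bracket M A B) A B p
    + g p (D A A p) (D B B p) - g p (D B A p) (D A B p)"
proof -
  note l = lc_vf[OF W(1,2)]
  note br = lie_bracket_vf[OF W(1) vf]
  note T = vf[THEN vf_tangent, OF W(3)]
  have t: "X p \<in> TM p" if "VF W X" for X
    by (rule vf_tangent[OF that W(3)])
  have key: "g p (D X (D Y A) p) (B p) = X p (dual Y A B) - g p (D Y A p) (D X B p)"
    if X: "VF W X" and Y: "VF W Y" for X Y
  proof -
    have "X p (\<lambda>q. g q (D Y A q) (B q)) = X p (dual Y A B)"
      by (rule tv_cong_open[OF t[OF X] g_smooth_near[OF W(1,3) l[OF Y vf(1)] vf(2)] W(1,3)])
        (rule lc_koszul[OF W(1,2) _ Y vf])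
    then show ?thesis using lc_metric[OF W(1,2) X l[OF Y vf(1)] vf(2) W(3)] by simp
  qed
  let ?X = "D A (D B A)" and ?Y = "D B (D A A)" and ?Z = "D (lie_bracket M A B) A"
  have v: "VF W ?X" "VF W ?Y" "VF W ?Z"
    by (intro l vf br)+
  note vt = v[THEN t]
  have "curvature M D A B A p = (\<lambda>f. ?X p f - ?Y p f - ?Z p f)"
    by (simp add: curvature_def)
  then have "g p (curvature M D A B A p) (B p) = g p (?X p) (B p) - g p (?Y p) (B p) - g p (?Z p) (B p)"
    by (simp add: g_lin_left[OF tv_combination[OF vt(1,2), of 1 "-1", simplified] vt(3) T(2),
          of 1 "-1", simplified] g_lin_left[OF vt(1,2) T(2), of 1 "-1", simplified])
  then show ?thesis
    by (simp add: key[OF vf] key[OF vf(2,1)] lc_koszul[OF W br vf])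
qed

end

end

context metric_manifold
begin

subsection \<open>The metric in coordinates\<close>

text \<open>The product rule for each permutation term, regrouped by the row that is
  differentiated.\<close>

lemma tv_det:
  fixes A :: "'a \<Rightarrow> real ^ 'n ^ 'n"
  assumes v: "v \<in> TM p" and s: "\<And>i j. smooth_near M p (\<lambda>q. A q $ i $ j)"
  shows "v (\<lambda>q. det (A q)) =
    (\<Sum>i\<in>UNIV. det (\<chi> k l. if k = i then v (\<lambda>q. A q $ i $ l) else A p $ k $ l))"
proof -
  let ?P = "{\<sigma>. \<sigma> permutes (UNIV :: 'n set)}"
  have fP: "finite ?P" by (simp add: finite_permutations)
  have sp: "smooth_near M p (\<lambda>q. \<Prod>i\<in>UNIV. A q $ i $ \<sigma> i)" for \<sigma>
    by (rule smooth_near_prod) (rule s)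
  have prod: "v (\<lambda>q. A q $ i $ \<sigma> i) * (\<Prod>j\<in>UNIV - {i}. A p $ j $ \<sigma> j) =
      (\<Prod>j\<in>UNIV. (\<chi> k l. if k = i then v (\<lambda>q. A q $ i $ l) else A p $ k $ l) $ j $ \<sigma> j)" for i \<sigma>
    by (subst (2) prod.remove[of _ i]) (auto intro!: prod.cong)
  have "v (\<lambda>q. det (A q)) = (\<Sum>\<sigma>\<in>?P. v (\<lambda>q. of_int (sign \<sigma>) * (\<Prod>i\<in>UNIV. A q $ i $ \<sigma> i)))"
    unfolding det_def by (rule tv_sum[OF v fP smooth_near_mult[OF smooth_near_const sp]])
  also have "\<dots> = (\<Sum>\<sigma>\<in>?P. of_int (sign \<sigma>) *
      (\<Sum>i\<in>UNIV. v (\<lambda>q. A q $ i $ \<sigma> i) * (\<Prod>j\<in>UNIV - {i}. A p $ j $ \<sigma> j)))"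
    by (simp only: tv_cmult[OF v sp] tv_prod[OF v finite s])
  also have "\<dots> = (\<Sum>i\<in>UNIV. \<Sum>\<sigma>\<in>?P. of_int (sign \<sigma>) *
      (v (\<lambda>q. A q $ i $ \<sigma> i) * (\<Prod>j\<in>UNIV - {i}. A p $ j $ \<sigma> j)))"
    by (simp only: sum_distrib_left) (rule sum.swap)
  finally show ?thesis unfolding prod det_def .
qed

definition gmat :: "('a, 'm) chart \<Rightarrow> 'a \<Rightarrow> real ^ 'm ^ 'm" where
  "gmat = coord_metric M g"

definition gdet :: "('a, 'm) chart \<Rightarrow> 'a \<Rightarrow> real" where
  "gdet c p = det (gmat c p)"

definition coords :: "('a, 'm) chart \<Rightarrow> 'a tvec \<Rightarrow> real ^ 'm" where
  "coords c v = (\<chi> i. v (coord c i))"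

definition from_coords :: "('a, 'm) chart \<Rightarrow> 'a \<Rightarrow> real ^ 'm \<Rightarrow> 'a tvec" where
  "from_coords c p x = (\<lambda>f. \<Sum>i\<in>UNIV. x $ i * coord_vec M c i p f)"

lemma gmat_nth: "gmat c p $ i $ j = g p (coord_vec M c i p) (coord_vec M c j p)"
  by (simp add: gmat_def coord_metric_def)

lemma from_coords_tangent: "c \<in> M \<Longrightarrow> p \<in> fst c \<Longrightarrow> from_coords c p x \<in> TM p"
  unfolding from_coords_def by (rule tv_combination_sum) (rule coord_vec_tangent)

lemma coords_from_coords: "c \<in> M \<Longrightarrow> p \<in> fst c \<Longrightarrow> coords c (from_coords c p x) = x"
  by (simp add: coords_def from_coords_def coord_vec_coord vec_eq_iff if_distrib sum.delta' cong: if_cong)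

lemma from_coords_coords:
  assumes "c \<in> M" "p \<in> fst c" "v \<in> TM p" shows "from_coords c p (coords c v) = v"
  unfolding from_coords_def coords_def vec_lambda_beta
  by (rule ext) (rule tv_expansion[OF assms, symmetric])

lemma g_coord_vec:
  assumes c: "c \<in> M" "p \<in> fst c" and v: "v \<in> TM p"
  shows "g p (coord_vec M c i p) v = (gmat c p *v coords c v) $ i"
proof -
  have "g p (coord_vec M c i p) v = g p (coord_vec M c i p) (from_coords c p (coords c v))"
    by (simp only: from_coords_coords[OF c v])
  also have "\<dots> = (\<Sum>j\<in>UNIV. coords c v $ j * g p (coord_vec M c i p) (coord_vec M c j p))"
    unfolding from_coords_def
    by (rule g_sum_right[OF finite coord_vec_tangent[OF c] coord_vec_tangent[OF c]])
  finally show ?thesis by (simp add: matrix_vector_mult_def gmat_nth mult.commute)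
qed

lemma radical_iff_ker:
  assumes c: "c \<in> M" "p \<in> fst c" and v: "v \<in> TM p"
  shows "v \<in> radical M g p \<longleftrightarrow> gmat c p *v coords c v = 0"
proof
  assume r: "v \<in> radical M g p"
  show "gmat c p *v coords c v = 0"
    using radicalD_right[OF r coord_vec_tangent[OF c]] g_coord_vec[OF c v] by (simp add: vec_eq_iff)
next
  assume k: "gmat c p *v coords c v = 0"
  have "g p v w = 0" if w: "w \<in> TM p" for w
  proof -
    have "g p (from_coords c p (coords c w)) v = (\<Sum>i\<in>UNIV. coords c w $ i * g p (coord_vec M c i p) v)"
      unfolding from_coords_def by (rule g_sum_left[OF finite coord_vec_tangent[OF c] v])
    then show ?thesis using k
      by (simp add: g_coord_vec[OF c v] from_coords_coords[OF c w] g_sym[OF v w])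
  qed
  then show "v \<in> radical M g p" using v by (simp add: radical_def)
qed

lemma gmat_smooth:
  assumes "c \<in> M" "open W" "W \<subseteq> fst c"
  shows "smooth_fun M W (\<lambda>q. gmat c q $ i $ j)"
  unfolding gmat_nth
  by (rule g_smooth[OF assms(2)]) (rule vf_subset[OF coord_vec_vf[OF assms(1)] assms(3)])+

lemma gdet_smooth:
  assumes "c \<in> M" "open W" "W \<subseteq> fst c"
  shows "smooth_fun M W (gdet c)"
proof -
  have "smooth_fun M W (\<lambda>q. det (gmat c q))"
    by (rule smooth_fun_det[OF assms(2) gmat_smooth[OF assms]])
  then show ?thesis by (simp add: gdet_def[abs_def])
qed

text \<open>\<open>singular_set\<close> asks for some chart with a degenerate Gram matrix. A kernel
  vector of the matrix is the coordinate vector of a radical vector, and the radical does not depend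
  on the chart.\<close>

lemma singular_iff_gdet:
  assumes "c \<in> M" "p \<in> fst c" shows "p \<in> singular_set M g \<longleftrightarrow> gdet c p = 0"
proof -
  have *: "gdet c p = 0 \<longleftrightarrow> (\<exists>r\<in>radical M g p. r \<noteq> (\<lambda>f. 0))"
    "rank (coord_metric M g c p) < CARD('m) \<longleftrightarrow> gdet c p = 0"
    if c: "c \<in> M" "p \<in> fst c" for c
  proof -
    show 1: "rank (coord_metric M g c p) < CARD('m) \<longleftrightarrow> gdet c p = 0"
      unfolding gdet_def gmat_def by (rule det_eq_0_rank[symmetric])
    have "gdet c p = 0 \<longleftrightarrow> (\<exists>x. x \<noteq> 0 \<and> gmat c p *v x = 0)"
      unfolding matrix_nonfull_linear_equations_eq
      using 1 rank_bound[of "gmat c p"] by (auto simp: gmat_def)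
    also have "\<dots> \<longleftrightarrow> (\<exists>r\<in>radical M g p. r \<noteq> (\<lambda>f. 0))"
    proof
      assume "\<exists>x. x \<noteq> 0 \<and> gmat c p *v x = 0"
      then obtain x where x: "x \<noteq> 0" "gmat c p *v x = 0" by blast
      let ?r = "from_coords c p x"
      have "?r \<in> radical M g p"
        using radical_iff_ker[OF c from_coords_tangent[OF c]] x coords_from_coords[OF c] by simp
      moreover have "?r \<noteq> (\<lambda>f. 0)"
      proof
        assume "?r = (\<lambda>f. 0)"
        then have "coords c ?r = 0" by (simp add: coords_def vec_eq_iff)
        then show False using x coords_from_coords[OF c] by simp
      qed
      ultimately show "\<exists>r\<in>radical M g p. r \<noteq> (\<lambda>f. 0)" by blast
    next
      assume "\<exists>r\<in>radical M g p. r \<noteq> (\<lambda>f. 0)"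
      then obtain r where r: "r \<in> radical M g p" "r \<noteq> (\<lambda>f. 0)" by blast
      have "coords c r \<noteq> 0"
      proof
        assume "coords c r = 0"
        then have "from_coords c p (coords c r) = (\<lambda>f. 0)" by (simp add: from_coords_def)
        then show False using r(2) from_coords_coords[OF c radical_tangent[OF r(1)]] by simp
      qed
      then show "\<exists>x. x \<noteq> 0 \<and> gmat c p *v x = 0"
        using radical_iff_ker[OF c radical_tangent[OF r(1)]] r(1) by blast
    qed
    finally show "gdet c p = 0 \<longleftrightarrow> (\<exists>r\<in>radical M g p. r \<noteq> (\<lambda>f. 0))" .
  qed
  have "p \<in> singular_set M g \<longleftrightarrow> (\<exists>c\<in>M. p \<in> fst c \<and> gdet c p = 0)"
    unfolding singular_set_def using *(2) by blast
  then show ?thesis using *(1) assms by blast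
qed

lemma open_nonsingular: "open (- singular_set M g)"
proof (subst open_subopen, rule ballI)
  fix p assume p: "p \<in> - singular_set M g"
  obtain c where c: "c \<in> M" "p \<in> fst c" by (rule chart_cover)
  have o: "open (fst c)" by (rule chart_open[OF c(1)])
  have "continuous_on (fst c) (gdet c)"
    by (rule smooth_fun_continuous[OF gdet_smooth[OF c(1) o order_refl] o])
  then have "open (fst c \<inter> gdet c -` (- {0}))"
    by (rule continuous_open_preimage[OF _ o]) (simp add: open_Compl)
  moreover have "p \<in> fst c \<inter> gdet c -` (- {0})"
    using p c singular_iff_gdet[OF c] by simp
  moreover have "fst c \<inter> gdet c -` (- {0}) \<subseteq> - singular_set M g"
    using singular_iff_gdet[OF c(1)] by blast
  ultimately show "\<exists>T. open T \<and> p \<in> T \<and> T \<subseteq> - singular_set M g" by blast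
qed

lemma open_minus_singular: "open W \<Longrightarrow> open (W - singular_set M g)"
  using open_Int[OF _ open_nonsingular] by (simp add: Diff_eq)

end

section \<open>The singular hypersurface of a transverse metric\<close>

locale transverse_metric = metric_manifold M g
  for M :: "('a::t2_space, 'm::finite) chart set" and g +
  assumes transverse: "transverse_singular M g"
begin

abbreviation Sig :: "'a set" where "Sig \<equiv> singular_set M g"

abbreviation TSig :: "'a \<Rightarrow> 'a tvec set" where "TSig \<equiv> tangent_sub M Sig"

lemma gdet_derivative:
  assumes "c \<in> M" "p \<in> fst c" "p \<in> Sig"
  obtains v where "v \<in> TM p" "v (gdet c) \<noteq> 0"
proof -
  have "\<exists>v\<in>TM p. v (\<lambda>q. det (coord_metric M g c q)) \<noteq> 0"
    using transverse assms unfolding transverse_singular_def by blast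
  moreover have "(\<lambda>q. det (coord_metric M g c q)) = gdet c" by (simp add: gdet_def gmat_def fun_eq_iff)
  ultimately show ?thesis using that by auto
qed

text \<open>If the singular set contained a neighbourhood of \<open>p\<close>, \<open>gdet\<close>
  would vanish there and so would all its derivatives at \<open>p\<close>, against
  transversality.\<close>

lemma nonsingular_dense:
  assumes "open W" "p \<in> W" obtains q where "q \<in> W" "q \<notin> Sig"
proof (cases "p \<in> Sig")
  case True
  obtain c where c: "c \<in> M" "p \<in> fst c" by (rule chart_cover)
  obtain v where v: "v \<in> TM p" "v (gdet c) \<noteq> 0" by (rule gdet_derivative[OF c True])
  have o: "open (fst c)" by (rule chart_open[OF c(1)])
  have "\<not> (W \<inter> fst c \<subseteq> Sig)"
  proof
    assume sub: "W \<inter> fst c \<subseteq> Sig"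
    have "v (gdet c) = v (\<lambda>q. 0)"
    proof (rule tv_cong_open[OF v(1) smooth_fun_near[OF gdet_smooth[OF c(1) o order_refl] o c(2)]])
      show "open (W \<inter> fst c)" "p \<in> W \<inter> fst c" using assms o c by auto
      show "gdet c q = 0" if "q \<in> W \<inter> fst c" for q
        using singular_iff_gdet[of c q] c(1) that sub by blast
    qed
    then show False using v tv_const[OF v(1)] by simp
  qed
  then show ?thesis using that by blast
qed (use assms that in blast)

lemma density_eq:
  fixes f h :: "'a \<Rightarrow> real"
  assumes W: "open W" "p \<in> W" and c: "continuous_on W f" "continuous_on W h"
    and eq: "\<And>q. q \<in> W \<Longrightarrow> q \<notin> Sig \<Longrightarrow> f q = h q"
  shows "f p = h p"
proof (rule ccontr)
  assume ne: "f p \<noteq> h p"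
  have "continuous_on W (\<lambda>q. f q - h q)" by (intro continuous_on_diff c)
  then have o: "open (W \<inter> (\<lambda>q. f q - h q) -` (- {0}))"
    by (rule continuous_open_preimage[OF _ W(1)]) (simp add: open_Compl)
  have "p \<in> W \<inter> (\<lambda>q. f q - h q) -` (- {0})" using ne W by simp
  from nonsingular_dense[OF o this] obtain q where "q \<in> W \<inter> (\<lambda>q. f q - h q) -` (- {0})" "q \<notin> Sig" .
  then show False using eq[of q] by simp
qed

text \<open>The means of computing at singular points with objects built from
  \<open>D\<close>.\<close>

lemma density_eq_smooth:
  assumes W: "open W" "p \<in> W" and c: "smooth_fun M W f" "smooth_fun M W h"
    and eq: "\<And>q. q \<in> W \<Longrightarrow> q \<notin> Sig \<Longrightarrow> f q = h q"
  shows "f p = h p"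
  by (rule density_eq[OF W c[THEN smooth_fun_continuous, OF W(1)] eq])

text \<open>Hadamard division read in a chart, with \<open>gdet\<close> as the defining function of
  the hypersurface.\<close>

lemma hadamard_singular:
  assumes c: "c \<in> M" "p \<in> fst c" and W: "open W" "p \<in> W" and p: "p \<in> Sig"
    and f: "smooth_fun M W f" and f0: "\<And>q. q \<in> W \<Longrightarrow> q \<in> Sig \<Longrightarrow> f q = 0"
  obtains V h where "open V" "p \<in> V" "V \<subseteq> W" "V \<subseteq> fst c" "smooth_fun M V h"
    "\<And>q. q \<in> V \<Longrightarrow> f q = h q * gdet c q"
proof -
  define S where "S = snd c ` (fst c \<inter> W)"
  have oS: "open S" unfolding S_def by (rule chart_image_open[OF c(1) W(1)])
  have oc: "open (fst c)" by (rule chart_open[OF c(1)])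
  have oW: "open (fst c \<inter> W)" using oc W by blast
  have sd: "smooth_fun M (fst c \<inter> W) (gdet c)" by (rule gdet_smooth[OF c(1) oW]) simp
  have nd: "smooth_near M p (gdet c)" by (rule smooth_fun_near[OF sd oW]) (use c W in auto)
  have sd': "smooth_on S (\<lambda>x. gdet c (cinv c x))"
    using smooth_fun_chartD[OF sd c(1)] by (simp add: S_def)
  have sf: "smooth_on S (\<lambda>x. f (cinv c x))"
    using smooth_fun_chartD[OF f c(1)] by (simp add: S_def)
  obtain v where v: "v \<in> TM p" "v (gdet c) \<noteq> 0" by (rule gdet_derivative[OF c p])
  \<comment> \<open>By \<open>tv_expansion\<close> a derivation that is nonzero on
    \<open>gdet\<close> needs some nonzero partial derivative of it.\<close>
  obtain i where i: "coord_vec M c i p (gdet c) \<noteq> 0"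
  proof (rule ccontr)
    assume n: "\<not> thesis"
    have "coord_vec M c i p (gdet c) = 0" for i using n that by blast
    then have "v (gdet c) = 0" by (subst tv_expansion[OF c v(1)]) simp
    then show False using v by simp
  qed
  have fd: "frechet_derivative (\<lambda>x. gdet c (cinv c x)) (at (snd c p)) (axis i 1) \<noteq> 0"
    using i coord_vec_eq[OF nd] by simp
  have pS: "snd c p \<in> S" using c W by (auto simp: S_def)
  have p0: "gdet c (cinv c (snd c p)) = 0"
    using singular_iff_gdet[OF c] p cinv_chart[OF c] by simp
  have S0: "f (cinv c x) = 0" if x: "x \<in> S" "gdet c (cinv c x) = 0" for x
  proof -
    obtain q where q: "q \<in> fst c" "q \<in> W" "x = snd c q" using x by (auto simp: S_def)
    then have "cinv c x = q" using cinv_chart[OF c(1)] by simp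
    then show ?thesis using f0[OF q(2)] singular_iff_gdet[OF c(1) q(1)] x by simp
  qed
  obtain \<Omega> h where \<Omega>: "open \<Omega>" "snd c p \<in> \<Omega>" "\<Omega> \<subseteq> S" "smooth_on \<Omega> h"
    "\<And>x. x \<in> \<Omega> \<Longrightarrow> f (cinv c x) = h x * gdet c (cinv c x)"
    by (rule hadamard_division[OF oS sd' sf pS p0 fd S0]) (assumption, assumption, rule that)
  define V where "V = fst c \<inter> W \<inter> snd c -` \<Omega>"
  have "open (fst c \<inter> snd c -` \<Omega>)"
    by (rule continuous_open_preimage[OF chart_continuous[OF c(1)] oc \<Omega>(1)])
  moreover have "V = (fst c \<inter> snd c -` \<Omega>) \<inter> W" by (auto simp: V_def)
  ultimately have oV: "open V" using open_Int[OF _ W(1)] by simp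
  have subV: "V \<subseteq> fst c" "V \<subseteq> W" "p \<in> V" using c W \<Omega> by (auto simp: V_def)
  have sh: "smooth_fun M V (\<lambda>q. h (snd c q))"
    by (rule smooth_fun_compose_chart[OF c(1) oV subV(1) smooth_on_subset[OF \<Omega>(4)]])
      (auto simp: V_def)
  have "f q = h (snd c q) * gdet c q" if "q \<in> V" for q
    using \<Omega>(5)[of "snd c q"] that cinv_chart[OF c(1), of q] by (auto simp: V_def)
  then show ?thesis by (rule that[OF oV subV(3,2,1) sh])
qed

text \<open>A function vanishing on the hypersurface is \<open>h\<close> times \<open>gdet\<close>,
  so its derivative at \<open>p\<close> is \<open>h p\<close> times that of \<open>gdet\<close>. A
  single equation thus replaces the quantifier over all such functions.\<close>

lemma tangent_sub_iff:
  assumes c: "c \<in> M" "p \<in> fst c" and p: "p \<in> Sig"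
  shows "v \<in> TSig p \<longleftrightarrow> v \<in> TM p \<and> v (gdet c) = 0"
proof
  have oc: "open (fst c)" by (rule chart_open[OF c(1)])
  have nd: "smooth_near M p (gdet c)"
    by (rule smooth_fun_near[OF gdet_smooth[OF c(1) oc order_refl] oc c(2)])
  have d0: "gdet c p = 0" using singular_iff_gdet[OF c] p by simp
  {
    assume v: "v \<in> TSig p"
    have "v (gdet c) = 0"
      by (rule tangent_subD[OF v nd oc c(2)]) (use singular_iff_gdet[OF c(1)] in blast)
    then show "v \<in> TM p \<and> v (gdet c) = 0" using tangent_sub_tangent[OF v] by blast
  next
    assume v: "v \<in> TM p \<and> v (gdet c) = 0"
    have "v f = 0" if f: "smooth_near M p f" and ev: "\<forall>\<^sub>F q in nhds p. q \<in> Sig \<longrightarrow> f q = 0" for f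
    proof -
      obtain W where W: "open W" "p \<in> W" "smooth_fun M W f" using f by (rule smooth_nearE)
      obtain W' where W': "open W'" "p \<in> W'" "\<And>q. q \<in> W' \<Longrightarrow> q \<in> Sig \<Longrightarrow> f q = 0"
        using ev unfolding eventually_nhds by blast
      have i: "open (W \<inter> W')" "p \<in> W \<inter> W'" using W W' by auto
      have z: "f q = 0" if "q \<in> W \<inter> W'" "q \<in> Sig" for q using W'(3) that by blast
      obtain V h where V: "open V" "p \<in> V" "V \<subseteq> W \<inter> W'" "V \<subseteq> fst c" "smooth_fun M V h"
        "\<And>q. q \<in> V \<Longrightarrow> f q = h q * gdet c q"
        by (rule hadamard_singular[OF c i p smooth_fun_subset[OF W(3) Int_lower1] z])
          (assumption, assumption, rule that)
      have nh: "smooth_near M p h" by (rule smooth_fun_near[OF V(5,1,2)])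
      have "v f = v (\<lambda>q. h q * gdet c q)"
        by (rule tv_cong_open[OF _ f V(1,2,6)]) (use v in blast)
      also have "\<dots> = 0" using tv_mult[OF _ nh nd, of v] v d0 by simp
      finally show ?thesis .
    qed
    then show "v \<in> TSig p" using v unfolding tangent_sub_def by blast
  }
qed

text \<open>If the kernel of the Gram matrix were two-dimensional, it would meet the kernel of the
  derivative of any single row, so each term of the derivative of the determinant would vanish.\<close>

lemma radical_one_dimensional:
  assumes p: "p \<in> Sig" and r: "r \<in> radical M g p" "r \<noteq> (\<lambda>f. 0)" and w: "w \<in> radical M g p"
  obtains a where "w = (\<lambda>f. a * r f)"
proof -
  obtain c where c: "c \<in> M" "p \<in> fst c" by (rule chart_cover)
  have oc: "open (fst c)" by (rule chart_open[OF c(1)])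
  note rT = radical_tangent[OF r(1)] and wT = radical_tangent[OF w]
  define x y where "x = coords c r" and "y = coords c w"
  have kx: "gmat c p *v x = 0" and ky: "gmat c p *v y = 0"
    using radical_iff_ker[OF c rT] radical_iff_ker[OF c wT] r w by (auto simp: x_def y_def)
  have fx: "from_coords c p x = r" "from_coords c p y = w"
    using from_coords_coords[OF c rT] from_coords_coords[OF c wT] by (auto simp: x_def y_def)
  have x0: "x \<noteq> 0" using r(2) fx(1) by (auto simp: from_coords_def)
  have "\<exists>a. y = a *\<^sub>R x"
  proof (rule ccontr)
    assume n: "\<nexists>a. y = a *\<^sub>R x"
    obtain v where v: "v \<in> TM p" "v (gdet c) \<noteq> 0" by (rule gdet_derivative[OF c p])
    have "det (\<chi> k l. if k = i then v (\<lambda>q. gmat c q $ i $ l) else gmat c p $ k $ l) = 0" for i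
    proof -
      let ?d = "\<chi> l. v (\<lambda>q. gmat c q $ i $ l)"
      let ?A = "\<chi> k l. if k = i then v (\<lambda>q. gmat c q $ i $ l) else gmat c p $ k $ l"
      obtain a b where ab: "a * (?d \<bullet> x) + b * (?d \<bullet> y) = 0" "a \<noteq> 0 \<or> b \<noteq> 0"
      proof (cases "?d \<bullet> x = 0")
        case True
        then show ?thesis using that[of 1 0] by simp
      next
        case False
        then show ?thesis using that[of "- (?d \<bullet> y)" "?d \<bullet> x"] by simp
      qed
      define z where "z = a *\<^sub>R x + b *\<^sub>R y"
      have "z \<noteq> 0"
      proof
        assume z0: "z = 0"
        show False
        proof (cases "b = 0")
          case True
          then show ?thesis using z0 ab(2) x0 by (simp add: z_def)
        next
          case False
          have "y = (1 / b) *\<^sub>R (b *\<^sub>R y)" using False by simp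
          also have "b *\<^sub>R y = - (a *\<^sub>R x)" using z0 by (simp add: z_def eq_neg_iff_add_eq_0 add.commute)
          finally have "y = (- a / b) *\<^sub>R x" by simp
          then show ?thesis using n by blast
        qed
      qed
      moreover have "?A *v z = 0"
      proof -
        have kz: "gmat c p *v z = 0"
          by (simp add: z_def matrix_vector_right_distrib matrix_vector_mult_scaleR kx ky)
        have dz: "?d \<bullet> z = 0" using ab(1) by (simp add: z_def inner_add_right)
        have "(?A *v z) $ k = 0" for k
        proof (cases "k = i")
          case True
          then show ?thesis using dz by (simp add: matrix_vector_mult_def inner_vec_def)
        next
          case False
          have "(gmat c p *v z) $ k = 0" using kz by simp
          then show ?thesis using False by (simp add: matrix_vector_mult_def)
        qed
        then show ?thesis by (simp add: vec_eq_iff)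
      qed
      ultimately have "rank ?A \<noteq> CARD('m)"
        using matrix_nonfull_linear_equations_eq[of ?A] by blast
      then show ?thesis using det_eq_0_rank[of ?A] rank_bound[of ?A] by simp
    qed
    moreover have "v (gdet c) =
      (\<Sum>i\<in>UNIV. det (\<chi> k l. if k = i then v (\<lambda>q. gmat c q $ i $ l) else gmat c p $ k $ l))"
      unfolding gdet_def[abs_def]
      by (rule tv_det[OF v(1) smooth_fun_near[OF gmat_smooth[OF c(1) oc order_refl] oc c(2)]])
    ultimately show False using v(2) by simp
  qed
  then obtain a where "y = a *\<^sub>R x" by blast
  then have "w = (\<lambda>f. a * r f)"
    unfolding fx(1)[symmetric] fx(2)[symmetric]
    by (simp add: from_coords_def sum_distrib_left mult.assoc)
  then show ?thesis by (rule that)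
qed

end

section \<open>The main normal, the main radical field and their extensions\<close>

locale singular_setup = transverse_metric M g
  for M :: "('a::t2_space, 'm::finite) chart set" and g +
  fixes D :: "'a vfield \<Rightarrow> 'a vfield \<Rightarrow> 'a vfield"
    and U :: "'a set"
    and N R NN RR :: "'a vfield"
    and Ups :: "'a \<Rightarrow> 'a tvec \<Rightarrow> 'a tvec \<Rightarrow> 'a tvec \<Rightarrow> 'a tvec \<Rightarrow> real"
  assumes tangent_radical: "tangent_radical M g" and riemann_lorentz: "riemann_lorentz M g"
    and lc: "levi_civita M g (- Sig) D"
    and U_open: "open U"
    and main_normal: "main_normal M g U N" and main_radical: "main_radical M g U N R"
    and geodesic: "geodesic_extension M g D U N NN" and canonical: "canonical_extension M g U NN R RR"
    and Upsilon: "is_Upsilon M g D U RR Ups"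
begin

lemma NN_vf: "W \<subseteq> U \<Longrightarrow> VF W NN"
  and RR_vf: "W \<subseteq> U \<Longrightarrow> VF W RR"
  using geodesic canonical vf_subset unfolding geodesic_extension_def canonical_extension_def by blast+

lemma NN_eq: "p \<in> Sig \<Longrightarrow> p \<in> U \<Longrightarrow> NN p = N p"
  and RR_eq: "p \<in> Sig \<Longrightarrow> p \<in> U \<Longrightarrow> RR p = R p"
  using geodesic canonical unfolding geodesic_extension_def canonical_extension_def by blast+

lemma N_orth: "p \<in> Sig \<Longrightarrow> p \<in> U \<Longrightarrow> v \<in> TSig p \<Longrightarrow> g p (N p) v = 0"
  and N_unit: "p \<in> Sig \<Longrightarrow> p \<in> U \<Longrightarrow> g p (N p) (N p) = 1"
  and N_II: "p \<in> Sig \<Longrightarrow> p \<in> U \<Longrightarrow> r \<in> radical M g p \<Longrightarrow> II M g p r (N p) (N p) = 0"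
  using main_normal unfolding main_normal_def by blast+

lemma RR_rad: "p \<in> Sig \<Longrightarrow> p \<in> U \<Longrightarrow> RR p \<in> radical M g p"
  using main_radical RR_eq unfolding main_radical_def by simp

lemma RR_tan: "p \<in> Sig \<Longrightarrow> p \<in> U \<Longrightarrow> RR p \<in> TSig p"
  using RR_rad tangent_radical unfolding tangent_radical_def by blast

lemma sff_RR:
  assumes W: "open W" "p \<in> W" "W \<subseteq> U" and p: "p \<in> Sig" and Y: "VF W Y"
    and tan: "\<And>q. q \<in> W \<Longrightarrow> q \<in> Sig \<Longrightarrow> Y q \<in> TSig q"
  shows "sff M g N p (Y p) (R p) = dual Y RR NN p"
proof -
  have "sff M g N p (Y p) (RR p) = dual Y RR NN p"
  proof (rule sff_eq[OF W(1,2) p Y RR_vf[OF W(3)] NN_vf[OF W(3)]])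
    fix q assume "q \<in> W \<inter> Sig"
    then have q: "q \<in> W" "q \<in> Sig" "q \<in> U" using W(3) by auto
    show "Y q \<in> TSig q" by (rule tan[OF q(1,2)])
    show "RR q \<in> TSig q" by (rule RR_tan[OF q(2,3)])
    show "NN q = N q" by (rule NN_eq[OF q(2,3)])
    show "g q (N q) v = 0" if "v \<in> TSig q" for v by (rule N_orth[OF q(2,3) that])
  qed
  then show ?thesis using RR_eq[OF p] W by auto
qed

lemma dual_RR_RR_NN: assumes p: "p \<in> Sig" "p \<in> U" shows "dual RR RR NN p = -1"
proof -
  have "sff M g N p (RR p) (R p) = dual RR RR NN p"
    by (rule sff_RR[OF U_open p(2) order_refl p(1) RR_vf[OF order_refl]]) (rule RR_tan)
  then show ?thesis using main_radical p RR_eq[OF p] unfolding main_radical_def by simp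
qed

text \<open>By tensoriality in the first slot a zero vector would give H(R,R) = 0 instead of
  -1.\<close>

lemma RR_nonzero: assumes p: "p \<in> Sig" "p \<in> U" shows "RR p \<noteq> (\<lambda>f. 0)"
  using dual_zero_1[OF U_open p(2) RR_vf RR_vf NN_vf] dual_RR_RR_NN[OF p] by auto

subsection \<open>Values of the tensor II\<close>

context
  fixes W :: "'a set" and p :: 'a
  assumes W: "open W" "p \<in> W" "W \<subseteq> U" and p: "p \<in> Sig"
begin

lemma pU: "p \<in> U" using W by blast

lemmas NW = NN_vf[OF W(3)] and RW = RR_vf[OF W(3)]
lemmas Rp = RR_rad[OF p pU]

text \<open>The torsion term pairs a bracket with \<open>RR p\<close>, which is radical.\<close>

lemma dual_RR_sym:
  assumes "VF W A" "VF W B"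
  shows "dual A B RR p = dual B A RR p"
  using dual_torsion[OF W(1,2) assms RW] radicalD_right[OF Rp lie_bracket_tangent[OF W(1,2) assms]]
  by simp

lemma dual_NN_NN_RR: "dual NN NN RR p = 0"
  using II_eq[OF W(1,2) NW NW RW Rp] N_II[OF p pU Rp] NN_eq[OF p pU] by simp

text \<open>The product of \<open>NN\<close> and \<open>RR\<close> vanishes along the hypersurface,
  so it has zero derivative in tangent directions. This turns the normalization H(R,R) = -1 into
  II(N,R) = 1 and identifies the screen with the tangent vectors that are
  \<open>II\<close>-orthogonal to N.\<close>

lemma dual_tangent_NN_RR:
  assumes Y: "VF W Y" "Y p \<in> TSig p"
  shows "dual Y NN RR p = - dual Y RR NN p"
proof -
  have "Y p (\<lambda>q. g q (NN q) (RR q)) = 0"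
    by (rule tangent_subD[OF Y(2) g_smooth_near[OF W(1,2) NW RW] W(1,2)])
      (use W radicalD_right[OF RR_rad vf_tangent[OF NW]] in blast)
  then show ?thesis using dual_metric[OF W(1,2) Y(1) NW RW] by simp
qed

lemma dual_RR_NN_RR: "dual RR NN RR p = 1"
  using dual_tangent_NN_RR[OF RW RR_tan[OF p pU]] dual_RR_RR_NN[OF p pU] by simp

lemma dual_NN_RR_RR: "dual NN RR RR p = 1"
  using dual_RR_sym[OF NW RW] dual_RR_NN_RR by simp

text \<open>The square of \<open>RR\<close> is constantly 0 along the hypersurface.\<close>

lemma dual_tangent_RR_RR:
  assumes Y: "VF W Y" "Y p \<in> TSig p"
  shows "dual Y RR RR p = 0"
proof -
  have "Y p (\<lambda>q. g q (RR q) (RR q)) = 0"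
    by (rule tangent_subD[OF Y(2) g_smooth_near[OF W(1,2) RW RW] W(1,2)])
      (use W radicalD_right[OF RR_rad vf_tangent[OF RW]] in blast)
  then show ?thesis using dual_diag[OF W(1,2) Y(1) RW] by simp
qed

lemma NN_tau: "NN p (\<lambda>q. g q (RR q) (RR q)) = 2"
  using dual_diag[OF W(1,2) NW RW] dual_NN_RR_RR by simp

lemma dual_RR_decompose_left:
  assumes A: "VF W A" and S: "VF W S" and B: "VF W B"
    and eq: "A p = (\<lambda>f. n * NN p f + S p f + r * RR p f)"
  shows "dual A B RR p =
    n * dual NN B RR p + dual S B RR p + r * dual RR B RR p"
proof -
  \<comment> \<open>The first slot depends on the value at \<open>p\<close> only, so constant
    coefficients suffice. The factors 1 bring the field into the form of
    \<open>dual_lin_1\<close>.\<close>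
  let ?X = "\<lambda>q f. n * NN q f + 1 * S q f"
  let ?A = "\<lambda>q f. 1 * ?X q f + r * RR q f"
  have X: "VF W ?X" by (rule vf_const_combination[OF W(1) NW S])
  have A': "VF W ?A" by (rule vf_const_combination[OF W(1) X RW])
  have "dual A B RR p = dual ?A B RR p"
    by (rule dual_cong_1[OF W(1,2) A A' B RW]) (simp add: eq)
  then show ?thesis
    by (simp only: dual_lin_1[OF W(1,2) X RW B RW] dual_lin_1[OF W(1,2) NW S B RW]) simp
qed

text \<open>The first argument is decomposed directly; the second is brought into the first slot by
  \<open>dual_RR_sym\<close> for each of the three summands.\<close>

lemma dual_RR_decompose:
  assumes A: "VF W A" and S: "VF W S"
    and B: "VF W B" and S': "VF W S'"
    and eq: "A p = (\<lambda>f. n * NN p f + S p f + r * RR p f)"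
      "B p = (\<lambda>f. n' * NN p f + S' p f + r' * RR p f)"
    and tan: "S p \<in> TSig p" "S' p \<in> TSig p"
    and scr: "dual S RR NN p = 0" "dual S' RR NN p = 0"
  shows "dual A B RR p = n * r' + r * n' + dual S S' RR p"
proof -
  have 1: "dual S NN RR p = 0" "dual S' NN RR p = 0"
    using dual_tangent_NN_RR[OF S tan(1)] dual_tangent_NN_RR[OF S' tan(2)] scr by auto
  have 2: "dual S RR RR p = 0" "dual S' RR RR p = 0"
    using dual_tangent_RR_RR[OF S tan(1)] dual_tangent_RR_RR[OF S' tan(2)] by auto
  have 3: "dual RR RR RR p = 0" by (rule dual_tangent_RR_RR[OF RW RR_tan[OF p pU]])
  have "dual NN B RR p = r'"
    using dual_RR_decompose_left[OF B S' NW eq(2)] dual_RR_sym[OF NW B] 1 dual_NN_NN_RR dual_RR_NN_RR by simp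
  moreover have "dual RR B RR p = n'"
    using dual_RR_decompose_left[OF B S' RW eq(2)] dual_RR_sym[OF RW B] 2 3 dual_NN_RR_RR by simp
  moreover have "dual S B RR p = dual S S' RR p"
    using dual_RR_decompose_left[OF B S' S eq(2)] dual_RR_sym[OF S B] dual_RR_sym[OF NW S] dual_RR_sym[OF RW S] dual_RR_sym[OF S' S] 1 2
    by simp
  ultimately show ?thesis using dual_RR_decompose_left[OF A S B eq(1)] by simp
qed

end

section \<open>The function \<open>tau\<close> and the smooth extension of \<open>tau\<close> times
  the connection\<close>

definition tau :: "'a \<Rightarrow> real" where "tau q = g q (RR q) (RR q)"

lemma tau_smooth: assumes "open W" "W \<subseteq> U" shows "smooth_fun M W tau"
  using g_smooth[OF assms(1) RR_vf[OF assms(2)] RR_vf[OF assms(2)]] by (simp add: tau_def[abs_def])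

lemma tau_zero: assumes "q \<in> Sig" "q \<in> U" shows "tau q = 0"
  unfolding tau_def by (rule radicalD[OF RR_rad[OF assms] vf_tangent[OF RR_vf[OF order_refl] assms(2)]])

lemma NN_tau_eq_2: assumes "p \<in> Sig" "p \<in> U" shows "NN p tau = 2"
  using NN_tau[OF U_open assms(2) order_refl assms(1)] by (simp add: tau_def[abs_def])

lemma tau_factor:
  assumes p: "p \<in> Sig" "p \<in> U" and c: "c \<in> M" "p \<in> fst c"
  obtains V k where "open V" "p \<in> V" "V \<subseteq> U" "V \<subseteq> fst c" "smooth_fun M V k"
    "\<And>q. q \<in> V \<Longrightarrow> tau q = k q * gdet c q" "\<And>q. q \<in> V \<Longrightarrow> k q \<noteq> 0"
proof -
  obtain V k where V: "open V" "p \<in> V" "V \<subseteq> U" "V \<subseteq> fst c" "smooth_fun M V k"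
    "\<And>q. q \<in> V \<Longrightarrow> tau q = k q * gdet c q"
    by (rule hadamard_singular[OF c U_open p(2,1) tau_smooth[OF U_open order_refl] tau_zero])
      (assumption, assumption, rule that)
  have "k p \<noteq> 0"
  proof
    assume k0: "k p = 0"
    have oc: "open (fst c)" by (rule chart_open[OF c(1)])
    have nd: "smooth_near M p (gdet c)"
      by (rule smooth_fun_near[OF gdet_smooth[OF c(1) oc order_refl] oc c(2)])
    have nk: "smooth_near M p k" by (rule smooth_fun_near[OF V(5,1,2)])
    have nt: "smooth_near M p tau"
      by (rule smooth_fun_near[OF tau_smooth[OF U_open order_refl] U_open p(2)])
    have Np: "NN p \<in> TM p" by (rule vf_tangent[OF NN_vf[OF order_refl] p(2)])
    have d0: "gdet c p = 0" using singular_iff_gdet[OF c] p by simp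
    have "NN p tau = NN p (\<lambda>q. k q * gdet c q)"
      by (rule tv_cong_open[OF Np nt V(1,2,6)])
    also have "\<dots> = 0" using tv_mult[OF Np nk nd] k0 d0 by simp
    finally show False using NN_tau_eq_2[OF p] by simp
  qed
  define V' where "V' = V \<inter> k -` (- {0})"
  have oV': "open V'" unfolding V'_def
    by (rule continuous_open_preimage[OF smooth_fun_continuous[OF V(5,1)] V(1)]) (simp add: open_Compl)
  have sub: "V' \<subseteq> V" by (auto simp: V'_def)
  show ?thesis
  proof (rule that[OF oV'])
    show "p \<in> V'" using V(2) \<open>k p \<noteq> 0\<close> by (simp add: V'_def)
    show "V' \<subseteq> U" "V' \<subseteq> fst c" using sub V by auto
    show "smooth_fun M V' k" by (rule smooth_fun_subset[OF V(5) sub])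
    show "tau q = k q * gdet c q" if "q \<in> V'" for q using V(6) sub that by blast
    show "k q \<noteq> 0" if "q \<in> V'" for q using that by (simp add: V'_def)
  qed
qed

text \<open>Off the singular set, the components of \<open>D A C\<close> are given by Cramer's rule with denominator
  \<open>gdet c\<close>, so \<open>tau * D A C\<close> extends smoothly. At a singular point the extension is radical, and its
  coefficient is found by differentiating \<open>\<langle>X, RR\<rangle> = tau * \<langle>D A C, RR\<rangle>\<close> in the direction \<open>NN\<close>.\<close>

lemma tau_extension:
  assumes W: "open W" "p \<in> W" "W \<subseteq> U" and p: "p \<in> Sig"
    and A: "VF W A" and C: "VF W C"
  obtains V X where "open V" "p \<in> V" "V \<subseteq> W" "VF V X"
    "X p = (\<lambda>f. dual A C RR p * RR p f)"
    "\<And>q. q \<in> V \<Longrightarrow> q \<notin> Sig \<Longrightarrow> X q = (\<lambda>f. tau q * D A C q f)"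
proof -
  obtain c where c: "c \<in> M" "p \<in> fst c" by (rule chart_cover)
  have pU: "p \<in> U" using W by blast
  obtain V0 k where V0: "open V0" "p \<in> V0" "V0 \<subseteq> U" "V0 \<subseteq> fst c" "smooth_fun M V0 k"
    "\<And>q. q \<in> V0 \<Longrightarrow> tau q = k q * gdet c q" "\<And>q. q \<in> V0 \<Longrightarrow> k q \<noteq> 0"
    by (rule tau_factor[OF p pU c]) (rule that)
  define V where "V = V0 \<inter> W"
  have V: "open V" "p \<in> V" "V \<subseteq> W" "V \<subseteq> U" "V \<subseteq> fst c" "V \<subseteq> V0"
    using V0(1-4) W by (auto simp: V_def)
  note AV = vf_subset[OF A V(3)] and CV = vf_subset[OF C V(3)] and RV = RR_vf[OF V(4)]
    and NV = NN_vf[OF V(4)] and E = vf_subset[OF coord_vec_vf[OF c(1)] V(5)]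
  define al where "al q = (\<chi> i. dual A C (coord_vec M c i) q)" for q
  \<comment> \<open>The numerators of Cramer's rule for the components of \<open>D A C\<close>. By
    the Koszul formula the right-hand side \<open>al\<close> is smooth at singular points
    too.\<close>
  define dj where "dj j q = det (\<chi> a b. if b = j then al q $ a else gmat c q $ a $ b)" for j q
  have sdj: "smooth_fun M V (dj j)" for j
  proof -
    have "smooth_fun M V (\<lambda>q. (\<chi> a b. if b = j then al q $ a else gmat c q $ a $ b) $ a $ b)" for a b
      using dual_smooth[OF V(1) AV CV E[of a]] gmat_smooth[OF c(1) V(1,5), of a b]
      by (cases "b = j") (simp_all add: al_def)
    then have "smooth_fun M V (\<lambda>q. det (\<chi> a b. if b = j then al q $ a else gmat c q $ a $ b))"
      by (rule smooth_fun_det[OF V(1)])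
    then show ?thesis by (simp add: dj_def[abs_def])
  qed
  \<comment> \<open>Since \<open>tau = k * gdet\<close>, multiplying Cramer's quotient
    \<open>dj j / gdet\<close> by \<open>tau\<close> gives \<open>k * dj j\<close>.\<close>
  define X where "X q = (\<lambda>f. \<Sum>j\<in>UNIV. (k q * dj j q) * coord_vec M c j q f)" for q
  have X: "VF V X"
    unfolding X_def
    by (rule vf_sum[OF V(1) smooth_fun_mult[OF V(1) smooth_fun_subset[OF V0(5) V(6)] sdj] E])
  let ?O = "V - Sig"
  have O: "open ?O" "?O \<subseteq> - Sig" by (auto intro: open_minus_singular[OF V(1)])
  have sO: "VF ?O Z" if "VF V Z" for Z by (rule vf_subset[OF that]) auto
  have DV: "VF ?O (D A C)" by (rule lc_vf[OF lc O sO[OF AV] sO[OF CV]])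
  have Xoff: "X q = (\<lambda>f. tau q * D A C q f)" if q: "q \<in> V" "q \<notin> Sig" for q
  proof -
    have qO: "q \<in> ?O" and qc: "q \<in> fst c" and q0: "q \<in> V0" using q V by auto
    let ?u = "coords c (D A C q)"
    have DT: "D A C q \<in> TM q" by (rule vf_tangent[OF DV qO])
    have "gmat c q *v ?u = al q"
    proof -
      have "(gmat c q *v ?u) $ i = al q $ i" for i
      proof -
        have "(gmat c q *v ?u) $ i = g q (coord_vec M c i q) (D A C q)"
          by (rule g_coord_vec[OF c(1) qc DT, symmetric])
        also have "\<dots> = g q (D A C q) (coord_vec M c i q)"
          by (rule g_sym[OF coord_vec_tangent[OF c(1) qc] DT])
        also have "\<dots> = dual A C (coord_vec M c i) q"
          by (rule lc_koszul[OF lc O qO sO[OF AV] sO[OF CV] sO[OF E]])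
        finally show ?thesis by (simp add: al_def)
      qed
      then show ?thesis by (simp add: vec_eq_iff)
    qed
    then have al: "al q = gmat c q *v ?u" by simp
    have dj: "dj j q = ?u $ j * gdet c q" for j
      unfolding dj_def al gdet_def by (rule cramer_lemma)
    have "X q f = tau q * D A C q f" for f
    proof -
      have "X q f = (\<Sum>j\<in>UNIV. tau q * (?u $ j * coord_vec M c j q f))"
        unfolding X_def dj V0(6)[OF q0] by (simp add: algebra_simps)
      also have "\<dots> = tau q * from_coords c q ?u f"
        by (simp add: from_coords_def sum_distrib_left)
      finally show ?thesis by (simp only: from_coords_coords[OF c(1) qc DT])
    qed
    then show ?thesis by (rule ext)
  qed
  \<comment> \<open>Proved off the singular set and carried over by density. At \<open>p\<close> the
    factor \<open>tau\<close> is 0, so \<open>X p\<close> is radical.\<close>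
  have gX: "g q (X q) (Z q) = tau q * dual A C Z q"
    if Z: "VF V Z" and q: "q \<in> V" for Z q
  proof (rule density_eq_smooth[OF V(1) q g_smooth[OF V(1) X Z]
        smooth_fun_mult[OF V(1) tau_smooth[OF V(1,4)] dual_smooth[OF V(1) AV CV Z]]])
    fix q assume q: "q \<in> V" "q \<notin> Sig"
    then have qO: "q \<in> ?O" by blast
    note DT = vf_tangent[OF DV qO] and ZT = vf_tangent[OF Z q(1)]
    have "g q (X q) (Z q) = tau q * g q (D A C q) (Z q)"
      using g_lin_left[OF DT DT ZT, of "tau q" 0] by (simp add: Xoff[OF q])
    also have "g q (D A C q) (Z q) = dual A C Z q"
      by (rule lc_koszul[OF lc O qO sO[OF AV] sO[OF CV] sO[OF Z]])
    finally show "g q (X q) (Z q) = tau q * dual A C Z q" .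
  qed
  have Xrad: "X p \<in> radical M g p"
  proof -
    have "g p (X p) w = 0" if w: "w \<in> TM p" for w
    proof -
      obtain Z where Z: "VF (fst c) Z" "Z p = w" by (rule vf_extension[OF c w])
      show ?thesis using gX[OF vf_subset[OF Z(1) V(5)] V(2)] Z(2) tau_zero[OF p pU] by simp
    qed
    then show ?thesis using vf_tangent[OF X V(2)] by (simp add: radical_def)
  qed
  obtain a where a: "X p = (\<lambda>f. a * RR p f)"
    by (rule radical_one_dimensional[OF p RR_rad[OF p pU] RR_nonzero[OF p pU] Xrad])
  have "a = dual A C RR p"
  proof -
    note Np = vf_tangent[OF NV V(2)]
    \<comment> \<open>This field vanishes at \<open>p\<close>, so by \<open>tv_g_zero\<close> the
      \<open>NN\<close>-derivative of its product with \<open>RR\<close> is a pairing with a radical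
      vector, hence 0. That derivative is also 2 \<open>dual A C RR p\<close> - 2 \<open>a\<close>,
      since \<open>tau\<close> vanishes at \<open>p\<close> with \<open>NN\<close>-derivative
      2.\<close>
    let ?Z = "\<lambda>q f. 1 * X q f + (- a) * RR q f"
    have Z: "VF V ?Z" by (rule vf_const_combination[OF V(1) X RV])
    have ntau: "smooth_near M p tau"
      by (rule smooth_fun_near[OF tau_smooth[OF V(1,4)] V(1,2)])
    have sXR: "smooth_near M p (\<lambda>q. g q (X q) (RR q))" by (rule g_smooth_near[OF V(1,2) X RV])
    have sd: "smooth_near M p (dual A C RR)"
      by (rule smooth_fun_near[OF dual_smooth[OF V(1) AV CV RV] V(1,2)])
    have "NN p (\<lambda>q. g q (?Z q) (RR q)) = g p (lie_bracket M NN ?Z p) (RR p)"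
      by (rule tv_g_zero[OF V(1,2) NV Z RV]) (simp add: a)
    also have "\<dots> = 0"
      by (rule radicalD_right[OF RR_rad[OF p pU] lie_bracket_tangent[OF V(1,2) NV Z]])
    finally have 0: "NN p (\<lambda>q. g q (?Z q) (RR q)) = 0" .
    have "NN p (\<lambda>q. g q (?Z q) (RR q)) = NN p (\<lambda>q. 1 * g q (X q) (RR q) + (- a) * tau q)"
      unfolding tau_def
      by (rule tv_cong_open[OF Np g_smooth_near[OF V(1,2) Z RV] V(1,2)])
        (rule g_lin_left[OF vf_tangent[OF X] vf_tangent[OF RV] vf_tangent[OF RV]])
    also have "\<dots> = NN p (\<lambda>q. g q (X q) (RR q)) - a * 2"
      using tv_lin[OF Np sXR ntau, of 1 "- a"] NN_tau_eq_2[OF p pU] by simp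
    also have "NN p (\<lambda>q. g q (X q) (RR q)) = NN p (\<lambda>q. tau q * dual A C RR q)"
      by (rule tv_cong_open[OF Np sXR V(1,2) gX[OF RV]])
    also have "\<dots> = 2 * dual A C RR p"
      using tv_mult[OF Np ntau sd] NN_tau_eq_2[OF p pU] tau_zero[OF p pU] by simp
    finally show ?thesis using 0 by simp
  qed
  with a have Xp: "X p = (\<lambda>f. dual A C RR p * RR p f)" by simp
  show ?thesis by (rule that[OF V(1-3) X Xp Xoff])
qed

section \<open>The tensor \<Upsilon> at singular points\<close>

lemma Ups_smooth:
  assumes "open W" "W \<subseteq> U" "VF W A" "VF W B"
  shows "smooth_fun M W (\<lambda>q. Ups q (A q) (B q) (A q) (B q))"
  using Upsilon assms unfolding is_Upsilon_def smooth_tensor4_def by blast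

lemma Ups_off:
  assumes "open W" "W \<subseteq> U" "VF W A" "VF W B" "q \<in> W" "q \<notin> Sig"
  shows "Ups q (A q) (B q) (A q) (B q) = tau q * g q (curvature M D A B A q) (B q)"
proof -
  have o: "open (W - Sig)" "W - Sig \<subseteq> U - Sig" "q \<in> W - Sig"
    using open_minus_singular[OF assms(1)] assms by auto
  have v: "VF (W - Sig) A" "VF (W - Sig) B"
    using vf_subset[OF assms(3)] vf_subset[OF assms(4)] by auto
  show ?thesis
    using Upsilon o v unfolding is_Upsilon_def tau_def by blast
qed

text \<open>\<open>X1\<close> and \<open>X2\<close> extend \<open>tau\<close> times
  \<open>D A A\<close> and \<open>D B A\<close>. Pairing them with the remaining covariant
  derivative gives \<open>dual B B X1\<close> and \<open>dual A B X2\<close>, so that off the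
  singular set \<Upsilon> equals \<open>?F\<close>, an expression free of \<open>D\<close> and
  smooth everywhere.\<close>

lemma Ups_formula:
  assumes W: "open W" "p \<in> W" "W \<subseteq> U" and p: "p \<in> Sig"
    and A: "VF W A" and B: "VF W B"
  shows "Ups p (A p) (B p) (A p) (B p) =
    dual A A RR p * dual B B RR p - (dual A B RR p)\<^sup>2"
proof -
  have pU: "p \<in> U" using W by blast
  obtain V1 X1 where V1: "open V1" "p \<in> V1" "V1 \<subseteq> W" "VF V1 X1"
    "X1 p = (\<lambda>f. dual A A RR p * RR p f)"
    "\<And>q. q \<in> V1 \<Longrightarrow> q \<notin> Sig \<Longrightarrow> X1 q = (\<lambda>f. tau q * D A A q f)"
    by (rule tau_extension[OF W p A A]) (rule that)
  obtain V2 X2 where V2: "open V2" "p \<in> V2" "V2 \<subseteq> W" "VF V2 X2"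
    "X2 p = (\<lambda>f. dual B A RR p * RR p f)"
    "\<And>q. q \<in> V2 \<Longrightarrow> q \<notin> Sig \<Longrightarrow> X2 q = (\<lambda>f. tau q * D B A q f)"
    by (rule tau_extension[OF W p B A]) (rule that)
  define V where "V = V1 \<inter> V2"
  have V: "open V" "p \<in> V" "V \<subseteq> V1" "V \<subseteq> V2" "V \<subseteq> U" "V \<subseteq> W" using V1 V2 W by (auto simp: V_def)
  note AV = vf_subset[OF A V(6)] and BV = vf_subset[OF B V(6)] and RV = RR_vf[OF V(5)]
    and X1 = vf_subset[OF V1(4) V(3)] and X2 = vf_subset[OF V2(4) V(4)]
  note br = lie_bracket_vf[OF V(1) AV BV]
  let ?O = "V - Sig"
  have O: "open ?O" "?O \<subseteq> - Sig" by (auto intro: open_minus_singular[OF V(1)])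
  have sO: "VF ?O Z" if "VF V Z" for Z by (rule vf_subset[OF that]) auto
  let ?K = "\<lambda>q. A q (dual B A B) - B q (dual A A B)
    - dual (lie_bracket M A B) A B q"
  let ?F = "\<lambda>q. tau q * ?K q + dual B B X1 q - dual A B X2 q"
  have sF: "smooth_fun M V ?F"
    by (rule smooth_fun_diff[OF V(1) smooth_fun_add[OF V(1) smooth_fun_mult[OF V(1) tau_smooth[OF V(1,5)]
      smooth_fun_diff[OF V(1) smooth_fun_diff[OF V(1)
        vf_smooth[OF AV V(1) order_refl dual_smooth[OF V(1) BV AV BV]]
        vf_smooth[OF BV V(1) order_refl dual_smooth[OF V(1) AV AV BV]]]
        dual_smooth[OF V(1) br AV BV]]]
      dual_smooth[OF V(1) BV BV X1]] dual_smooth[OF V(1) AV BV X2]])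
  have "Ups p (A p) (B p) (A p) (B p) = ?F p"
  proof (rule density_eq_smooth[OF V(1,2) Ups_smooth[OF V(1,5) AV BV] sF])
    fix q assume q: "q \<in> V" "q \<notin> Sig"
    then have qO: "q \<in> ?O" by blast
    have qV: "q \<in> V1" "q \<in> V2" using q V by auto
    note l = lc_vf[OF lc O] and k = lc_koszul[OF lc O qO]
    have t: "D Y Z q \<in> TM q" if "VF V Y" "VF V Z" for Y Z
      by (rule vf_tangent[OF l[OF sO[OF that(1)] sO[OF that(2)]] qO])
    have e: "tau q * g q (D Y Z q) (D Y' Z' q) = dual Y' Z' X q"
      if vf: "VF V Y" "VF V Z" "VF V Y'" "VF V Z'"
        "VF V X" and X: "X q = (\<lambda>f. tau q * D Y Z q f)" for Y Z Y' Z' X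
    proof -
      have "tau q * g q (D Y Z q) (D Y' Z' q) = g q (X q) (D Y' Z' q)"
        using g_lin_left[OF t[OF vf(1,2)] t[OF vf(1,2)] t[OF vf(3,4)], of "tau q" 0] by (simp add: X)
      also have "\<dots> = g q (D Y' Z' q) (X q)"
        by (rule g_sym[OF vf_tangent[OF vf(5) q(1)] t[OF vf(3,4)]])
      also have "\<dots> = dual Y' Z' X q"
        by (rule k[OF sO[OF vf(3)] sO[OF vf(4)] sO[OF vf(5)]])
      finally show ?thesis .
    qed
    have "Ups q (A q) (B q) (A q) (B q) = tau q * g q (curvature M D A B A q) (B q)"
      by (rule Ups_off[OF V(1,5) AV BV q])
    also have "\<dots> = tau q * (?K q + g q (D A A q) (D B B q) - g q (D B A q) (D A B q))"
      by (simp only: curvature_eq[OF lc O qO sO[OF AV] sO[OF BV]])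
    also have "\<dots> = tau q * ?K q + tau q * g q (D A A q) (D B B q) - tau q * g q (D B A q) (D A B q)"
      by (simp only: distrib_left right_diff_distrib)
    also have "\<dots> = ?F q"
      by (simp only: e[OF AV AV BV BV X1 V1(6)[OF qV(1) q(2)]] e[OF BV AV AV BV X2 V2(6)[OF qV(2) q(2)]])
    finally show "Ups q (A q) (B q) (A q) (B q) = ?F q" .
  qed
  \<comment> \<open>The third slot depends on the value at \<open>p\<close> only, and there
    \<open>X1\<close> is a multiple of \<open>RR\<close>. The zero summand matches the form of
    \<open>dual_lin_3\<close>.\<close>
  also have "dual B B X1 p = dual A A RR p * dual B B RR p"
  proof -
    let ?Y = "\<lambda>q f. dual A A RR p * RR q f + 0 * RR q f"
    have "dual B B X1 p = dual B B ?Y p"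
      by (rule dual_cong_3[OF V(1,2) BV BV X1 vf_const_combination[OF V(1) RV RV]]) (simp add: V1(5))
    then show ?thesis by (simp add: dual_lin_3[OF V(1,2) BV BV RV RV, where b = 0, simplified])
  qed
  also have "dual A B X2 p = dual B A RR p * dual A B RR p"
  proof -
    let ?Y = "\<lambda>q f. dual B A RR p * RR q f + 0 * RR q f"
    have "dual A B X2 p = dual A B ?Y p"
      by (rule dual_cong_3[OF V(1,2) AV BV X2 vf_const_combination[OF V(1) RV RV]]) (simp add: V2(5))
    then show ?thesis by (simp add: dual_lin_3[OF V(1,2) AV BV RV RV, where b = 0, simplified])
  qed
  also have "dual B A RR p = dual A B RR p"
    by (rule dual_RR_sym[OF V(1,2,5) p BV AV])
  finally show ?thesis by (simp add: tau_zero[OF p pU] power2_eq_square)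
qed

end

section \<open>Screen decomposition and semidefiniteness on the hypersurface\<close>

context singular_setup
begin

lemma screen_iff:
  assumes W: "open W" "p \<in> W" "W \<subseteq> U" and p: "p \<in> Sig" and Y: "VF W Y"
    and tan: "\<And>q. q \<in> W \<Longrightarrow> q \<in> Sig \<Longrightarrow> Y q \<in> TSig q"
  shows "Y p \<in> screen M g N R p \<longleftrightarrow> dual Y RR NN p = 0"
  using tan[OF W(2) p] sff_RR[OF W p Y tan] by (simp add: screen_def)

text \<open>The screen part of a vector is wanted as a vector field on an open set, so that the dual
  connection can be applied to it; therefore the coefficients must be smooth off the hypersurface as
  well.\<close>

lemma screen_projection:
  assumes W: "open W" "p \<in> W" "W \<subseteq> U" and p: "p \<in> Sig" and A: "VF W A"
  obtains V Y where "open V" "p \<in> V" "V \<subseteq> W" "VF V Y"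
    "\<And>q. q \<in> V \<Longrightarrow> q \<in> Sig \<Longrightarrow> Y q \<in> screen M g N R q"
    "\<And>q. q \<in> V \<Longrightarrow> q \<in> Sig \<Longrightarrow>
      A q = (\<lambda>f. nu g N q (A q) * NN q f + Y q f + rho M g N R q (A q) * RR q f)"
proof -
  obtain c where c: "c \<in> M" "p \<in> fst c" by (rule chart_cover)
  have pU: "p \<in> U" using W by blast
  have oc: "open (fst c)" by (rule chart_open[OF c(1)])
  define W' where "W' = W \<inter> fst c"
  have W': "open W'" "p \<in> W'" "W' \<subseteq> W" "W' \<subseteq> U" "W' \<subseteq> fst c" using W c oc by (auto simp: W'_def)
  have sd: "smooth_fun M W' (gdet c)" by (rule gdet_smooth[OF c(1) W'(1,5)])
  have sN: "smooth_fun M W' (\<lambda>q. NN q (gdet c))"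
    by (rule vf_smooth[OF NN_vf[OF W'(4)] W'(1) order_refl sd])
  define V where "V = W' \<inter> (\<lambda>q. NN q (gdet c)) -` (- {0})"
  have oV: "open V" unfolding V_def
    by (rule continuous_open_preimage[OF smooth_fun_continuous[OF sN W'(1)] W'(1)]) (simp add: open_Compl)
  \<comment> \<open>\<open>NN p\<close> is transverse to the hypersurface: being orthogonal to all
    tangent vectors, a tangent \<open>N p\<close> would be null instead of a unit vector.\<close>
  have "NN p (gdet c) \<noteq> 0"
  proof
    assume "NN p (gdet c) = 0"
    then have "NN p \<in> TSig p"
      using tangent_sub_iff[OF c p] vf_tangent[OF NN_vf[OF order_refl] pU] by blast
    then show False using N_orth[OF p pU] N_unit[OF p pU] NN_eq[OF p pU] by force
  qed
  then have pV: "p \<in> V" using W' by (simp add: V_def)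
  have sub: "V \<subseteq> W'" "V \<subseteq> W" "V \<subseteq> U" "V \<subseteq> fst c" using W' by (auto simp: V_def)
  note AV = vf_subset[OF A sub(2)] and NV = NN_vf[OF sub(3)] and RV = RR_vf[OF sub(3)]
  have sdV: "smooth_fun M V (gdet c)" by (rule smooth_fun_subset[OF sd sub(1)])
  \<comment> \<open>With this coefficient \<open>T\<close> annihilates \<open>gdet\<close> and so is
    tangent by construction. Orthogonality to \<open>N\<close> then shows that at singular points
    the coefficient is \<open>- nu\<close>.\<close>
  define co where "co q = - (A q (gdet c) / NN q (gdet c))" for q
  have sco: "smooth_fun M V co" unfolding co_def
    by (rule smooth_fun_uminus[OF oV smooth_fun_divide[OF oV vf_smooth[OF AV oV order_refl sdV]
            vf_smooth[OF NV oV order_refl sdV]]]) (simp add: V_def)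
  define T where "T q = (\<lambda>f. 1 * A q f + co q * NN q f)" for q
  have T: "VF V T" unfolding T_def
    by (rule vf_combination[OF oV smooth_fun_const sco AV NV])
  have Ttan: "T q \<in> TSig q" if q: "q \<in> V" "q \<in> Sig" for q
  proof -
    have "T q (gdet c) = 0" using q by (simp add: T_def co_def V_def)
    then show ?thesis using tangent_sub_iff[OF c(1) _ q(2)] sub(4) q vf_tangent[OF T q(1)] by blast
  qed
  have co: "co q = - nu g N q (A q)" if q: "q \<in> V" "q \<in> Sig" for q
  proof -
    have qU: "q \<in> U" using q sub by blast
    note NT = vf_tangent[OF NV q(1)]
    have "g q (N q) (T q) = 0" by (rule N_orth[OF q(2) qU Ttan[OF q]])
    then have "g q (NN q) (T q) = 0" using NN_eq[OF q(2) qU] by simp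
    then have "g q (T q) (NN q) = 0"
      using g_sym[OF NT vf_tangent[OF T q(1)]] by simp
    then have "1 * g q (A q) (NN q) + co q * g q (NN q) (NN q) = 0"
      unfolding T_def using g_lin_left[OF vf_tangent[OF AV q(1)] NT NT, of 1 "co q"] by simp
    then show ?thesis using N_unit[OF q(2) qU] NN_eq[OF q(2) qU] by (simp add: nu_def)
  qed
  define r where "r q = dual T RR NN q" for q
  have sr: "smooth_fun M V r"
    using dual_smooth[OF oV T RV NV] by (simp add: r_def[abs_def])
  \<comment> \<open>Here \<open>r\<close> is H(T,R) at singular points. As H(R,R) = -1, adding
    \<open>r\<close> times \<open>RR\<close> gives H(Y,R) = 0, and it shows that \<open>r\<close> is
    \<open>- rho\<close>.\<close>
  define Y where "Y q = (\<lambda>f. 1 * T q f + r q * RR q f)" for q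
  have Y: "VF V Y" unfolding Y_def
    by (rule vf_combination[OF oV smooth_fun_const sr T RV])
  have Ytan: "Y q \<in> TSig q" if q: "q \<in> V" "q \<in> Sig" for q
    unfolding Y_def by (rule tangent_sub_combination[OF Ttan[OF q] RR_tan[OF q(2)]]) (use q sub in blast)
  have scr: "Y q \<in> screen M g N R q" if q: "q \<in> V" "q \<in> Sig" for q
  proof -
    have qU: "q \<in> U" using q sub by blast
    let ?Y = "\<lambda>s f. 1 * T s f + r q * RR s f"
    have "dual Y RR NN q = dual ?Y RR NN q"
      by (rule dual_cong_1[OF oV q(1) Y vf_const_combination[OF oV T RV] RV NV]) (simp add: Y_def)
    also have "\<dots> = 1 * r q + r q * (- 1)"
      by (simp only: dual_lin_1[OF oV q(1) T RV RV NV] dual_RR_RR_NN[OF q(2) qU] r_def)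
    finally show ?thesis using screen_iff[OF oV q(1) sub(3) q(2) Y Ytan] by simp
  qed
  have dec: "A q = (\<lambda>f. nu g N q (A q) * NN q f + Y q f + rho M g N R q (A q) * RR q f)"
    if q: "q \<in> V" "q \<in> Sig" for q
  proof -
    have qU: "q \<in> U" using q sub by blast
    have "(\<lambda>f. A q f - nu g N q (A q) * N q f) = T q"
      using co[OF q] NN_eq[OF q(2) qU] by (simp add: T_def)
    then have "rho M g N R q (A q) = - sff M g N q (T q) (R q)" by (simp add: rho_def)
    also have "\<dots> = - r q" using sff_RR[OF oV q(1) sub(3) q(2) T Ttan] by (simp add: r_def)
    finally have "rho M g N R q (A q) = - r q" .
    then show ?thesis using co[OF q] by (simp add: Y_def T_def fun_eq_iff)
  qed
  show ?thesis by (rule that[OF oV pV sub(2) Y scr dec])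
qed

text \<open>Orthonormality makes the map \<open>\<Phi>\<close> from coefficient vectors to
  coordinates injective, hence surjective by dimension. So every tangent vector is a combination of
  the \<open>e i\<close>, and its square is a sum of squares.\<close>

lemma g_nonneg_index_zero:
  assumes i: "has_index M g q 0" and w: "w \<in> TM q"
  shows "g q w w \<ge> 0"
proof -
  obtain e :: "'m \<Rightarrow> 'a tvec" and s where e: "\<forall>i. e i \<in> TM q \<and> s i \<in> {-1, 1}"
    "\<forall>i j. g q (e i) (e j) = (if i = j then s i else 0)" "card {i. s i = -1} = 0"
    using i unfolding has_index_def by blast
  have "{i. s i = -1} = {}" using e(3) by (simp only: card_0_eq[OF finite])
  then have s1: "s i = 1" for i using e(1) by blast
  have eT: "e i \<in> TM q" for i using e(1) by blast
  have ee: "g q (e i) (e j) = (if i = j then 1 else 0)" for i j using e(2) by (simp add: s1)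
  obtain c where c: "c \<in> M" "q \<in> fst c" by (rule chart_cover)
  define L where "L z = (\<lambda>f. \<Sum>i\<in>UNIV. z $ i * e i f)" for z :: "real ^ 'm"
  have LT: "L z \<in> TM q" for z
    unfolding L_def by (rule tv_combination_sum) (rule eT)
  have Le: "g q (L z) (e j) = z $ j" for z j
  proof -
    have "g q (L z) (e j) = (\<Sum>i\<in>UNIV. z $ i * g q (e i) (e j))"
      unfolding L_def by (rule g_sum_left[OF finite eT eT])
    then show ?thesis by (simp add: ee if_distrib sum.delta cong: if_cong)
  qed
  define \<Phi> where "\<Phi> z = coords c (L z)" for z
  have \<Phi>: "\<Phi> z $ k = (\<Sum>i\<in>UNIV. z $ i * e i (coord c k))" for z k
    by (simp add: \<Phi>_def coords_def L_def)
  have lin: "linear \<Phi>"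
  proof (rule linearI)
    show "\<Phi> (x + y) = \<Phi> x + \<Phi> y" for x y
      by (simp add: vec_eq_iff \<Phi> distrib_right sum.distrib)
    show "\<Phi> (a *\<^sub>R x) = a *\<^sub>R \<Phi> x" for a x
      by (simp add: vec_eq_iff \<Phi> sum_distrib_left mult.assoc)
  qed
  have "inj \<Phi>"
  proof -
    have "z = 0" if "\<Phi> z = 0" for z
    proof -
      have "L z = from_coords c q 0" using from_coords_coords[OF c LT, of z] that by (simp add: \<Phi>_def)
      then have "L z = (\<lambda>f. 0)" by (simp add: from_coords_def)
      then have "z $ j = 0" for j using Le[of z j] g_zero_left[OF eT] by simp
      then show ?thesis by (simp add: vec_eq_iff)
    qed
    then show ?thesis using linear_injective_0[OF lin] by blast
  qed
  then have "surj \<Phi>" by (rule linear_injective_imp_surjective[OF lin]) (rule refl)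
  then obtain z where "coords c w = \<Phi> z" by (rule surjE)
  then have cw: "coords c w = coords c (L z)" by (simp only: \<Phi>_def)
  have w: "w = L z"
    by (rule trans[OF from_coords_coords[OF c w, symmetric]], subst cw, rule from_coords_coords[OF c LT])
  have "g q (L z) (L z) = (\<Sum>i\<in>UNIV. z $ i * g q (L z) (e i))"
    unfolding L_def[of z] by (rule g_sum_right[OF finite eT LT[of z, unfolded L_def]])
  then have "g q w w = (\<Sum>i\<in>UNIV. z $ i * z $ i)" by (simp only: w Le)
  then show ?thesis by (simp add: sum_nonneg)
qed

text \<open>Points of index 0 accumulate at \<open>p\<close>, and a negative value would persist on
  a neighbourhood of \<open>p\<close>.\<close>

lemma g_nonneg:
  assumes p: "p \<in> Sig" and v: "v \<in> TM p"
  shows "g p v v \<ge> 0"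
proof (rule ccontr)
  assume n: "\<not> g p v v \<ge> 0"
  obtain c where c: "c \<in> M" "p \<in> fst c" by (rule chart_cover)
  have oc: "open (fst c)" by (rule chart_open[OF c(1)])
  obtain Y where Y: "VF (fst c) Y" "Y p = v" by (rule vf_extension[OF c v])
  let ?I = "{q. has_index M g q 0}"
  define Q where "Q = fst c \<inter> (\<lambda>q. g q (Y q) (Y q)) -` {..<0}"
  have oQ: "open Q" unfolding Q_def
    by (rule continuous_open_preimage[OF smooth_fun_continuous[OF g_smooth[OF oc Y(1) Y(1)] oc] oc]) simp
  have "p \<in> closure ?I" using riemann_lorentz p unfolding riemann_lorentz_def by blast
  moreover have "p \<in> Q" using n c Y(2) by (simp add: Q_def)
  ultimately obtain q where q: "q \<in> Q" "has_index M g q 0"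
    using open_Int_closure_eq_empty[OF oQ, of ?I] by blast
  then have "q \<in> fst c" "g q (Y q) (Y q) < 0" by (simp_all add: Q_def)
  with g_nonneg_index_zero[OF q(2) vf_tangent[OF Y(1)]] show False by simp
qed

text \<open>The usual argument for a semidefinite form: a null vector with a nonzero product would
  produce a vector of negative square.\<close>

lemma g_null_radical:
  assumes p: "p \<in> Sig" and v: "v \<in> TM p" and v0: "g p v v = 0"
  shows "v \<in> radical M g p"
proof -
  have "g p v w = 0" if w: "w \<in> TM p" for w
  proof (rule ccontr)
    assume n: "g p v w \<noteq> 0"
    \<comment> \<open>Chosen so that the square of t v + w, which is 2 t \<open>g p v w\<close> +
      \<open>g p w w\<close>, becomes -1.\<close>
    define t where "t = - (g p w w + 1) / (2 * g p v w)"
    let ?u = "\<lambda>f. t * v f + 1 * w f"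
    have uT: "?u \<in> TM p" by (rule tv_combination[OF v w])
    have "g p ?u ?u = t * g p v ?u + 1 * g p w ?u" by (rule g_lin_left[OF v w uT])
    also have "g p v ?u = t * g p v v + 1 * g p v w" by (rule g_lin_right[OF v w v])
    also have "g p w ?u = t * g p w v + 1 * g p w w" by (rule g_lin_right[OF v w w])
    also have "t * (t * g p v v + 1 * g p v w) + 1 * (t * g p w v + 1 * g p w w) =
        t * (t * 0 + g p v w) + (t * g p v w + g p w w)"
      by (simp add: v0 g_sym[OF w v])
    also have "\<dots> = 2 * (t * g p v w) + g p w w" by simp
    also have "t * g p v w = - (g p w w + 1) / 2" using n by (simp add: t_def)
    also have "2 * (- (g p w w + 1) / 2) + g p w w = -1" by (simp add: field_simps)
    finally show False using g_nonneg[OF p uT] by simp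
  qed
  then show ?thesis using v by (simp add: radical_def)
qed

text \<open>Covers the case in which \<open>Y\<close> and N + R span a degenerate plane. A null
  \<open>Y p\<close> is radical, hence a multiple of \<open>RR p\<close>, and II(R,Y) = 0 for
  tangent \<open>Y\<close>.\<close>

lemma screen_null:
  assumes W: "open W" "p \<in> W" "W \<subseteq> U" and p: "p \<in> Sig" and Y: "VF W Y"
    and tan: "Y p \<in> TSig p" and g0: "g p (Y p) (Y p) = 0"
  shows "dual Y Y RR p = 0"
proof -
  have pU: "p \<in> U" using W by blast
  note RW = RR_vf[OF W(3)]
  obtain a where a: "Y p = (\<lambda>f. a * RR p f)"
    by (rule radical_one_dimensional[OF p RR_rad[OF p pU] RR_nonzero[OF p pU]
          g_null_radical[OF p vf_tangent[OF Y W(2)] g0]])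
  let ?X = "\<lambda>q f. a * RR q f + 0 * RR q f"
  have "dual Y Y RR p = dual ?X Y RR p"
    by (rule dual_cong_1[OF W(1,2) Y vf_const_combination[OF W(1) RW RW] Y RW]) (simp add: a)
  also have "\<dots> = a * dual RR Y RR p"
    by (simp add: dual_lin_1[OF W(1,2) RW RW Y RW, where b = 0, simplified])
  also have "dual RR Y RR p = dual Y RR RR p" by (rule dual_RR_sym[OF W p RW Y])
  also have "\<dots> = 0" by (rule dual_tangent_RR_RR[OF W p Y tan])
  finally show ?thesis by simp
qed

subsection \<open>Extendibility of the sectional curvature\<close>

lemma det_gram: "det (gram g A B q) = g q (A q) (A q) * g q (B q) (B q) - g q (A q) (B q) * g q (B q) (A q)"
  by (simp add: det_2 gram_def)

lemma det_gram_smooth: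
  assumes "open W" "VF W A" "VF W B"
  shows "smooth_fun M W (\<lambda>q. det (gram g A B q))"
  unfolding det_gram
  by (rule smooth_fun_diff[OF assms(1) smooth_fun_mult[OF assms(1)] smooth_fun_mult[OF assms(1)]])
    (rule g_smooth[OF assms(1)]; rule assms)+

lemma rank_gram: "rank (gram g A B q) = 2 \<longleftrightarrow> det (gram g A B q) \<noteq> 0"
  using det_eq_0_rank[of "gram g A B q"] rank_bound[of "gram g A B q"] by auto

lemma nondegenerate_pairD:
  assumes "nondegenerate_pair M g U W A B"
  shows "open W" "\<And>p. p \<in> Sig \<Longrightarrow> p \<in> W \<Longrightarrow> p \<in> U" "VF W A" "VF W B"
    "\<And>p. p \<in> W \<Longrightarrow> det (gram g A B p) \<noteq> 0"
  using assms unfolding nondegenerate_pair_def rank_gram by blast+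

text \<open>Extensions around different singular points agree on overlaps, because they agree with
  \<open>F\<close> on the dense nonsingular part; so they glue.\<close>

lemma smoothly_extendible_localI:
  assumes W: "open W" and F: "smooth_fun M (W - Sig) F"
    and ex: "\<And>p. p \<in> Sig \<Longrightarrow> p \<in> W \<Longrightarrow>
      \<exists>V h. open V \<and> p \<in> V \<and> V \<subseteq> W \<and> smooth_fun M V h \<and> (\<forall>q\<in>V - Sig. h q = F q)"
  shows "smoothly_extendible M W Sig F"
proof -
  have "\<forall>p. \<exists>Vh. p \<in> Sig \<longrightarrow> p \<in> W \<longrightarrow> open (fst Vh) \<and> p \<in> fst Vh \<and> fst Vh \<subseteq> W \<and>
      smooth_fun M (fst Vh) (snd Vh) \<and> (\<forall>q\<in>fst Vh - Sig. snd Vh q = F q)"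
  proof
    fix p
    show "\<exists>Vh. p \<in> Sig \<longrightarrow> p \<in> W \<longrightarrow> open (fst Vh) \<and> p \<in> fst Vh \<and> fst Vh \<subseteq> W \<and>
      smooth_fun M (fst Vh) (snd Vh) \<and> (\<forall>q\<in>fst Vh - Sig. snd Vh q = F q)"
    proof (cases "p \<in> Sig \<and> p \<in> W")
      case True
      then obtain V h where "open V \<and> p \<in> V \<and> V \<subseteq> W \<and> smooth_fun M V h \<and> (\<forall>q\<in>V - Sig. h q = F q)"
        using ex by blast
      then show ?thesis by (intro exI[of _ "(V, h)"]) simp
    qed blast
  qed
  then obtain \<phi> where \<phi>: "\<forall>p. p \<in> Sig \<longrightarrow> p \<in> W \<longrightarrow> open (fst (\<phi> p)) \<and> p \<in> fst (\<phi> p) \<and>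
      fst (\<phi> p) \<subseteq> W \<and> smooth_fun M (fst (\<phi> p)) (snd (\<phi> p)) \<and>
      (\<forall>q\<in>fst (\<phi> p) - Sig. snd (\<phi> p) q = F q)"
    by (rule choice[THEN exE])
  define V where "V p = fst (\<phi> p)" for p
  define h where "h p = snd (\<phi> p)" for p
  have V: "open (V p)" "p \<in> V p" "V p \<subseteq> W" "smooth_fun M (V p) (h p)"
    "\<And>q. q \<in> V p \<Longrightarrow> q \<notin> Sig \<Longrightarrow> h p q = F q" if "p \<in> Sig" "p \<in> W" for p
    using \<phi>[THEN spec, THEN mp, THEN mp, OF that] by (auto simp: V_def h_def)
  \<comment> \<open>At each singular point the extension chosen for that very point is evaluated;
    \<open>eq\<close> shows that any other one gives the same value.\<close>
  define F' where "F' q = (if q \<in> Sig then h q q else F q)" for q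
  have eq: "F' q = h p q" if p: "p \<in> Sig" "p \<in> W" and q: "q \<in> V p" for p q
  proof (cases "q \<in> Sig")
    case True
    have qW: "q \<in> W" using V(3)[OF p] q by blast
    have "h q q = h p q"
    proof (rule density_eq_smooth[of "V p \<inter> V q" q "h q" "h p"])
      show "open (V p \<inter> V q)" "q \<in> V p \<inter> V q" using V(1)[OF p] V(1,2)[OF True qW] q by auto
      show "smooth_fun M (V p \<inter> V q) (h q)" by (rule smooth_fun_subset[OF V(4)[OF True qW]]) simp
      show "smooth_fun M (V p \<inter> V q) (h p)" by (rule smooth_fun_subset[OF V(4)[OF p]]) simp
      show "h q x = h p x" if "x \<in> V p \<inter> V q" "x \<notin> Sig" for x
        using V(5)[OF p] V(5)[OF True qW] that by auto
    qed
    then show ?thesis using True by (simp add: F'_def)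
  next
    case False
    then show ?thesis using V(5)[OF p q] by (simp add: F'_def)
  qed
  have "smooth_fun M W F'"
  proof (rule smooth_fun_local)
    fix p assume pW: "p \<in> W"
    show "smooth_near M p F'"
    proof (cases "p \<in> Sig")
      case True
      have "smooth_fun M (V p) F'"
        by (rule smooth_fun_cong[THEN iffD1, OF V(1)[OF True pW] _ V(4)[OF True pW]])
          (rule eq[OF True pW, symmetric])
      then show ?thesis by (rule smooth_fun_near[OF _ V(1,2)[OF True pW]])
    next
      case False
      have o: "open (W - Sig)" "p \<in> W - Sig" using open_minus_singular[OF W] pW False by auto
      have "smooth_fun M (W - Sig) F'"
        by (rule smooth_fun_cong[THEN iffD1, OF o(1) _ F]) (simp add: F'_def)
      then show ?thesis by (rule smooth_fun_near[OF _ o])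
    qed
  qed
  moreover have "\<forall>p\<in>W - Sig. F' p = F p" by (simp add: F'_def)
  ultimately show ?thesis unfolding smoothly_extendible_def by blast
qed

lemma sectional_extendible_iff:
  assumes nd: "nondegenerate_pair M g U W A B"
  shows "smoothly_extendible M W Sig (sectional M g D A B) \<longleftrightarrow> Upsilon_vanishes M g Ups W A B"
proof
  note W = nondegenerate_pairD[OF nd]
  \<comment> \<open>\<open>W\<close> may leave \<open>U\<close> at nonsingular points, while
    \<Upsilon> and \<open>tau\<close> are given on \<open>U\<close>.\<close>
  define V where "V = W \<inter> U"
  have V: "open V" "V \<subseteq> W" "V \<subseteq> U" using W(1) U_open by (auto simp: V_def)
  note AV = vf_subset[OF W(3) V(2)] and BV = vf_subset[OF W(4) V(2)]
  let ?f = "\<lambda>q. Ups q (A q) (B q) (A q) (B q)"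
  {
    assume "smoothly_extendible M W Sig (sectional M g D A B)"
    then obtain F where F: "smooth_fun M W F" "\<And>q. q \<in> W - Sig \<Longrightarrow> F q = sectional M g D A B q"
      unfolding smoothly_extendible_def by blast
    show "Upsilon_vanishes M g Ups W A B"
      unfolding Upsilon_vanishes_def
    proof
      fix p assume "p \<in> Sig \<inter> W"
      then have p: "p \<in> Sig" "p \<in> U" "p \<in> V" using W(2) by (auto simp: V_def)
      \<comment> \<open>Both sides are smooth and agree off the singular set, where the denominator
        is cleared; at \<open>p\<close> the factor \<open>tau\<close> is 0.\<close>
      have "?f p = tau p * (det (gram g A B p) * F p)"
      proof (rule density_eq_smooth[OF V(1) p(3) Ups_smooth[OF V(1,3) AV BV]])
        show "smooth_fun M V (\<lambda>q. tau q * (det (gram g A B q) * F q))"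
          by (rule smooth_fun_mult[OF V(1) tau_smooth[OF V(1,3)] smooth_fun_mult[OF V(1)
                det_gram_smooth[OF V(1) AV BV] smooth_fun_subset[OF F(1) V(2)]]])
        fix q assume q: "q \<in> V" "q \<notin> Sig"
        then have "q \<in> W - Sig" "q \<in> W" using V(2) by auto
        then show "?f q = tau q * (det (gram g A B q) * F q)"
          using Ups_off[OF V(1,3) AV BV q] F(2)[of q] W(5)[of q] by (simp add: sectional_def)
      qed
      then show "?f p = 0" using tau_zero[OF p(1,2)] by simp
    qed
  next
    assume 0: "Upsilon_vanishes M g Ups W A B"
    show "smoothly_extendible M W Sig (sectional M g D A B)"
    proof (rule smoothly_extendible_localI[OF W(1)])
      let ?O = "W - Sig"
      have O: "open ?O" "?O \<subseteq> - Sig" by (auto intro: open_minus_singular[OF W(1)])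
      have AO: "VF ?O A" and BO: "VF ?O B"
        by (rule vf_subset[OF W(3)], blast, rule vf_subset[OF W(4)], blast)
      show "smooth_fun M ?O (sectional M g D A B)"
        unfolding sectional_def[abs_def]
        by (rule smooth_fun_divide[OF O(1) g_smooth[OF O(1) curvature_vf[OF lc O AO BO AO] BO]
              det_gram_smooth[OF O(1) AO BO]]) (use W(5) in blast)
    next
      fix p assume p: "p \<in> Sig" "p \<in> W"
      then have pU: "p \<in> U" and pV: "p \<in> V" using W(2) by (auto simp: V_def)
      obtain c where c: "c \<in> M" "p \<in> fst c" by (rule chart_cover)
      have f0: "?f q = 0" if "q \<in> V" "q \<in> Sig" for q
        using 0 that V(2) unfolding Upsilon_vanishes_def by blast
      obtain V1 h where V1: "open V1" "p \<in> V1" "V1 \<subseteq> V" "V1 \<subseteq> fst c" "smooth_fun M V1 h"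
        "\<And>q. q \<in> V1 \<Longrightarrow> ?f q = h q * gdet c q"
        by (rule hadamard_singular[OF c V(1) pV p(1) Ups_smooth[OF V(1,3) AV BV] f0])
          (assumption, assumption, rule that)
      obtain V2 k where V2: "open V2" "p \<in> V2" "V2 \<subseteq> U" "V2 \<subseteq> fst c" "smooth_fun M V2 k"
        "\<And>q. q \<in> V2 \<Longrightarrow> tau q = k q * gdet c q" "\<And>q. q \<in> V2 \<Longrightarrow> k q \<noteq> 0"
        by (rule tau_factor[OF p(1) pU c]) (rule that)
      define V' where "V' = V1 \<inter> V2"
      have V': "open V'" "p \<in> V'" "V' \<subseteq> W" "V' \<subseteq> V" "V' \<subseteq> V1" "V' \<subseteq> V2"
        using V1 V2 V by (auto simp: V'_def)
      \<comment> \<open>\<Upsilon> is \<open>h * gdet\<close> and \<open>tau\<close> is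
        \<open>k * gdet\<close>. The vanishing factor cancels and leaves a nonzero
        denominator.\<close>
      let ?d = "\<lambda>q. k q * det (gram g A B q)"
      have sh: "smooth_fun M V' (\<lambda>q. h q / ?d q)"
        by (rule smooth_fun_divide[OF V'(1) smooth_fun_subset[OF V1(5) V'(5)] smooth_fun_mult[OF V'(1)
              smooth_fun_subset[OF V2(5) V'(6)]
              det_gram_smooth[OF V'(1) vf_subset[OF W(3) V'(3)] vf_subset[OF W(4) V'(3)]]]])
          (use V2(7) W(5) V' in \<open>meson mult_eq_0_iff subsetD\<close>)
      have "h q / ?d q = sectional M g D A B q" if q: "q \<in> V'" "q \<notin> Sig" for q
      proof -
        have m: "q \<in> V" "q \<in> V1" "q \<in> V2" "q \<in> W" "q \<in> fst c" using q V' V2(4) by auto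
        let ?n = "g q (curvature M D A B A q) (B q)"
        have d0: "gdet c q \<noteq> 0" using singular_iff_gdet[OF c(1) m(5)] q(2) by simp
        have "h q * gdet c q = ?f q" by (rule V1(6)[OF m(2), symmetric])
        also have "\<dots> = tau q * ?n" by (rule Ups_off[OF V(1,3) AV BV m(1) q(2)])
        also have "\<dots> = (k q * ?n) * gdet c q" by (simp only: V2(6)[OF m(3)] mult_ac)
        finally have "h q = k q * ?n" using d0 by simp
        then show ?thesis using V2(7)[OF m(3)] W(5)[OF m(4)] by (simp add: sectional_def)
      qed
      then show "\<exists>V h. open V \<and> p \<in> V \<and> V \<subseteq> W \<and> smooth_fun M V h \<and>
          (\<forall>q\<in>V - Sig. h q = sectional M g D A B q)"
        using V'(1-3) sh by (intro exI[of _ V'] exI[of _ "\<lambda>q. h q / ?d q"]) simp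
    qed
  }
qed

subsection \<open>II-flatness\<close>

lemma screen_sectionI:
  assumes "open W" "VF W Y" "\<And>q. q \<in> W \<Longrightarrow> q \<in> Sig \<Longrightarrow> Y q \<in> screen M g N R q"
  shows "screen_section M g N R W Y"
  using assms unfolding screen_section_def smooth_along_def by blast

lemma screen_tangent: "v \<in> screen M g N R q \<Longrightarrow> v \<in> TSig q"
  by (simp add: screen_def)

lemma nu_rho_det:
  "det (vector [vector [a, b], vector [c, d]] :: real ^ 2 ^ 2) = a * d - b * c"
  by (simp add: det_2)

text \<open>With \<nu>, \<rho> and \<nu>', \<rho>' for \<open>A\<close> and \<open>B\<close>, the
  expression II(A,A) II(B,B) - II(A,B)^2 becomes 4 \<nu> \<rho> \<nu>' \<rho>' - (\<nu> \<rho>' +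
  \<rho> \<nu>')^2, which is minus a square.\<close>

lemma II_flat_Ups:
  assumes flat: "II_flat M g N R U" and nd: "nondegenerate_pair M g U W A B"
    and p: "p \<in> Sig" "p \<in> W"
  shows "Ups p (A p) (B p) (A p) (B p) =
    - (nu g N p (A p) * rho M g N R p (B p) - nu g N p (B p) * rho M g N R p (A p))\<^sup>2"
proof -
  note W = nondegenerate_pairD[OF nd]
  have pU: "p \<in> U" by (rule W(2)[OF p])
  define W0 where "W0 = W \<inter> U"
  have W0: "open W0" "p \<in> W0" "W0 \<subseteq> U" "W0 \<subseteq> W" using W(1) U_open p pU by (auto simp: W0_def)
  note A0 = vf_subset[OF W(3) W0(4)] and B0 = vf_subset[OF W(4) W0(4)]
  obtain V1 S1 where V1: "open V1" "p \<in> V1" "V1 \<subseteq> W0" "VF V1 S1"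
    "\<And>q. q \<in> V1 \<Longrightarrow> q \<in> Sig \<Longrightarrow> S1 q \<in> screen M g N R q"
    "\<And>q. q \<in> V1 \<Longrightarrow> q \<in> Sig \<Longrightarrow>
      A q = (\<lambda>f. nu g N q (A q) * NN q f + S1 q f + rho M g N R q (A q) * RR q f)"
    by (rule screen_projection[OF W0(1-3) p(1) A0]) (rule that)
  obtain V2 S2 where V2: "open V2" "p \<in> V2" "V2 \<subseteq> W0" "VF V2 S2"
    "\<And>q. q \<in> V2 \<Longrightarrow> q \<in> Sig \<Longrightarrow> S2 q \<in> screen M g N R q"
    "\<And>q. q \<in> V2 \<Longrightarrow> q \<in> Sig \<Longrightarrow>
      B q = (\<lambda>f. nu g N q (B q) * NN q f + S2 q f + rho M g N R q (B q) * RR q f)"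
    by (rule screen_projection[OF W0(1-3) p(1) B0]) (rule that)
  define V where "V = V1 \<inter> V2"
  have V: "open V" "p \<in> V" "V \<subseteq> U" "V \<subseteq> V1" "V \<subseteq> V2" "V \<subseteq> W"
    using V1(1-3) V2(1-3) W0 by (auto simp: V_def)
  note AV = vf_subset[OF W(3) V(6)] and BV = vf_subset[OF W(4) V(6)]
    and S1 = vf_subset[OF V1(4) V(4)] and S2 = vf_subset[OF V2(4) V(5)] and RV = RR_vf[OF V(3)]
  have c1: "S1 q \<in> screen M g N R q" and c2: "S2 q \<in> screen M g N R q" if "q \<in> V" "q \<in> Sig" for q
    using V1(5) V2(5) V(4,5) that by blast+
  note e1 = V1(6)[OF V1(2) p(1)] and e2 = V2(6)[OF V2(2) p(1)]
  note t1 = screen_tangent[OF c1] and t2 = screen_tangent[OF c2]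
  have d1: "dual S1 RR NN p = 0"
    using screen_iff[OF V(1-3) p(1) S1 t1] c1[OF V(2) p(1)] by blast
  have d2: "dual S2 RR NN p = 0"
    using screen_iff[OF V(1-3) p(1) S2 t2] c2[OF V(2) p(1)] by blast
  have z: "dual S S' RR p = 0"
    if s: "screen_section M g N R V S" "screen_section M g N R V S'"
      and v: "VF V S" "VF V S'" for S S'
  proof -
    have "II M g p (R p) (S p) (S' p) = 0"
      using flat s V(1-3) p(1) unfolding II_flat_def by blast
    then show ?thesis
      using II_eq[OF V(1,2) v RV RR_rad[OF p(1) pU]] RR_eq[OF p(1) pU] by simp
  qed
  note s1 = screen_sectionI[OF V(1) S1 c1] and s2 = screen_sectionI[OF V(1) S2 c2]
  note ex = dual_RR_decompose[OF V(1-3) p(1)]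
  have "dual A A RR p = 2 * nu g N p (A p) * rho M g N R p (A p)"
    using ex[OF AV S1 AV S1 e1 e1 t1[OF V(2) p(1)] t1[OF V(2) p(1)] d1 d1] z[OF s1 s1 S1 S1] by simp
  moreover have "dual B B RR p = 2 * nu g N p (B p) * rho M g N R p (B p)"
    using ex[OF BV S2 BV S2 e2 e2 t2[OF V(2) p(1)] t2[OF V(2) p(1)] d2 d2] z[OF s2 s2 S2 S2] by simp
  moreover have "dual A B RR p =
      nu g N p (A p) * rho M g N R p (B p) + rho M g N R p (A p) * nu g N p (B p)"
    using ex[OF AV S1 BV S2 e1 e2 t1[OF V(2) p(1)] t2[OF V(2) p(1)] d1 d2] z[OF s1 s2 S1 S2] by simp
  ultimately show ?thesis
    using Ups_formula[OF V(1-3) p(1) AV BV] by (simp add: power2_eq_square algebra_simps)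
qed

text \<open>At \<open>p\<close> the test vector N + R is a unit vector orthogonal to
  \<open>Y\<close>, so the Gram determinant is the square of \<open>Y p\<close>: nonzero in the
  second case, while \<open>screen_null\<close> settles the first. The hypothesis then yields
  II(Y,Y) * 2 = II(Y, N + R)^2 = 0.\<close>

lemma screen_square_zero:
  assumes hyp: "\<And>W A B. nondegenerate_pair M g U W A B \<Longrightarrow> nu_rho_det_vanishes M g N R W A B \<Longrightarrow>
      Upsilon_vanishes M g Ups W A B"
    and W: "open W" "p \<in> W" "W \<subseteq> U" and p: "p \<in> Sig" and Y: "VF W Y"
    and scr: "\<And>q. q \<in> W \<Longrightarrow> q \<in> Sig \<Longrightarrow> Y q \<in> screen M g N R q"
  shows "dual Y Y RR p = 0"
proof (cases "g p (Y p) (Y p) = 0")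
  case True
  show ?thesis by (rule screen_null[OF W p Y screen_tangent[OF scr[OF W(2) p]] True])
next
  case False
  have pU: "p \<in> U" using W by blast
  note NW = NN_vf[OF W(3)] and RW = RR_vf[OF W(3)]
  let ?B = "\<lambda>q f. 1 * NN q f + 1 * RR q f"
  have B: "VF W ?B" by (rule vf_const_combination[OF W(1) NW RW])
  have tan: "Y q \<in> TSig q" if "q \<in> W" "q \<in> Sig" for q
    by (rule screen_tangent[OF scr[OF that]])
  have gYN: "g q (Y q) (N q) = 0" if q: "q \<in> W" "q \<in> Sig" for q
  proof -
    have qU: "q \<in> U" using q W by blast
    have "g q (N q) (Y q) = 0" by (rule N_orth[OF q(2) qU tan[OF q]])
    then show ?thesis
      using g_sym[OF vf_tangent[OF Y q(1)] vf_tangent[OF NW q(1)]] NN_eq[OF q(2) qU] by simp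
  qed
  \<comment> \<open>Nondegeneracy is checked at \<open>p\<close> and required on the whole domain,
    hence the restriction to the open set where the Gram determinant is nonzero.\<close>
  define V where "V = W \<inter> (\<lambda>q. det (gram g Y ?B q)) -` (- {0})"
  have oV: "open V" unfolding V_def
    by (rule continuous_open_preimage[OF smooth_fun_continuous[OF det_gram_smooth[OF W(1) Y B] W(1)] W(1)])
      (simp add: open_Compl)
  have T: "Y p \<in> TM p" "NN p \<in> TM p" "RR p \<in> TM p"
    "?B p \<in> TM p"
    by (rule vf_tangent[OF Y W(2)] vf_tangent[OF NW W(2)] vf_tangent[OF RW W(2)] vf_tangent[OF B W(2)])+
  note rad = RR_rad[OF p pU]
  have gYB: "g p (Y p) (?B p) = 0"
    using g_lin_right[OF T(2,3,1), of 1 1] gYN[OF W(2) p] NN_eq[OF p pU] radicalD_right[OF rad T(1)]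
    by simp
  have "g p (?B p) (?B p) = 1 * g p (NN p) (?B p) + 1 * g p (RR p) (?B p)"
    by (rule g_lin_left[OF T(2,3,4)])
  also have "\<dots> = 1"
    using g_lin_right[OF T(2,3,2), of 1 1] radicalD[OF rad T(4)] radicalD_right[OF rad T(2)]
      N_unit[OF p pU] NN_eq[OF p pU] by simp
  finally have gBB: "g p (?B p) (?B p) = 1" .
  have pV: "p \<in> V" using False W(2) gYB gBB by (simp add: V_def det_gram)
  have VW: "V \<subseteq> W" by (simp add: V_def)
  have nd: "nondegenerate_pair M g U V Y ?B"
    unfolding nondegenerate_pair_def rank_gram
    using oV VW W(3) vf_subset[OF Y VW] vf_subset[OF B VW] by (auto simp: V_def)
  have nr: "nu_rho_det_vanishes M g N R V Y ?B"
    unfolding nu_rho_det_vanishes_def nu_rho_det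
  proof
    fix q assume "q \<in> Sig \<inter> V"
    then have q: "q \<in> W" "q \<in> Sig" using VW by auto
    have n0: "nu g N q (Y q) = 0" using gYN[OF q] by (simp add: nu_def)
    then have "rho M g N R q (Y q) = 0"
      using scr[OF q] by (simp add: rho_def screen_def)
    with n0 show "nu g N q (Y q) * rho M g N R q (?B q) - nu g N q (?B q) * rho M g N R q (Y q) = 0"
      by simp
  qed
  have "Ups p (Y p) (?B p) (Y p) (?B p) = 0"
    using hyp[OF nd nr] p pV unfolding Upsilon_vanishes_def by blast
  then have U0: "dual Y Y RR p * dual ?B ?B RR p = (dual Y ?B RR p)\<^sup>2"
    using Ups_formula[OF W p Y B] by simp
  have d: "dual Y RR NN p = 0"
    using screen_iff[OF W p Y tan] scr[OF W(2) p] by blast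
  note tp = tan[OF W(2) p]
  have YR: "dual Y RR RR p = 0" by (rule dual_tangent_RR_RR[OF W p Y tp])
  have YN: "dual Y NN RR p = 0" using dual_tangent_NN_RR[OF W p Y tp] d by simp
  have YB: "dual Y ?B RR p = 0"
    using dual_lin_2[OF W(1,2) Y NW RW RW, of 1 1] YR YN by simp
  have "dual ?B ?B RR p = 1 * dual NN ?B RR p + 1 * dual RR ?B RR p"
    by (rule dual_lin_1[OF W(1,2) NW RW B RW])
  also have "\<dots> = 2"
    using dual_lin_2[OF W(1,2) NW NW RW RW, of 1 1] dual_lin_2[OF W(1,2) RW NW RW RW, of 1 1]
      dual_NN_NN_RR[OF W p] dual_NN_RR_RR[OF W p] dual_RR_NN_RR[OF W p] dual_tangent_RR_RR[OF W p RW RR_tan[OF p pU]] by simp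
  finally show ?thesis using U0 YB by simp
qed

text \<open>Polarization of \<open>screen_square_zero\<close>. Screen sections live along the
  hypersurface only, so they are first extended to vector fields near \<open>p\<close>; their sum is
  again a screen field, which gives the mixed term.\<close>

lemma II_flatI:
  assumes hyp: "\<And>W A B. nondegenerate_pair M g U W A B \<Longrightarrow> nu_rho_det_vanishes M g N R W A B \<Longrightarrow>
      Upsilon_vanishes M g Ups W A B"
  shows "II_flat M g N R U"
  unfolding II_flat_def
proof (intro allI impI ballI, elim conjE)
  fix W X Y p
  assume W: "open W" "W \<subseteq> U" and X: "screen_section M g N R W X" and Y: "screen_section M g N R W Y"
    and "p \<in> Sig \<inter> W"
  then have p: "p \<in> Sig" "p \<in> W" and pU: "p \<in> U" by auto
  obtain V1 X' where V1: "open V1" "p \<in> V1" "VF V1 X'"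
    "\<And>q. q \<in> V1 \<Longrightarrow> q \<in> Sig \<Longrightarrow> q \<in> W \<Longrightarrow> X' q = X q"
    using X p unfolding screen_section_def smooth_along_def by blast
  obtain V2 Y' where V2: "open V2" "p \<in> V2" "VF V2 Y'"
    "\<And>q. q \<in> V2 \<Longrightarrow> q \<in> Sig \<Longrightarrow> q \<in> W \<Longrightarrow> Y' q = Y q"
    using Y p unfolding screen_section_def smooth_along_def by blast
  define V where "V = W \<inter> V1 \<inter> V2"
  have V: "open V" "p \<in> V" "V \<subseteq> U" "V \<subseteq> V1" "V \<subseteq> V2" "V \<subseteq> W"
    using W V1(1,2) V2(1,2) p by (auto simp: V_def)
  note XV = vf_subset[OF V1(3) V(4)] and YV = vf_subset[OF V2(3) V(5)] and RV = RR_vf[OF V(3)]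
  have sX: "X' q \<in> screen M g N R q" and sY: "Y' q \<in> screen M g N R q" if q: "q \<in> V" "q \<in> Sig" for q
  proof -
    have m: "q \<in> V1" "q \<in> V2" "q \<in> W" using q V by auto
    have "X q \<in> screen M g N R q" "Y q \<in> screen M g N R q"
      using X Y m(3) q(2) unfolding screen_section_def by blast+
    then show "X' q \<in> screen M g N R q" "Y' q \<in> screen M g N R q"
      using V1(4)[OF m(1) q(2) m(3)] V2(4)[OF m(2) q(2) m(3)] by auto
  qed
  let ?Z = "\<lambda>q f. 1 * X' q f + 1 * Y' q f"
  have ZV: "VF V ?Z" by (rule vf_const_combination[OF V(1) XV YV])
  have tZ: "?Z q \<in> TSig q" if q: "q \<in> V" "q \<in> Sig" for q
    by (rule tangent_sub_combination[OF screen_tangent[OF sX[OF q]] screen_tangent[OF sY[OF q]]])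
  have sZ: "?Z q \<in> screen M g N R q" if q: "q \<in> V" "q \<in> Sig" for q
  proof -
    note NV = NN_vf[OF V(3)]
    have "dual X' RR NN q = 0"
      using screen_iff[OF V(1) q(1) V(3) q(2) XV screen_tangent[OF sX]] sX[OF q] by blast
    moreover have "dual Y' RR NN q = 0"
      using screen_iff[OF V(1) q(1) V(3) q(2) YV screen_tangent[OF sY]] sY[OF q] by blast
    ultimately have "dual ?Z RR NN q = 0"
      using dual_lin_1[OF V(1) q(1) XV YV RV NV, of 1 1] by simp
    then show ?thesis using screen_iff[OF V(1) q(1) V(3) q(2) ZV tZ] by blast
  qed
  note sq = screen_square_zero[OF hyp V(1-3) p(1)]
  have "dual ?Z ?Z RR p = 1 * dual X' ?Z RR p + 1 * dual Y' ?Z RR p"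
    by (rule dual_lin_1[OF V(1,2) XV YV ZV RV])
  also have "\<dots> = dual X' X' RR p + dual X' Y' RR p +
      (dual Y' X' RR p + dual Y' Y' RR p)"
    using dual_lin_2[OF V(1,2) XV XV YV RV, of 1 1] dual_lin_2[OF V(1,2) YV XV YV RV, of 1 1] by simp
  finally have "dual X' Y' RR p = 0"
    using sq[OF _ _ ZV sZ] sq[OF _ _ XV sX] sq[OF _ _ YV sY] dual_RR_sym[OF V(1-3) p(1) YV XV] by simp
  then have "II M g p (RR p) (X' p) (Y' p) = 0"
    using II_eq[OF V(1,2) XV YV RV RR_rad[OF p(1) pU]] by simp
  then show "II M g p (R p) (X p) (Y p) = 0"
    using RR_eq[OF p(1) pU] V1(4)[OF V1(2) p] V2(4)[OF V2(2) p] by simp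
qed

end

theorem proposition15:
  fixes M :: "('a::{t2_space, second_countable_topology}, 'm::finite) chart set"
    and g :: "'a metric_field"
    and D :: "'a vfield \<Rightarrow> 'a vfield \<Rightarrow> 'a vfield"
    and U :: "'a set"
    and N R NN RR :: "'a vfield"
    and Ups :: "'a \<Rightarrow> 'a tvec \<Rightarrow> 'a tvec \<Rightarrow> 'a tvec \<Rightarrow> 'a tvec \<Rightarrow> real"
  assumes "smooth_structure M" and "connected (UNIV :: 'a set)" and "CARD('m) > 2"
    and "transverse_singular M g" and "tangent_radical M g" and "riemann_lorentz M g"
    and "levi_civita M g (- singular_set M g) D"
    and "open U"
    and "main_normal M g U N" and "main_radical M g U N R"
    and "geodesic_extension M g D U N NN" and "canonical_extension M g U NN R RR"
    and "is_Upsilon M g D U RR Ups"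
  shows "(\<forall>W A B. nondegenerate_pair M g U W A B \<longrightarrow>
            (smoothly_extendible M W (singular_set M g) (sectional M g D A B) \<longleftrightarrow>
             Upsilon_vanishes M g Ups W A B)) \<and>
         ((\<forall>W A B. nondegenerate_pair M g U W A B \<longrightarrow>
              nu_rho_det_vanishes M g N R W A B \<longrightarrow> Upsilon_vanishes M g Ups W A B) \<longleftrightarrow>
          II_flat M g N R U) \<and>
         (II_flat M g N R U \<longrightarrow>
          (\<forall>W A B. nondegenerate_pair M g U W A B \<longrightarrow>
              Upsilon_vanishes M g Ups W A B \<longrightarrow> nu_rho_det_vanishes M g N R W A B))"
proof -
  have "smooth_symmetric M g" using assms(4) unfolding transverse_singular_def by blast
  then interpret singular_setup M g D U N R NN RR Ups
    using assms by unfold_locales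
  \<comment> \<open>By \<open>II_flat_Ups\<close>, \<Upsilon> is minus the square of the
    determinant, so both vanish together. This yields (2) \<Longrightarrow> (1) and (2)
    \<Longrightarrow> (3) at once.\<close>
  have flat: "Upsilon_vanishes M g Ups W A B \<longleftrightarrow> nu_rho_det_vanishes M g N R W A B"
    if "II_flat M g N R U" "nondegenerate_pair M g U W A B" for W A B
    unfolding Upsilon_vanishes_def nu_rho_det_vanishes_def nu_rho_det
    by (rule ball_cong[OF refl]) (simp add: II_flat_Ups[OF that])
  show ?thesis
    using sectional_extendible_iff II_flatI flat by (intro conjI allI impI iffI) blast+
qed

end
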